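(* Let $A_1\in\mathbb C^{n_1\times n_1}$, $A_2\in\mathbb C^{n_2\times n_2}$ with $\sigma(A_1)\cup\sigma(A_2)\subset\mathbb D$, let $C\in\mathbb C^{m\times n}$, $n=n_1+n_2$, and let $M,N,F$ be as in the context. Let $s\in\mathcal S_\kappa^{p\times q}$ have Kreĭn–Langer factorizations $s=b_\ell^{-1}s_\ell=s_rb_r^{-1}$ and assume that for every $u\in\mathbb C^n$ $$[b_\ell\ \ -s_\ell]Fu\in H_2^p\quad\text{and}\quad[-s_r^*\ \ b_r^*]Fu\in(H_2^q)^\perp.$$ Then the matrix $P_s$ is a solution of the Lyapunov–Stein equation: $M^*P_sM-N^*P_sN=C^*j_{pq}C$.
   Context: Notation. $p,q\ge1$, $m=p+q$, $j_{pq}=\begin{bmatrix}I_p&0\\0&-I_q\end{bmatrix}$, $\mathbb D=\{|\lambda|<1\}$, $\mathbb T=\partial\mathbb D$, "mvf" = matrix valued function. $L_2^k$ is the space of $\mathbb C^k$-valued square integrable functions on $\mathbb T$ with $\langle f,g\rangle=\frac1{2\pi}\int_0^{2\pi}g(e^{i\theta})^*f(e^{i\theta})\,d\theta$; $H_2^k\subset L_2^k$ is the Hardy space of $\mathbb D$, $(H_2^k)^\perp=L_2^k\ominus H_2^k$, and $P_+,P_-$ are the orthogonal projections onto $H_2^k$, $(H_2^k)^\perp$. Generalized Schur class. $\mathcal S_\kappa^{p\times q}$ is the set of $p\times q$ mvf's $s$ meromorphic in $\mathbb D$ for which the kernel $\frac{I_p-s(\lambda)s(\omega)^*}{1-\lambda\overline\omega}$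 has $\kappa$ negative squares on the domain of holomorphy of $s$ in $\mathbb D$ (all the associated finite Hermitian Gram matrices have at most $\kappa$ negative eigenvalues, and some has exactly $\kappa$). $\mathcal S^{p\times q}=\mathcal S_0^{p\times q}$ is the Schur class. A Blaschke–Potapov product of degree $\kappa$ is, up to a constant unitary factor, a product of $\kappa$ factors $I-\Pi+\frac{\lambda-\alpha}{1-\overline\alpha\lambda}\Pi$ with $\alpha\in\mathbb D$, $\Pi$ a rank one orthogonal projection. Every $s\in\mathcal S_\kappa^{p\times q}$ has Kreĭn–Langer factorizations $s=b_\ell^{-1}s_\ell=s_rb_r^{-1}$ with $b_\ell$ ($p\times p$), $b_r$ ($q\times q$) Blaschke–Potapov products of degree $\kappa$, $s_\ell,s_r\in\mathcal S^{p\times q}$, $\operatorname{rank}[b_\ell\ s_\ell]=p$ and $\operatorname{rank}[b_r^*\ s_r^*]=q$ at every point of $\mathbb D$. The boundary values of $s$ on $\mathbb T$ exist a.e. and are contractive. Data. $n_1,n_2\ge0$, $n=n_1+n_2\ge1$, $M=\begin{bmatrix}A_1&0\\0&I_{n_2}\end{bmatrix}$, $N=\begin{bmatrix}I_{n_1}&0\\0&A_2\end{bmatrix}$, $F(\lambda)=C(M-\lambda N)^{-1}$. (If $n_1=0$ or $n_2=0$ the corresponding blocks are absent.) The matrix $P_s$. For $s\in\mathcal S_\kappa^{p\times q}$ let $\Delta_s=\begin{bmatrix}I_p&-s\\-s^*&I_q\end{bmatrix}$ on $\mathbb T$, $\mathcal H(b_r)=H_2^q\ominus b_rH_2^q$,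 $\mathcal H_*(b_\ell)=(H_2^p)^\perp\ominus b_\ell^*(H_2^p)^\perp$. The operator $Y_\ell:h\in\mathcal H_*(b_\ell)\mapsto P_+s^*h$ is a bijection onto $\mathcal H(b_r)$; put $\Gamma_\ell f=Y_\ell^{-1}P_{\mathcal H(b_r)}f$ for $f\in L_2^q$ (with $P_{\mathcal H(b_r)}$ the orthogonal projection), so $\Gamma_\ell:L_2^q\to\mathcal H_*(b_\ell)\subset L_2^p$, with adjoint $\Gamma_\ell^*$. The matrix $P_s\in\mathbb C^{n\times n}$ is defined by $$v^*P_su=\Big\langle\Big\{\Delta_s+\Delta_s\begin{bmatrix}0&\Gamma_\ell\\\Gamma_\ell^*&0\end{bmatrix}\Delta_s\Big\}Fu,Fv\Big\rangle,\quad u,v\in\mathbb C^n.$$ *)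

theory Defs
  imports
    "HOL-Complex_Analysis.Complex_Analysis"
    "Jordan_Normal_Form.Spectral_Radius"
    "Jordan_Normal_Form.Schur_Decomposition"
    "Jordan_Normal_Form.Gauss_Jordan_Elimination"
    "Jordan_Normal_Form.DL_Rank"
begin

unbundle no vec_syntax and no inner_syntax

text \<open>
  Matrices and vectors are those of \<open>Jordan_Normal_Form\<close>, so all sizes are ordinary natural
  numbers and may be zero.  The scalar product \<open>v \<bullet>c w\<close> is $w^* v$, linear in \<open>v\<close>.
\<close>


section \<open>Matrices\<close>

definition jmat :: "nat \<Rightarrow> nat \<Rightarrow> complex mat" where
  "jmat p q = four_block_mat (1\<^sub>m p) (0\<^sub>m p q) (0\<^sub>m q p) (- 1\<^sub>m q)"

definition hcat :: "complex mat \<Rightarrow> complex mat \<Rightarrow> complex mat" where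
  "hcat A B = four_block_mat A B (0\<^sub>m 0 (dim_col A)) (0\<^sub>m 0 (dim_col B))"

text \<open>
  \<^const>\<open>mat_inverse\<close> returns \<open>None\<close> on singular matrices; then the value is unspecified.
\<close>

definition minv :: "complex mat \<Rightarrow> complex mat" where
  "minv A = the (mat_inverse A)"

definition Mmat :: "nat \<Rightarrow> nat \<Rightarrow> complex mat \<Rightarrow> complex mat" where
  "Mmat n1 n2 A1 = four_block_mat A1 (0\<^sub>m n1 n2) (0\<^sub>m n2 n1) (1\<^sub>m n2)"

definition Nmat :: "nat \<Rightarrow> nat \<Rightarrow> complex mat \<Rightarrow> complex mat" where
  "Nmat n1 n2 A2 = four_block_mat (1\<^sub>m n1) (0\<^sub>m n1 n2) (0\<^sub>m n2 n1) A2"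

definition Fmat :: "complex mat \<Rightarrow> complex mat \<Rightarrow> complex mat \<Rightarrow> complex \<Rightarrow> complex mat" where
  "Fmat C M N z = C * minv (M - z \<cdot>\<^sub>m N)"


section \<open>The generalized Schur class\<close>

text \<open>Number of negative eigenvalues of a Hermitian matrix, with multiplicity.\<close>

definition neg_eigs :: "complex mat \<Rightarrow> nat" where
  "neg_eigs A = size (filter_mset (\<lambda>x. x \<in> \<real> \<and> Re x < 0) (proots (char_poly A)))"

text \<open>
  A meromorphic matrix function is given by the representative each of whose entries is analytic
  wherever it has no pole (and is \<open>0\<close> at its poles).
\<close>

definition meromorphic_mvf :: "nat \<Rightarrow> nat \<Rightarrow> (complex \<Rightarrow> complex mat) \<Rightarrow> bool" where
  "meromorphic_mvf p q s \<longleftrightarrow>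
     (\<forall>z\<in>ball 0 1. s z \<in> carrier_mat p q) \<and>
     (\<forall>i<p. \<forall>j<q. (\<lambda>z. s z $$ (i, j)) nicely_meromorphic_on ball 0 1)"

definition hol_domain :: "nat \<Rightarrow> nat \<Rightarrow> (complex \<Rightarrow> complex mat) \<Rightarrow> complex set" where
  "hol_domain p q s =
     {z \<in> ball 0 1. \<forall>i<p. \<forall>j<q. (\<lambda>w. s w $$ (i, j)) analytic_on {z}}"

definition schur_kernel ::
  "nat \<Rightarrow> (complex \<Rightarrow> complex mat) \<Rightarrow> complex \<Rightarrow> complex \<Rightarrow> complex mat" where
  "schur_kernel p s z w = (1 / (1 - z * cnj w)) \<cdot>\<^sub>m (1\<^sub>m p - s z * mat_adjoint (s w))"

text \<open>
  The entry at \<open>(i, j)\<close> is $u_i^* K(\omega_i, \omega_j) u_j$, for the list \<open>xs\<close> of pairs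
  \<open>(\<omega>\<^sub>i, u\<^sub>i)\<close>.
\<close>

definition gram :: "(complex \<Rightarrow> complex \<Rightarrow> complex mat) \<Rightarrow> (complex \<times> complex vec) list \<Rightarrow> complex mat"
  where
  "gram K xs = Matrix.mat (length xs) (length xs)
     (\<lambda>(i, j). (K (fst (xs ! i)) (fst (xs ! j)) *\<^sub>v snd (xs ! j)) \<bullet>c snd (xs ! i))"

definition has_neg_squares ::
  "nat \<Rightarrow> (complex \<Rightarrow> complex \<Rightarrow> complex mat) \<Rightarrow> complex set \<Rightarrow> nat \<Rightarrow> bool" where
  "has_neg_squares p K \<Omega> \<kappa> \<longleftrightarrow>
     (\<forall>xs. set xs \<subseteq> \<Omega> \<times> carrier_vec p \<longrightarrow> neg_eigs (gram K xs) \<le> \<kappa>) \<and>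
     (\<exists>xs. set xs \<subseteq> \<Omega> \<times> carrier_vec p \<and> neg_eigs (gram K xs) = \<kappa>)"

definition gen_schur :: "nat \<Rightarrow> nat \<Rightarrow> nat \<Rightarrow> (complex \<Rightarrow> complex mat) set" where
  "gen_schur \<kappa> p q =
     {s. meromorphic_mvf p q s \<and> has_neg_squares p (schur_kernel p s) (hol_domain p q s) \<kappa>}"

abbreviation schur_class :: "nat \<Rightarrow> nat \<Rightarrow> (complex \<Rightarrow> complex mat) set" where
  "schur_class \<equiv> gen_schur 0"

text \<open>
  None of the above looks at the values of \<open>s\<close> on the unit circle.  As in the usual notation, \<open>s\<close>
  also denotes its boundary function: \<open>bdry_values p q s\<close> fixes that convention, namely
  that \<open>s\<close> takes on the circle the values of its radial limits almost everywhere.  By Fatou's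
  theorem every function in the generalized Schur class can be extended to the circle in this
  way, uniquely up to a null set.
\<close>

definition bdry_values :: "nat \<Rightarrow> nat \<Rightarrow> (complex \<Rightarrow> complex mat) \<Rightarrow> bool" where
  "bdry_values p q s \<longleftrightarrow>
     (\<forall>z\<in>sphere 0 1. s z \<in> carrier_mat p q) \<and>
     (AE t in lebesgue_on {0..2 * pi}. \<forall>i<p. \<forall>j<q.
        ((\<lambda>r. s (of_real r * cis t) $$ (i, j)) \<longlongrightarrow> s (cis t) $$ (i, j)) (at_left (1::real)))"


section \<open>Blaschke--Potapov products and Krein--Langer factorizations\<close>

definition bp_factor :: "nat \<Rightarrow> complex \<times> complex mat \<Rightarrow> complex \<Rightarrow> complex mat" where
  "bp_factor k = (\<lambda>(a, E) z. 1\<^sub>m k - E + ((z - a) / (1 - cnj a * z)) \<cdot>\<^sub>m E)"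

definition rank1_projections :: "nat \<Rightarrow> complex mat set" where
  "rank1_projections k =
     {E \<in> carrier_mat k k. E * E = E \<and> mat_adjoint E = E \<and> vec_space.rank k E = 1}"

definition bp_product :: "nat \<Rightarrow> nat \<Rightarrow> (complex \<Rightarrow> complex mat) \<Rightarrow> bool" where
  "bp_product \<kappa> k b \<longleftrightarrow>
     (\<exists>U xs. U \<in> carrier_mat k k \<and> mat_adjoint U * U = 1\<^sub>m k \<and>
        length xs = \<kappa> \<and> set xs \<subseteq> ball 0 1 \<times> rank1_projections k \<and>
        (\<forall>z\<in>cball 0 1. b z = U * foldr (\<lambda>x B. bp_factor k x z * B) xs (1\<^sub>m k)))"

definition left_KL ::
  "nat \<Rightarrow> nat \<Rightarrow> nat \<Rightarrow> (complex \<Rightarrow> complex mat) \<Rightarrow> (complex \<Rightarrow> complex mat) \<Rightarrow>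
   (complex \<Rightarrow> complex mat) \<Rightarrow> bool" where
  "left_KL \<kappa> p q s bl sl \<longleftrightarrow>
     bp_product \<kappa> p bl \<and> sl \<in> schur_class p q \<and>
     (\<forall>z\<in>hol_domain p q s. invertible_mat (bl z) \<longrightarrow> s z = minv (bl z) * sl z) \<and>
     (\<forall>z\<in>ball 0 1. vec_space.rank p (hcat (bl z) (sl z)) = p)"

definition right_KL ::
  "nat \<Rightarrow> nat \<Rightarrow> nat \<Rightarrow> (complex \<Rightarrow> complex mat) \<Rightarrow> (complex \<Rightarrow> complex mat) \<Rightarrow>
   (complex \<Rightarrow> complex mat) \<Rightarrow> bool" where
  "right_KL \<kappa> p q s br sr \<longleftrightarrow>
     bp_product \<kappa> q br \<and> sr \<in> schur_class p q \<and>
     (\<forall>z\<in>hol_domain p q s. invertible_mat (br z) \<longrightarrow> s z = sr z * minv (br z)) \<and>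
     (\<forall>z\<in>ball 0 1. vec_space.rank q (hcat (mat_adjoint (br z)) (mat_adjoint (sr z))) = q)"


section \<open>Square integrable functions on the unit circle\<close>

text \<open>
  Elements of $L_2^k$ are represented by functions on the circle, which are to be identified
  when they agree almost everywhere; values off the circle are irrelevant.
\<close>

definition L2 :: "nat \<Rightarrow> (complex \<Rightarrow> complex vec) set" where
  "L2 k = {f. (\<forall>z\<in>sphere 0 1. f z \<in> carrier_vec k) \<and>
     (\<forall>i<k. (\<lambda>t. f (cis t) $ i) \<in> borel_measurable (lebesgue_on {0..2 * pi}) \<and>
            integrable (lebesgue_on {0..2 * pi}) (\<lambda>t. (cmod (f (cis t) $ i))\<^sup>2))}"

definition ae_eq :: "(complex \<Rightarrow> complex vec) \<Rightarrow> (complex \<Rightarrow> complex vec) \<Rightarrow> bool" where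
  "ae_eq f g \<longleftrightarrow> (AE t in lebesgue_on {0..2 * pi}. f (cis t) = g (cis t))"

definition ip :: "(complex \<Rightarrow> complex vec) \<Rightarrow> (complex \<Rightarrow> complex vec) \<Rightarrow> complex" where
  "ip f g = (1 / (2 * pi)) * (LINT t|lebesgue_on {0..2 * pi}. f (cis t) \<bullet>c g (cis t))"

definition fourier :: "(complex \<Rightarrow> complex vec) \<Rightarrow> nat \<Rightarrow> int \<Rightarrow> complex" where
  "fourier f i j =
     (1 / (2 * pi)) * (LINT t|lebesgue_on {0..2 * pi}. f (cis t) $ i * cis (- of_int j * t))"

text \<open>The Hardy space as a subspace of $L_2^k$.\<close>

definition H2 :: "nat \<Rightarrow> (complex \<Rightarrow> complex vec) set" where
  "H2 k = {f \<in> L2 k. \<forall>i<k. \<forall>j<0. fourier f i j = 0}"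

definition ominus ::
  "(complex \<Rightarrow> complex vec) set \<Rightarrow> (complex \<Rightarrow> complex vec) set \<Rightarrow> (complex \<Rightarrow> complex vec) set"
  where "ominus V W = {f \<in> V. \<forall>g\<in>W. ip f g = 0}"

definition H2perp :: "nat \<Rightarrow> (complex \<Rightarrow> complex vec) set" where
  "H2perp k = ominus (L2 k) (H2 k)"

text \<open>
  Operators on $L_2^k$ return some representative of the value, which is unique up to
  equality almost everywhere.
\<close>

definition proj ::
  "(complex \<Rightarrow> complex vec) set \<Rightarrow> (complex \<Rightarrow> complex vec) \<Rightarrow> complex \<Rightarrow> complex vec" where
  "proj W f = (SOME g. g \<in> W \<and> (\<forall>h\<in>W. ip (\<lambda>z. f z - g z) h = 0))"

definition mult_op ::
  "(complex \<Rightarrow> complex mat) \<Rightarrow> (complex \<Rightarrow> complex vec) \<Rightarrow> complex \<Rightarrow> complex vec" where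
  "mult_op G f = (\<lambda>z. G z *\<^sub>v f z)"

abbreviation adj :: "(complex \<Rightarrow> complex mat) \<Rightarrow> complex \<Rightarrow> complex mat" where
  "adj G \<equiv> (\<lambda>z. mat_adjoint (G z))"

definition adjoint_op ::
  "nat \<Rightarrow> ((complex \<Rightarrow> complex vec) \<Rightarrow> complex \<Rightarrow> complex vec) \<Rightarrow>
   (complex \<Rightarrow> complex vec) \<Rightarrow> complex \<Rightarrow> complex vec" where
  "adjoint_op k T g = (SOME f. f \<in> L2 k \<and> (\<forall>h\<in>L2 k. ip (T h) g = ip h f))"


section \<open>The matrix $P_s$\<close>

definition Hspace :: "nat \<Rightarrow> (complex \<Rightarrow> complex mat) \<Rightarrow> (complex \<Rightarrow> complex vec) set" where
  "Hspace q br = ominus (H2 q) (mult_op br ` H2 q)"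

definition Hstar :: "nat \<Rightarrow> (complex \<Rightarrow> complex mat) \<Rightarrow> (complex \<Rightarrow> complex vec) set" where
  "Hstar p bl = ominus (H2perp p) (mult_op (adj bl) ` H2perp p)"

definition Yop ::
  "nat \<Rightarrow> (complex \<Rightarrow> complex mat) \<Rightarrow> (complex \<Rightarrow> complex vec) \<Rightarrow> complex \<Rightarrow> complex vec" where
  "Yop q s h = proj (H2 q) (mult_op (adj s) h)"

definition Gop ::
  "nat \<Rightarrow> nat \<Rightarrow> (complex \<Rightarrow> complex mat) \<Rightarrow> (complex \<Rightarrow> complex mat) \<Rightarrow>
   (complex \<Rightarrow> complex mat) \<Rightarrow> (complex \<Rightarrow> complex vec) \<Rightarrow> complex \<Rightarrow> complex vec" where
  "Gop p q s bl br f = (SOME h. h \<in> Hstar p bl \<and> ae_eq (Yop q s h) (proj (Hspace q br) f))"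

definition Delta :: "nat \<Rightarrow> nat \<Rightarrow> (complex \<Rightarrow> complex mat) \<Rightarrow> complex \<Rightarrow> complex mat" where
  "Delta p q s z = four_block_mat (1\<^sub>m p) (- s z) (- mat_adjoint (s z)) (1\<^sub>m q)"

definition offdiag_op ::
  "nat \<Rightarrow> nat \<Rightarrow> ((complex \<Rightarrow> complex vec) \<Rightarrow> complex \<Rightarrow> complex vec) \<Rightarrow>
   ((complex \<Rightarrow> complex vec) \<Rightarrow> complex \<Rightarrow> complex vec) \<Rightarrow>
   (complex \<Rightarrow> complex vec) \<Rightarrow> complex \<Rightarrow> complex vec" where
  "offdiag_op p q S T g =
     (\<lambda>z. S (\<lambda>w. vec_last (g w) q) z @\<^sub>v T (\<lambda>w. vec_first (g w) p) z)"

definition P_operator ::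
  "nat \<Rightarrow> nat \<Rightarrow> (complex \<Rightarrow> complex mat) \<Rightarrow> (complex \<Rightarrow> complex mat) \<Rightarrow>
   (complex \<Rightarrow> complex mat) \<Rightarrow> (complex \<Rightarrow> complex vec) \<Rightarrow> complex \<Rightarrow> complex vec" where
  "P_operator p q s bl br f =
     (let D = mult_op (Delta p q s); G = Gop p q s bl br in
      (\<lambda>z. D f z + D (offdiag_op p q G (adjoint_op q G) (D f)) z))"

definition Pmat ::
  "nat \<Rightarrow> nat \<Rightarrow> nat \<Rightarrow> (complex \<Rightarrow> complex mat) \<Rightarrow> (complex \<Rightarrow> complex mat) \<Rightarrow>
   (complex \<Rightarrow> complex mat) \<Rightarrow> (complex \<Rightarrow> complex mat) \<Rightarrow> complex mat" where
  "Pmat p q n s bl br F = (THE P. P \<in> carrier_mat n n \<and>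
     (\<forall>u\<in>carrier_vec n. \<forall>v\<in>carrier_vec n.
        (P *\<^sub>v u) \<bullet>c v =
          ip (P_operator p q s bl br (\<lambda>z. F z *\<^sub>v u)) (\<lambda>z. F z *\<^sub>v v)))"

end

theory Submission imports Defs begin

text \<open>
  For \<open>f = F u\<close> let \<open>\<phi> = f\<^sub>1 - s f\<^sub>2\<close> and \<open>\<psi> = f\<^sub>2 - s\<^sup>* f\<^sub>1\<close> be the components of
  \<open>\<Delta> f\<close>, let \<open>h = \<Gamma> \<psi>\<close>, and mark by primes what belongs to \<open>f' = F v\<close>.  Then \<open>v\<^sup>* P u\<close> is the
  value at \<open>f, f'\<close> of the form
    \<open>[f, f'] = \<langle>\<Delta> f, f'\<rangle> + \<langle>h, \<phi>'\<rangle> + \<langle>\<phi>, h'\<rangle>\<close>.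
  As \<open>b\<^sub>l s = s\<^sub>l\<close> and \<open>s b\<^sub>r = s\<^sub>r\<close> on the circle, the two assumptions on \<open>F\<close> say that
  \<open>b\<^sub>l \<phi> \<in> H\<^sub>2\<close> and \<open>b\<^sub>r\<^sup>* \<psi> \<bottom> H\<^sub>2\<close>; the second one makes \<open>s\<^sup>* h - \<psi>\<close> orthogonal to all of
  \<open>H\<^sub>2\<close> (\<open>\<Gamma>_residual\<close>).

  Since \<open>F (M - z N) = C\<close>, the functions \<open>f = F M u\<close> and \<open>g = F N u\<close> and the constant \<open>c = C u\<close>
  satisfy \<open>f = c + z g\<close>, and the theorem says that \<open>[f, f'] - [g, g'] = c'\<^sup>* j c\<close>.  In the part
  \<open>\<langle>\<Delta> f, f'\<rangle>\<close> the shift drops out except for terms that involve the constants.  What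
  is to be understood is how \<open>h\<^sub>f\<close> is related to \<open>h\<^sub>g\<close>.  Let \<open>k = c\<^sub>1 + h\<^sub>f - z h\<^sub>g\<close>.  Then
  \<open>b = b\<^sub>l k\<close> is in \<open>H\<^sub>2\<close>.  If \<open>b'\<close> is its backward shift, then \<open>b\<^sub>l\<^sup>* b'\<close> and
  \<open>s\<^sup>* b\<^sub>l\<^sup>* b'\<close> turn out to be orthogonal to \<open>H\<^sub>2\<close>, so that \<open>b\<^sub>l\<^sup>* b'\<close> is in the kernel of
  \<open>Y\<close>.  But \<open>Y\<close> is injective, so \<open>b'\<close> vanishes and \<open>b\<^sub>l k\<close> is constant.  Therefore \<open>k\<close> is
  orthogonal to \<open>z x\<close> whenever \<open>b\<^sub>l x \<in> H\<^sub>2\<close> (\<open>shift_defect\<close>), in particular to \<open>z \<phi>\<^sub>g'\<close>.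
  With this relation the difference of the two forms is computed by expanding \<open>f = c + z g\<close>
  and \<open>f' = c' + z g'\<close> (\<open>cross_term\<close>, \<open>form_difference\<close>).

  Injectivity of \<open>Y\<close> is where coprimeness of \<open>b\<^sub>l\<close> and \<open>s\<^sub>l\<close> enters.  If \<open>Y h = 0\<close>, then
  \<open>b = b\<^sub>l h\<close> lies in a space that is invariant under the backward shift and orthogonal to
  \<open>p H\<^sub>2\<close>, for a polynomial \<open>p\<close> with zeros in the disc.  Were \<open>b\<close> not zero, splitting off the
  zeros of \<open>p\<close> one by one would lead to an eigenvector \<open>v / (1 - cnj a z)\<close> of the backward
  shift in this space, and Cauchy's formula would give \<open>v\<^sup>* [b\<^sub>l(a) s\<^sub>l(a)] = 0\<close>, contrary
  to the rank condition (\<open>coprime_trivial_kernel\<close>, \<open>Y_injective\<close>).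

  The operators \<open>\<Gamma>\<close> and \<open>\<Gamma>\<^sup>*\<close>, which are defined by choice, exist for a finite dimensional
  reason.  Induction over the elementary factors gives orthonormal bases with \<open>\<kappa>\<close> elements
  of both \<open>H(b\<^sub>r)\<close> and \<open>H\<^sub>*(b\<^sub>l) = b\<^sub>l\<^sup>* H(b\<^sub>l)\<close> (\<open>bp_product_structure\<close>).  In them \<open>Y\<close> is a
  square matrix, which is invertible because \<open>Y\<close> is injective (\<open>det_T\<close>).  Thus all
  projections that occur are finite sums.  That \<open>H\<^sub>2\<close> is in turn the orthocomplement of its
  orthocomplement (\<open>H2_I_orth\<close>) holds because membership in \<open>H\<^sub>2\<close> is tested by the monomials
  with negative exponents.
\<close>

section \<open>Square integrable and bounded functions on the circle\<close>

(* Leaves the infix $ to the entries of vectors. *)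
no_notation fps_nth (infixl "$" 75)

abbreviation circ :: "real measure" where
  "circ \<equiv> lebesgue_on {0..2 * pi}"

definition sq_integrable :: "(real \<Rightarrow> complex) \<Rightarrow> bool" where
  "sq_integrable a \<longleftrightarrow> a \<in> borel_measurable circ \<and> integrable circ (\<lambda>t. (cmod (a t))\<^sup>2)"

definition ess_bounded :: "(real \<Rightarrow> complex) \<Rightarrow> bool" where
  "ess_bounded a \<longleftrightarrow> a \<in> borel_measurable circ \<and> (\<exists>B. AE t in circ. cmod (a t) \<le> B)"

lemma finite_measure_circ: "finite_measure circ"
  by (rule finite_measure_lebesgue_on) auto

lemma sq_integrable_add:
  assumes "sq_integrable a" "sq_integrable b"
  shows "sq_integrable (\<lambda>t. a t + b t)"
proof -
  have m: "a \<in> borel_measurable circ" "b \<in> borel_measurable circ"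
    and i: "integrable circ (\<lambda>t. 2 * (cmod (a t))\<^sup>2 + 2 * (cmod (b t))\<^sup>2)"
    using assms by (auto simp: sq_integrable_def)
  have "integrable circ (\<lambda>t. (cmod (a t + b t))\<^sup>2)"
  proof (rule Bochner_Integration.integrable_bound[OF i])
    show "(\<lambda>t. (cmod (a t + b t))\<^sup>2) \<in> borel_measurable circ" using m by measurable
    have "(cmod (x + y))\<^sup>2 \<le> 2 * (cmod x)\<^sup>2 + 2 * (cmod y)\<^sup>2" for x y
    proof -
      have "(cmod (x + y))\<^sup>2 \<le> (cmod x + cmod y)\<^sup>2"
        by (intro power_mono norm_triangle_ineq) auto
      also have "\<dots> \<le> 2 * (cmod x)\<^sup>2 + 2 * (cmod y)\<^sup>2"
        using zero_le_power2[of "cmod x - cmod y"] by (simp add: power2_eq_square algebra_simps)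
      finally show ?thesis .
    qed
    then show "AE t in circ. norm ((cmod (a t + b t))\<^sup>2)
        \<le> norm (2 * (cmod (a t))\<^sup>2 + 2 * (cmod (b t))\<^sup>2)"
      by auto
  qed
  then show ?thesis using m by (auto simp: sq_integrable_def)
qed

lemma sq_integrable_mult:
  assumes "ess_bounded g" "sq_integrable a"
  shows "sq_integrable (\<lambda>t. g t * a t)"
proof -
  obtain B where B: "AE t in circ. cmod (g t) \<le> B" using assms by (auto simp: ess_bounded_def)
  have m: "a \<in> borel_measurable circ" "g \<in> borel_measurable circ"
    and i: "integrable circ (\<lambda>t. B\<^sup>2 * (cmod (a t))\<^sup>2)"
    using assms by (auto simp: sq_integrable_def ess_bounded_def)
  have "integrable circ (\<lambda>t. (cmod (g t * a t))\<^sup>2)"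
  proof (rule Bochner_Integration.integrable_bound[OF i])
    show "(\<lambda>t. (cmod (g t * a t))\<^sup>2) \<in> borel_measurable circ" using m by measurable
    show "AE t in circ. norm ((cmod (g t * a t))\<^sup>2) \<le> norm (B\<^sup>2 * (cmod (a t))\<^sup>2)"
      using B by eventually_elim (auto simp: norm_mult power_mult_distrib intro!: mult_right_mono power_mono)
  qed
  then show ?thesis using m by (auto simp: sq_integrable_def)
qed

lemma sq_integrable_prod_integrable:
  assumes "sq_integrable a" "sq_integrable b"
  shows "integrable circ (\<lambda>t. a t * cnj (b t))"
proof -
  have m: "a \<in> borel_measurable circ" "b \<in> borel_measurable circ"
    and i: "integrable circ (\<lambda>t. (cmod (a t))\<^sup>2 + (cmod (b t))\<^sup>2)"
    using assms by (auto simp: sq_integrable_def)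
  show ?thesis
  proof (rule Bochner_Integration.integrable_bound[OF i])
    show "(\<lambda>t. a t * cnj (b t)) \<in> borel_measurable circ" using m
      by (auto intro!: borel_measurable_times borel_measurable_continuous_on[of cnj] continuous_intros)
    have "cmod x * cmod y \<le> (cmod x)\<^sup>2 + (cmod y)\<^sup>2" for x y
    proof -
      have "0 \<le> cmod x * cmod y" by simp
      with sum_squares_bound[of "cmod x" "cmod y"] show ?thesis by linarith
    qed
    then show "AE t in circ. norm (a t * cnj (b t)) \<le> norm ((cmod (a t))\<^sup>2 + (cmod (b t))\<^sup>2)"
      by (auto simp: norm_mult)
  qed
qed

lemma ess_bounded_const [simp]: "ess_bounded (\<lambda>t. c)"
  by (auto simp: ess_bounded_def intro!: exI[of _ "cmod c"])

lemma ess_bounded_cnj: "ess_bounded a \<Longrightarrow> ess_bounded (\<lambda>t. cnj (a t))"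
  by (auto simp: ess_bounded_def intro!: borel_measurable_continuous_on[of cnj] continuous_intros)

lemma ess_bounded_add:
  assumes "ess_bounded a" "ess_bounded b" shows "ess_bounded (\<lambda>t. a t + b t)"
proof -
  obtain A B where "AE t in circ. cmod (a t) \<le> A" "AE t in circ. cmod (b t) \<le> B"
    using assms by (auto simp: ess_bounded_def)
  then have "AE t in circ. cmod (a t + b t) \<le> A + B"
    by eventually_elim (rule norm_triangle_le, simp)
  then show ?thesis using assms by (auto simp: ess_bounded_def)
qed

lemma ess_bounded_mult:
  assumes "ess_bounded a" "ess_bounded b" shows "ess_bounded (\<lambda>t. a t * b t)"
proof -
  obtain A B where "AE t in circ. cmod (a t) \<le> A" "AE t in circ. cmod (b t) \<le> B"
    using assms by (auto simp: ess_bounded_def)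
  then have "AE t in circ. cmod (a t * b t) \<le> A * B"
    by eventually_elim (auto simp: norm_mult intro!: mult_mono order_trans[OF norm_ge_zero])
  then show ?thesis using assms by (auto simp: ess_bounded_def)
qed

lemma ess_bounded_sum:
  "(\<And>i. i \<in> I \<Longrightarrow> ess_bounded (a i)) \<Longrightarrow> ess_bounded (\<lambda>t. \<Sum>i\<in>I. a i t)"
  by (induction I rule: infinite_finite_induct) (auto intro: ess_bounded_add)

lemma ess_bounded_sq_integrable: "ess_bounded a \<Longrightarrow> sq_integrable a"
  using sq_integrable_mult[of a "\<lambda>_. 1"] finite_measure.integrable_const[OF finite_measure_circ, of "1::real"]
  by (simp add: sq_integrable_def)

lemma sq_integrable_sum:
  "(\<And>i. i \<in> I \<Longrightarrow> sq_integrable (a i)) \<Longrightarrow> sq_integrable (\<lambda>t. \<Sum>i\<in>I. a i t)"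
  by (induction I rule: infinite_finite_induct)
    (auto intro: sq_integrable_add ess_bounded_sq_integrable[OF ess_bounded_const])

lemma ess_bounded_continuous:
  assumes "continuous_on (sphere 0 1) a"
  shows "ess_bounded (\<lambda>t. a (cis t))"
proof -
  have "continuous_on {0..2 * pi} (\<lambda>t. a (cis t))"
    by (rule continuous_on_compose2[OF assms]) (auto intro!: continuous_intros)
  then have m: "(\<lambda>t. a (cis t)) \<in> borel_measurable circ"
    by (rule continuous_imp_measurable_on_sets_lebesgue) auto
  have "compact (a ` sphere 0 1)"
    by (rule compact_continuous_image[OF assms]) auto
  then have "bounded (a ` sphere 0 1)" by (rule compact_imp_bounded)
  then obtain B where "\<forall>x\<in>a ` sphere 0 1. norm x \<le> B" unfolding bounded_iff by auto
  then have "cmod (a (cis t)) \<le> B" for t by (metis imageI mem_sphere_0 norm_cis)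
  then show ?thesis using m by (auto simp: ess_bounded_def)
qed

lemma complete_measure_circ: "complete_measure circ"
proof
  fix A B assume AB: "B \<subseteq> A" "A \<in> null_sets circ"
  then have "A \<in> null_sets lebesgue" "A \<subseteq> {0..2*pi}" 
    by (auto simp: null_sets_restrict_space)
  then have "B \<in> null_sets lebesgue" using AB(1) by (metis completion.complete2)
  then show "B \<in> sets circ" using AB \<open>A \<subseteq> {0..2*pi}\<close>
    by (auto simp: sets_restrict_space_iff null_sets_def)
qed
text \<open>
  Lebesgue measure is complete, so measurability passes to almost everywhere equal functions.
  This is what makes \<open>L\<^sub>2\<close> and the scalar product blind to the choice of representatives.
\<close>

lemma measurable_circ_AE_cong:
  assumes "f \<in> borel_measurable circ" "AE t in circ. f t = g t"
  shows "g \<in> borel_measurable circ"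
proof (rule measurableI)
  fix A :: "'a set" assume A: "A \<in> sets borel"
  have "f -` A \<inter> space circ \<in> sets circ" using assms(1) A by (rule measurable_sets)
  then show "g -` A \<inter> space circ \<in> sets circ"
    by (rule complete_measure.in_sets_AE[OF complete_measure_circ, rotated])
      (use assms(2) in \<open>auto elim!: eventually_mono\<close>)
qed auto

lemma integral_circ_cong_AE:
  fixes f g :: "real \<Rightarrow> 'a :: {banach, second_countable_topology}"
  assumes "AE t in circ. f t = g t"
  shows "integral\<^sup>L circ f = integral\<^sup>L circ g"
proof (cases "f \<in> borel_measurable circ")
  case True
  then show ?thesis
    using assms measurable_circ_AE_cong[OF True assms] by (intro integral_cong_AE)
next
  case False
  moreover have "g \<notin> borel_measurable circ"
    using False assms by (auto dest!: measurable_circ_AE_cong[where g = f] elim!: eventually_mono)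
  ultimately have "\<not> integrable circ f" "\<not> integrable circ g"
    using borel_measurable_integrable by blast+
  then show ?thesis by (simp add: not_integrable_integral_eq)
qed

section \<open>Adjoint matrices and scalar products\<close>

lemma mat_adjoint_carrier [simp, intro]:
  "A \<in> carrier_mat k l \<Longrightarrow> mat_adjoint A \<in> carrier_mat l k"
  by (auto simp: mat_adjoint_def mat_of_rows_def)

lemma mat_adjoint_dim [simp]:
  "dim_row (mat_adjoint A) = dim_col A" "dim_col (mat_adjoint A) = dim_row A"
  by (auto simp: mat_adjoint_def mat_of_rows_def)

lemma mat_adjoint_index [simp]:
  fixes A :: "complex mat"
  assumes "i < dim_col A" "j < dim_row A"
  shows "mat_adjoint A $$ (i, j) = cnj (A $$ (j, i))"
  using assms by (simp add: mat_adjoint_def mat_of_rows_def)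

lemma mat_adjoint_adjoint [simp]: "mat_adjoint (mat_adjoint A) = (A :: complex mat)"
  by (intro eq_matI) auto

lemma mat_adjoint_mult:
  fixes A B :: "complex mat"
  assumes "A \<in> carrier_mat k l" "B \<in> carrier_mat l m"
  shows "mat_adjoint (A * B) = mat_adjoint B * mat_adjoint A"
  using assms by (intro eq_matI) (auto simp: scalar_prod_def mult.commute)

lemma mat_adjoint_one [simp]: "mat_adjoint (1\<^sub>m k :: complex mat) = 1\<^sub>m k"
  by (intro eq_matI) auto

lemma cscalar_prod_sum:
  fixes v w :: "complex vec"
  shows "w \<in> carrier_vec k \<Longrightarrow> v \<bullet>c w = (\<Sum>i<k. v $ i * cnj (w $ i))"
  by (auto simp: scalar_prod_def lessThan_atLeast0)

lemma cscalar_prod_mat_left: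
  fixes A :: "complex mat"
  assumes A: "A \<in> carrier_mat k l" and v: "v \<in> carrier_vec l" and w: "w \<in> carrier_vec k"
  shows "(A *\<^sub>v v) \<bullet>c w = v \<bullet>c (mat_adjoint A *\<^sub>v w)"
proof -
  have "(A *\<^sub>v v) \<bullet>c w = (\<Sum>i<k. \<Sum>j<l. A $$ (i, j) * v $ j * cnj (w $ i))"
    using A v w by (auto simp: cscalar_prod_sum[of _ k] scalar_prod_def sum_distrib_right
        lessThan_atLeast0 intro!: sum.cong)
  also have "\<dots> = (\<Sum>j<l. \<Sum>i<k. A $$ (i, j) * v $ j * cnj (w $ i))"
    by (rule sum.swap)
  also have "\<dots> = v \<bullet>c (mat_adjoint A *\<^sub>v w)"
    using A v w by (auto simp: cscalar_prod_sum[of _ l] scalar_prod_def sum_distrib_left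
        lessThan_atLeast0 mult_ac intro!: sum.cong)
  finally show ?thesis .
qed

lemma cscalar_prod_unit_vec [simp]:
  "i < k \<Longrightarrow> v \<in> carrier_vec k \<Longrightarrow> v \<bullet>c unit_vec k i = (v $ i :: complex)"
  by (simp add: cscalar_prod_sum[of _ k] unit_vec_def if_distrib cong: if_cong)

lemma smult_zero_vec [simp]: "a \<cdot>\<^sub>v 0\<^sub>v k = (0\<^sub>v k :: complex vec)"
  by (intro eq_vecI) auto

lemma hcat_carrier:
  assumes "A \<in> carrier_mat k a" "B \<in> carrier_mat k b"
  shows "hcat A B \<in> carrier_mat k (a + b)"
  using assms four_block_carrier_mat[OF assms(1), of "0\<^sub>m 0 b" 0 b] by (simp add: hcat_def)

lemma smult_mat_vec:
  fixes A :: "complex mat"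
  shows "A \<in> carrier_mat k l \<Longrightarrow> v \<in> carrier_vec l \<Longrightarrow> (a \<cdot>\<^sub>m A) *\<^sub>v v = a \<cdot>\<^sub>v (A *\<^sub>v v)"
  by (intro eq_vecI) (auto simp: scalar_prod_def sum_distrib_left mult_ac)

section \<open>Determinants and inverses\<close>

lemma det_tendsto:
  fixes A :: "'b \<Rightarrow> complex mat"
  assumes A: "\<forall>\<^sub>F x in F. A x \<in> carrier_mat n n" and B: "B \<in> carrier_mat n n"
    and lim: "\<And>i j. i < n \<Longrightarrow> j < n \<Longrightarrow> ((\<lambda>x. A x $$ (i, j)) \<longlongrightarrow> B $$ (i, j)) F"
  shows "((\<lambda>x. Determinant.det (A x)) \<longlongrightarrow> Determinant.det B) F"
proof -
  have "((\<lambda>x. \<Sum>\<pi>\<in>{\<pi>. \<pi> permutes {0..<n}}. signof \<pi> * (\<Prod>i = 0..<n. A x $$ (i, \<pi> i))) \<longlongrightarrow>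
      (\<Sum>\<pi>\<in>{\<pi>. \<pi> permutes {0..<n}}. signof \<pi> * (\<Prod>i = 0..<n. B $$ (i, \<pi> i)))) F"
    by (intro tendsto_sum tendsto_mult tendsto_const tendsto_prod lim)
      (auto dest: permutes_in_image)
  then have "((\<lambda>x. \<Sum>\<pi>\<in>{\<pi>. \<pi> permutes {0..<n}}. signof \<pi> * (\<Prod>i = 0..<n. A x $$ (i, \<pi> i))) \<longlongrightarrow>
      Determinant.det B) F"
    using B by (simp add: det_def')
  then show ?thesis
    by (rule Lim_transform_eventually) (use A in \<open>auto elim!: eventually_mono simp: det_def'\<close>)
qed

lemma minv_eq:
  assumes A: "A \<in> carrier_mat n n" and B: "B \<in> carrier_mat n n"
    and AB: "A * B = 1\<^sub>m n" "B * A = 1\<^sub>m n"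
  shows "minv A = B"
proof (cases "mat_inverse A")
  case None
  have "A \<in> Units (ring_mat TYPE(complex) n ())"
    using A B AB by (auto simp: Units_def ring_mat_def)
  with mat_inverse(1)[OF A None, where b = "()"] show ?thesis by blast
next
  case (Some B')
  have B': "A * B' = 1\<^sub>m n" "B' * A = 1\<^sub>m n" "B' \<in> carrier_mat n n"
    using mat_inverse(2)[OF A Some] by auto
  have "B' = B' * (A * B)" using B' AB by simp
  also have "\<dots> = (B' * A) * B" by (rule assoc_mult_mat[OF B'(3) A B, symmetric])
  also have "\<dots> = B" using B' B by simp
  finally show ?thesis by (simp add: minv_def Some)
qed

lemma minv_adj_mat:
  assumes A: "A \<in> carrier_mat n n" and d: "Determinant.det A \<noteq> 0"
  shows "minv A = (1 / Determinant.det A) \<cdot>\<^sub>m adj_mat A"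
    "A * minv A = 1\<^sub>m n" "minv A * A = 1\<^sub>m n" "minv A \<in> carrier_mat n n" "invertible_mat A"
proof -
  note ad = adj_mat[OF A]
  let ?B = "(1 / Determinant.det A) \<cdot>\<^sub>m adj_mat A"
  have Bc: "?B \<in> carrier_mat n n" using ad by simp
  have "A * ?B = (1 / Determinant.det A) \<cdot>\<^sub>m (A * adj_mat A)"
    by (rule mult_smult_distrib[OF A ad(1)])
  also have "\<dots> = 1\<^sub>m n" unfolding ad(2) using d by (intro eq_matI) auto
  finally have AB: "A * ?B = 1\<^sub>m n" .
  have "?B * A = (1 / Determinant.det A) \<cdot>\<^sub>m (adj_mat A * A)"
    by (rule mult_smult_assoc_mat[OF ad(1) A])
  also have "\<dots> = 1\<^sub>m n" unfolding ad(3) using d by (intro eq_matI) auto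
  finally have BA: "?B * A = 1\<^sub>m n" .
  show 1: "minv A = ?B" by (rule minv_eq[OF A Bc AB BA])
  show "A * minv A = 1\<^sub>m n" "minv A * A = 1\<^sub>m n" "minv A \<in> carrier_mat n n"
    unfolding 1 by (fact AB BA Bc)+
  have "inverts_mat A ?B" "inverts_mat ?B A" using AB BA A Bc by (auto simp: inverts_mat_def)
  then show "invertible_mat A" using A unfolding invertible_mat_def by auto
qed

section \<open>Square integrable vector functions\<close>

lemma L2_iff:
  "f \<in> L2 k \<longleftrightarrow> (\<forall>z\<in>sphere 0 1. f z \<in> carrier_vec k) \<and> (\<forall>i<k. sq_integrable (\<lambda>t. f (cis t) $ i))"
  by (auto simp: L2_def sq_integrable_def)

lemma L2_carrier: "f \<in> L2 k \<Longrightarrow> cmod z = 1 \<Longrightarrow> f z \<in> carrier_vec k"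
  by (auto simp: L2_iff)

lemma L2_dim [simp]: "f \<in> L2 k \<Longrightarrow> dim_vec (f (cis t)) = k"
  using L2_carrier[of f k "cis t"] by auto

lemma L2_cis [simp]: "f \<in> L2 k \<Longrightarrow> f (cis t) \<in> carrier_vec k"
  using L2_carrier[of f k "cis t"] by auto

lemma L2_sq: "f \<in> L2 k \<Longrightarrow> i < k \<Longrightarrow> sq_integrable (\<lambda>t. f (cis t) $ i)"
  by (auto simp: L2_iff)

lemma L2_I:
  assumes "\<And>z. cmod z = 1 \<Longrightarrow> f z \<in> carrier_vec k"
    and "\<And>i. i < k \<Longrightarrow> sq_integrable (\<lambda>t. f (cis t) $ i)"
  shows "f \<in> L2 k"
  using assms by (auto simp: L2_iff)

text \<open>
  The multipliers of \<open>L\<^sub>2\<close>: essentially bounded matrix functions on the circle.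
\<close>

definition Linf :: "nat \<Rightarrow> nat \<Rightarrow> (complex \<Rightarrow> complex mat) set" where
  "Linf k l = {G. (\<forall>z\<in>sphere 0 1. G z \<in> carrier_mat k l) \<and>
     (\<forall>i<k. \<forall>j<l. ess_bounded (\<lambda>t. G (cis t) $$ (i, j)))}"

lemma Linf_carrier: "G \<in> Linf k l \<Longrightarrow> cmod z = 1 \<Longrightarrow> G z \<in> carrier_mat k l"
  by (auto simp: Linf_def)

lemma Linf_cis [simp]: "G \<in> Linf k l \<Longrightarrow> G (cis t) \<in> carrier_mat k l"
  by (auto simp: Linf_def)

lemma Linf_bd: "G \<in> Linf k l \<Longrightarrow> i < k \<Longrightarrow> j < l \<Longrightarrow> ess_bounded (\<lambda>t. G (cis t) $$ (i, j))"
  by (auto simp: Linf_def)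

lemma Linf_I:
  assumes "\<And>z. cmod z = 1 \<Longrightarrow> G z \<in> carrier_mat k l"
    and "\<And>i j. i < k \<Longrightarrow> j < l \<Longrightarrow> ess_bounded (\<lambda>t. G (cis t) $$ (i, j))"
  shows "G \<in> Linf k l"
  using assms by (auto simp: Linf_def)

lemma Linf_adj [simp]: "G \<in> Linf k l \<Longrightarrow> adj G \<in> Linf l k"
proof (rule Linf_I)
  fix i j assume "G \<in> Linf k l" and ij: "i < l" "j < k"
  then have "dim_row (G (cis t)) = k" "dim_col (G (cis t)) = l" for t
    using Linf_cis by blast+
  then show "ess_bounded (\<lambda>t. mat_adjoint (G (cis t)) $$ (i, j))"
    using Linf_bd[OF \<open>G \<in> Linf k l\<close> ij(2,1)] ij by (simp add: ess_bounded_cnj)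
qed (auto simp: Linf_carrier)

lemma Linf_mult:
  assumes G: "G \<in> Linf k l" and H: "H \<in> Linf l m"
  shows "(\<lambda>z. G z * H z) \<in> Linf k m"
proof (rule Linf_I)
  fix z :: complex assume "cmod z = 1"
  then show "G z * H z \<in> carrier_mat k m"
    by (intro mult_carrier_mat[OF Linf_carrier[OF G] Linf_carrier[OF H]])
next
  fix i j assume ij: "i < k" "j < m"
  have "ess_bounded (\<lambda>t. \<Sum>r<l. G (cis t) $$ (i, r) * H (cis t) $$ (r, j))"
    using ij by (intro ess_bounded_sum ess_bounded_mult Linf_bd[OF G] Linf_bd[OF H]) auto
  moreover have "(\<Sum>r<l. G (cis t) $$ (i, r) * H (cis t) $$ (r, j)) = (G (cis t) * H (cis t)) $$ (i, j)" for t
    using ij Linf_cis[OF G, of t] Linf_cis[OF H, of t] by (simp add: scalar_prod_def lessThan_atLeast0)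
  ultimately show "ess_bounded (\<lambda>t. (G (cis t) * H (cis t)) $$ (i, j))" by simp
qed

lemma Linf_AE:
  assumes G: "G \<in> Linf k l" and ae: "AE t in circ. G (cis t) = H (cis t)"
    and c: "\<And>z. cmod z = 1 \<Longrightarrow> H z \<in> carrier_mat k l"
  shows "H \<in> Linf k l"
proof (rule Linf_I[OF c])
  fix i j assume "i < k" "j < l"
  then have b: "ess_bounded (\<lambda>t. G (cis t) $$ (i, j))" by (rule Linf_bd[OF G])
  then obtain B where m: "(\<lambda>t. G (cis t) $$ (i, j)) \<in> borel_measurable circ"
    and B: "AE t in circ. cmod (G (cis t) $$ (i, j)) \<le> B" by (auto simp: ess_bounded_def)
  have "(\<lambda>t. H (cis t) $$ (i, j)) \<in> borel_measurable circ"
    by (rule measurable_circ_AE_cong[OF m]) (use ae in \<open>auto elim!: eventually_mono\<close>)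
  moreover have "AE t in circ. cmod (H (cis t) $$ (i, j)) \<le> B"
    using B ae by eventually_elim simp
  ultimately show "ess_bounded (\<lambda>t. H (cis t) $$ (i, j))" by (auto simp: ess_bounded_def)
qed

lemma ae_eqI: "(\<And>z. cmod z = 1 \<Longrightarrow> f z = g z) \<Longrightarrow> ae_eq f g"
  by (auto simp: ae_eq_def)

lemma ae_eq_refl [simp]: "ae_eq f f"
  by (auto simp: ae_eq_def)

lemma ae_eq_sym: "ae_eq f g \<Longrightarrow> ae_eq g f"
  by (auto simp: ae_eq_def elim!: eventually_mono)

lemma ae_eq_trans: "ae_eq f g \<Longrightarrow> ae_eq g h \<Longrightarrow> ae_eq f h"
  unfolding ae_eq_def by (auto elim!: eventually_elim2)

lemma L2_ae:
  assumes "g \<in> L2 k" "ae_eq g f" "\<And>z. cmod z = 1 \<Longrightarrow> f z \<in> carrier_vec k"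
  shows "f \<in> L2 k"
proof (rule L2_I)
  fix i assume i: "i < k"
  have sq: "sq_integrable (\<lambda>t. g (cis t) $ i)" using assms(1) i by (rule L2_sq)
  have ae: "AE t in circ. g (cis t) $ i = f (cis t) $ i"
    using assms(2) unfolding ae_eq_def by eventually_elim simp
  have m: "(\<lambda>t. f (cis t) $ i) \<in> borel_measurable circ"
    by (rule measurable_circ_AE_cong[OF _ ae]) (use sq in \<open>auto simp: sq_integrable_def\<close>)
  have "integrable circ (\<lambda>t. (cmod (f (cis t) $ i))\<^sup>2)"
    by (rule integrable_cong_AE_imp[where g = "\<lambda>t. (cmod (g (cis t) $ i))\<^sup>2"])
      (use sq m ae in \<open>auto simp: sq_integrable_def elim!: eventually_mono\<close>)
  with m show "sq_integrable (\<lambda>t. f (cis t) $ i)" by (simp add: sq_integrable_def)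
qed (use assms in auto)

lemma L2_add [simp]: "f \<in> L2 k \<Longrightarrow> g \<in> L2 k \<Longrightarrow> (\<lambda>z. f z + g z) \<in> L2 k"
  by (rule L2_I) (auto simp: L2_carrier intro!: sq_integrable_add L2_sq)

lemma L2_smult_fun:
  assumes "f \<in> L2 k" "ess_bounded (\<lambda>t. a (cis t))"
  shows "(\<lambda>z. a z \<cdot>\<^sub>v f z) \<in> L2 k"
  using assms by (intro L2_I) (auto simp: L2_carrier intro!: sq_integrable_mult L2_sq)

lemma L2_smult [simp]: "f \<in> L2 k \<Longrightarrow> (\<lambda>z. a \<cdot>\<^sub>v f z) \<in> L2 k"
  by (rule L2_smult_fun) auto

lemma L2_minus [simp]: "f \<in> L2 k \<Longrightarrow> g \<in> L2 k \<Longrightarrow> (\<lambda>z. f z - g z) \<in> L2 k"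
  by (rule L2_ae[OF L2_add[of f k "\<lambda>z. (-1) \<cdot>\<^sub>v g z"]])
    (auto intro!: ae_eqI eq_vecI simp: L2_carrier carrier_vecD[OF L2_carrier])

lemma L2_const [simp]: "c \<in> carrier_vec k \<Longrightarrow> (\<lambda>z. c) \<in> L2 k"
  by (auto simp: L2_iff intro: ess_bounded_sq_integrable)

lemma L2_mult_op:
  assumes "G \<in> Linf k l" "f \<in> L2 l"
  shows "mult_op G f \<in> L2 k"
proof (rule L2_I)
  fix z assume "cmod z = 1"
  then show "mult_op G f z \<in> carrier_vec k"
    using assms by (auto simp: mult_op_def dest!: Linf_carrier L2_carrier)
next
  fix i assume i: "i < k"
  have "mult_op G f (cis t) $ i = (\<Sum>j<l. G (cis t) $$ (i, j) * f (cis t) $ j)" for t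
    using Linf_cis[OF assms(1), of t] L2_cis[OF assms(2), of t] i
    by (simp add: mult_op_def scalar_prod_def lessThan_atLeast0)
  then show "sq_integrable (\<lambda>t. mult_op G f (cis t) $ i)"
    using assms i by (auto intro!: sq_integrable_sum sq_integrable_mult Linf_bd L2_sq)
qed

lemma ip_integrable:
  assumes "f \<in> L2 k" "g \<in> L2 k"
  shows "integrable circ (\<lambda>t. f (cis t) \<bullet>c g (cis t))"
  using assms
  by (simp add: cscalar_prod_sum[of _ k])
    (auto intro!: Bochner_Integration.integrable_sum sq_integrable_prod_integrable L2_sq)

lemma ip_cong: "ae_eq f f' \<Longrightarrow> ae_eq g g' \<Longrightarrow> ip f g = ip f' g'"
  unfolding ip_def ae_eq_def
  by (intro arg_cong[of _ _ "\<lambda>x. _ * x"] integral_circ_cong_AE) (auto elim: eventually_elim2)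

lemma ip_cong_left: "(\<And>z. cmod z = 1 \<Longrightarrow> f z = f' z) \<Longrightarrow> ip f g = ip f' g"
  by (rule ip_cong[OF ae_eqI ae_eq_refl])

lemma ip_cong_right: "(\<And>z. cmod z = 1 \<Longrightarrow> g z = g' z) \<Longrightarrow> ip f g = ip f g'"
  by (rule ip_cong[OF ae_eq_refl ae_eqI])

lemma ip_eqI:
  "(\<And>z. cmod z = 1 \<Longrightarrow> f z \<bullet>c g z = f' z \<bullet>c g' z) \<Longrightarrow> ip f g = ip f' g'"
  unfolding ip_def by (auto intro!: integral_circ_cong_AE)

lemma ip_add_left:
  assumes "f \<in> L2 k" "g \<in> L2 k" "h \<in> L2 k"
  shows "ip (\<lambda>z. f z + g z) h = ip f h + ip g h"
proof -
  have "(f (cis t) + g (cis t)) \<bullet>c h (cis t) = f (cis t) \<bullet>c h (cis t) + g (cis t) \<bullet>c h (cis t)" for t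
    using assms by (intro add_scalar_prod_distrib[of _ k]) auto
  then show ?thesis
    using assms ip_integrable[of f k h] ip_integrable[of g k h]
    by (simp add: ip_def algebra_simps)
qed

lemma ip_smult_left:
  assumes "f \<in> L2 k" "h \<in> L2 k"
  shows "ip (\<lambda>z. a \<cdot>\<^sub>v f z) h = a * ip f h"
proof -
  have "(a \<cdot>\<^sub>v f (cis t)) \<bullet>c h (cis t) = a * (f (cis t) \<bullet>c h (cis t))" for t
    using assms by (intro smult_scalar_prod_distrib[of _ k]) auto
  then show ?thesis by (simp add: ip_def)
qed

lemma ip_cnj:
  assumes "f \<in> L2 k" "g \<in> L2 k"
  shows "ip f g = cnj (ip g f)"
proof -
  have "f (cis t) \<bullet>c g (cis t) = cnj (g (cis t) \<bullet>c f (cis t))" for t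
    using assms by (simp add: cscalar_prod_sum[of _ k] mult.commute)
  then show ?thesis by (simp add: ip_def)
qed

lemma ip_minus_left:
  assumes "f \<in> L2 k" "g \<in> L2 k" "h \<in> L2 k"
  shows "ip (\<lambda>z. f z - g z) h = ip f h - ip g h"
proof -
  have "ip (\<lambda>z. f z - g z) h = ip (\<lambda>z. f z + (-1) \<cdot>\<^sub>v g z) h"
    using assms by (intro ip_cong ae_eqI ae_eq_refl) (auto intro!: eq_vecI dest!: L2_carrier)
  then show ?thesis
    using assms by (simp add: ip_add_left[of _ k] ip_smult_left[of _ k])
qed

lemma ip_add_right:
  assumes "f \<in> L2 k" "g \<in> L2 k" "h \<in> L2 k"
  shows "ip h (\<lambda>z. f z + g z) = ip h f + ip h g"
  using assms by (simp add: ip_cnj[of h k] ip_add_left[of _ k])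

lemma ip_minus_right:
  assumes "f \<in> L2 k" "g \<in> L2 k" "h \<in> L2 k"
  shows "ip h (\<lambda>z. f z - g z) = ip h f - ip h g"
  using assms by (simp add: ip_cnj[of h k] ip_minus_left[of _ k])

lemma ip_smult_right:
  assumes "f \<in> L2 k" "h \<in> L2 k"
  shows "ip h (\<lambda>z. a \<cdot>\<^sub>v f z) = cnj a * ip h f"
  using assms by (simp add: ip_cnj[of h k] ip_smult_left[of _ k])

lemma ip_smult_fun:
  assumes "f \<in> L2 k" "g \<in> L2 k"
  shows "ip (\<lambda>z. a z \<cdot>\<^sub>v f z) g = ip f (\<lambda>z. cnj (a z) \<cdot>\<^sub>v g z)"
  using assms
  by (intro ip_eqI) (auto dest!: L2_carrier simp: cscalar_prod_sum[of _ k] mult_ac)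

lemma ip_mult_op:
  assumes "G \<in> Linf k l" "f \<in> L2 l" "g \<in> L2 k"
  shows "ip (mult_op G f) g = ip f (mult_op (adj G) g)"
  using assms unfolding mult_op_def
  by (intro ip_eqI cscalar_prod_mat_left[of _ k l]) (auto dest: L2_carrier Linf_carrier)

lemma ip_mult_op':
  assumes "G \<in> Linf k l" "f \<in> L2 k" "g \<in> L2 l"
  shows "ip (mult_op (adj G) f) g = ip f (mult_op G g)"
  using ip_mult_op[of "adj G" l k f g] assms by simp

lemma ip_self_zero:
  assumes f: "f \<in> L2 k" and 0: "ip f f = 0"
  shows "ae_eq f (\<lambda>_. 0\<^sub>v k)"
proof -
  have int: "integrable circ (\<lambda>t. \<Sum>i<k. (cmod (f (cis t) $ i))\<^sup>2)"
    using f by (auto intro!: Bochner_Integration.integrable_sum simp: L2_iff sq_integrable_def)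
  have "f (cis t) \<bullet>c f (cis t) = of_real (\<Sum>i<k. (cmod (f (cis t) $ i))\<^sup>2)" for t
    using f by (simp add: cscalar_prod_sum[of _ k] complex_norm_square del: of_real_power)
  then have "ip f f = (1 / (2 * pi)) * of_real (LINT t|circ. (\<Sum>i<k. (cmod (f (cis t) $ i))\<^sup>2))"
    by (simp add: ip_def flip: of_real_sum)
  then have "(LINT t|circ. (\<Sum>i<k. (cmod (f (cis t) $ i))\<^sup>2)) = 0"
    using 0 by (simp add: complex_eq_iff)
  then have "AE t in circ. (\<Sum>i<k. (cmod (f (cis t) $ i))\<^sup>2) = 0"
    using integral_nonneg_eq_0_iff_AE[OF int] by (simp add: sum_nonneg)
  then show ?thesis
    unfolding ae_eq_def
  proof eventually_elim
    case (elim t)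
    then have "\<forall>i<k. f (cis t) $ i = 0" by (simp add: sum_nonneg_eq_0_iff)
    then show ?case using f by (intro eq_vecI) auto
  qed
qed

lemma ip_const:
  assumes "c \<in> carrier_vec k" "d \<in> carrier_vec k"
  shows "ip (\<lambda>_. c) (\<lambda>_. d) = c \<bullet>c d"
proof -
  have "measure circ (space circ) = 2 * pi"
    by (simp add: measure_restrict_space)
  then show ?thesis by (simp add: ip_def scaleR_conv_of_real)
qed

section \<open>Fourier coefficients and the Hardy space\<close>

text \<open>
  The monomials \<open>z\<^sup>j\<close> in one coordinate; scalar products with them are the Fourier coefficients.
\<close>

definition trig :: "nat \<Rightarrow> nat \<Rightarrow> int \<Rightarrow> complex \<Rightarrow> complex vec" where
  "trig k i j = (\<lambda>z. z powi j \<cdot>\<^sub>v unit_vec k i)"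

lemma continuous_on_powi_sphere: "continuous_on (sphere 0 1) (\<lambda>z::complex. z powi j)"
  by (intro continuous_intros) auto

lemma ess_bounded_powi: "ess_bounded (\<lambda>t. cis t powi j)"
  by (rule ess_bounded_continuous[OF continuous_on_powi_sphere])

lemma ess_bounded_cis [simp]: "ess_bounded cis" "ess_bounded (\<lambda>t. cnj (cis t))"
  using ess_bounded_continuous[of "\<lambda>z. z"] ess_bounded_continuous[of cnj]
  by (auto intro!: continuous_intros)

lemma trig_L2 [simp]: "trig k i j \<in> L2 k"
  unfolding trig_def by (intro L2_smult_fun L2_const ess_bounded_powi) auto

lemma fourier_ip:
  assumes "f \<in> L2 k" "i < k"
  shows "fourier f i j = ip f (trig k i j)"
proof -
  have "f (cis t) \<bullet>c trig k i j (cis t) = f (cis t) $ i * cis (- of_int j * t)" for t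
  proof -
    have "conjugate (trig k i j (cis t)) = cis (- of_int j * t) \<cdot>\<^sub>v unit_vec k i"
      unfolding trig_def using assms
      by (intro eq_vecI) (auto simp: cis_power_int cis_cnj unit_vec_def)
    then show ?thesis using assms by (simp add: mult.commute)
  qed
  then show ?thesis by (simp add: fourier_def ip_def)
qed

lemma integral_cis_int:
  "(LINT t|circ. cis (of_int j * t)) = (if j = 0 then 2 * pi else 0)"
proof (cases "j = 0")
  case False
  define F where "F t = cis (of_int j * t) / (\<i> * of_int j)" for t :: real
  have "((\<lambda>t. cis (of_int j * t)) has_integral (F (2 * pi) - F 0)) {0..2 * pi}"
  proof (rule fundamental_theorem_of_calculus)
    fix t :: real
    show "(F has_vector_derivative cis (of_int j * t)) (at t within {0..2 * pi})"
      unfolding F_def cis_conv_exp using False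
      by (auto intro!: derivative_eq_intros has_vector_derivative_real_field simp: field_simps)
  qed auto
  moreover have "F (2 * pi) = F 0"
    using cis_multiple_2pi[of "of_int j"] by (simp add: F_def mult_ac)
  moreover have "(\<lambda>t. cis (of_int j * t)) absolutely_integrable_on {0..2 * pi}"
    by (intro absolutely_integrable_continuous_real continuous_intros)
  ultimately show ?thesis
    using False by (simp add: lebesgue_integral_eq_integral set_integrable_def
        integrable_restrict_space integral_unique absolutely_integrable_on_def)
qed (simp add: scaleR_conv_of_real measure_restrict_space)

lemma ip_trig:
  assumes "i < k" "i' < k"
  shows "ip (trig k i j) (trig k i' j') = (if i = i' \<and> j = j' then 1 else 0)"
proof -
  have "ip (trig k i j) (trig k i' j') = fourier (trig k i j) i' j'"
    using assms by (simp add: fourier_ip[of _ k])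
  moreover have "trig k i j (cis t) $ i' * cis (- of_int j' * t) =
      (if i = i' then cis (of_int (j - j') * t) else 0)" for t
    using assms by (auto simp: trig_def cis_power_int cis_mult algebra_simps)
  ultimately show ?thesis
    by (cases "i = i'") (auto simp: fourier_def integral_cis_int simp del: of_int_diff)
qed

lemma H2_I:
  assumes "f \<in> L2 k" "\<And>i j. i < k \<Longrightarrow> j < 0 \<Longrightarrow> ip f (trig k i j) = 0"
  shows "f \<in> H2 k"
  using assms by (simp add: H2_def fourier_ip[of _ k])

lemma H2_trig:
  assumes "f \<in> H2 k" "i < k" "j < 0"
  shows "ip f (trig k i j) = 0"
proof -
  have "f \<in> L2 k" "fourier f i j = 0" using assms by (auto simp: H2_def)
  then show ?thesis using assms(2) by (simp add: fourier_ip[of _ k])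
qed

lemma H2perp_I: "f \<in> L2 k \<Longrightarrow> (\<And>g. g \<in> H2 k \<Longrightarrow> ip f g = 0) \<Longrightarrow> f \<in> H2perp k"
  by (simp add: H2perp_def ominus_def)

lemma H2perp_orth: "f \<in> H2perp k \<Longrightarrow> g \<in> H2 k \<Longrightarrow> ip f g = 0"
  by (simp add: H2perp_def ominus_def)

lemma H2_L2 [simp]: "f \<in> H2 k \<Longrightarrow> f \<in> L2 k"
  by (simp add: H2_def)

lemma H2perp_L2 [simp]: "f \<in> H2perp k \<Longrightarrow> f \<in> L2 k"
  by (simp add: H2perp_def ominus_def)

lemma H2_orth: "f \<in> H2 k \<Longrightarrow> g \<in> H2perp k \<Longrightarrow> ip f g = 0"
  using H2perp_orth[of g k f] by (subst ip_cnj[of _ k]) auto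

lemma trig_H2perp: "i < k \<Longrightarrow> j < 0 \<Longrightarrow> trig k i j \<in> H2perp k"
  by (rule H2perp_I) (auto simp: ip_cnj[of "trig k i j" k] H2_trig)

text \<open>
  \<open>H\<^sub>2\<close> is recovered from \<open>H2perp\<close>, since the monomials with negative exponents are in
  \<open>H2perp\<close> and already suffice to test membership in \<open>H\<^sub>2\<close>.
\<close>

lemma H2_I_orth: "f \<in> L2 k \<Longrightarrow> (\<And>g. g \<in> H2perp k \<Longrightarrow> ip f g = 0) \<Longrightarrow> f \<in> H2 k"
  by (rule H2_I) (auto intro: trig_H2perp)

lemma H2_add [simp]: "f \<in> H2 k \<Longrightarrow> g \<in> H2 k \<Longrightarrow> (\<lambda>z. f z + g z) \<in> H2 k"
  by (rule H2_I) (auto simp: ip_add_left[of _ k] H2_trig)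

lemma H2_minus [simp]: "f \<in> H2 k \<Longrightarrow> g \<in> H2 k \<Longrightarrow> (\<lambda>z. f z - g z) \<in> H2 k"
  by (rule H2_I) (auto simp: ip_minus_left[of _ k] H2_trig)

lemma H2_smult [simp]: "f \<in> H2 k \<Longrightarrow> (\<lambda>z. a \<cdot>\<^sub>v f z) \<in> H2 k"
  by (rule H2_I) (auto simp: ip_smult_left[of _ k] H2_trig)

lemma H2_ae: "f \<in> H2 k \<Longrightarrow> ae_eq f g \<Longrightarrow> g \<in> L2 k \<Longrightarrow> g \<in> H2 k"
  using ip_cong[of f g h h for h] by (auto intro!: H2_I dest: H2_trig)

lemma H2perp_minus [simp]: "f \<in> H2perp k \<Longrightarrow> g \<in> H2perp k \<Longrightarrow> (\<lambda>z. f z - g z) \<in> H2perp k"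
  by (rule H2perp_I) (auto simp: ip_minus_left[of _ k] H2perp_orth)

lemma H2perp_ae: "f \<in> H2perp k \<Longrightarrow> ae_eq f g \<Longrightarrow> g \<in> L2 k \<Longrightarrow> g \<in> H2perp k"
  using ip_cong[of f g h h for h] by (auto intro!: H2perp_I dest: H2perp_orth)

text \<open>
  For a function in \<open>H\<^sub>2\<close> this is its value at the origin.
\<close>

definition mean :: "nat \<Rightarrow> (complex \<Rightarrow> complex vec) \<Rightarrow> complex vec" where
  "mean k f = Matrix.vec k (\<lambda>i. fourier f i 0)"

lemma mean_carrier [simp]: "mean k f \<in> carrier_vec k"
  by (simp add: mean_def)

lemma dim_mean [simp]: "dim_vec (mean k f) = k"
  by (simp add: mean_def)

lemma ip_const_right:
  assumes "f \<in> L2 k" "c \<in> carrier_vec k"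
  shows "ip f (\<lambda>_. c) = mean k f \<bullet>c c"
proof -
  have int: "integrable circ (\<lambda>t. f (cis t) $ i)" if "i < k" for i
    using sq_integrable_prod_integrable[OF L2_sq[OF assms(1) that]
        ess_bounded_sq_integrable[OF ess_bounded_const[of 1]]] by simp
  have "ip f (\<lambda>_. c) = (1 / (2 * pi)) * (LINT t|circ. (\<Sum>i<k. f (cis t) $ i * cnj (c $ i)))"
    using assms by (simp add: ip_def cscalar_prod_sum[of _ k])
  also have "(LINT t|circ. (\<Sum>i<k. f (cis t) $ i * cnj (c $ i)))
      = (\<Sum>i<k. (LINT t|circ. f (cis t) $ i) * cnj (c $ i))"
    using int by (subst Bochner_Integration.integral_sum) auto
  also have "(1 / (2 * pi)) * \<dots> = (\<Sum>i<k. fourier f i 0 * cnj (c $ i))"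
    by (simp add: fourier_def sum_distrib_left)
  finally show ?thesis using assms by (simp add: cscalar_prod_sum[of _ k] mean_def)
qed

lemma const_trig: "i < k \<Longrightarrow> trig k i 0 = (\<lambda>_. unit_vec k i)"
  by (simp add: trig_def)

lemma const_H2 [simp]:
  assumes "c \<in> carrier_vec k" shows "(\<lambda>_. c) \<in> H2 k"
proof -
  have "ip (\<lambda>_. c) (trig k i j) = 0" if "i < k" "j < 0" for i j
  proof -
    have "mean k (trig k i j) = 0\<^sub>v k"
      using that by (intro eq_vecI) (auto simp: mean_def fourier_ip[of _ k] ip_trig)
    then show ?thesis
      using assms by (subst ip_cnj[of _ k]) (auto simp: ip_const_right[of _ k])
  qed
  then show ?thesis using assms by (intro H2_I) auto
qed

lemma cnj_unit_mult: "cmod z = 1 \<Longrightarrow> cnj z * z = 1" "cmod z = 1 \<Longrightarrow> z * cnj z = 1"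
  using complex_norm_square[of z] by (auto simp: mult.commute)

lemma cnj_eq_inverse: "cmod z = 1 \<Longrightarrow> cnj z = 1 / z"
  using cnj_unit_mult(1)[of z] by (cases "z = 0") (auto simp: field_simps)

lemma cnj_smult_trig: "cmod z = 1 \<Longrightarrow> cnj z \<cdot>\<^sub>v trig k i j z = trig k i (j - 1) z"
  by (cases "z = 0") (auto simp: trig_def smult_smult_assoc power_int_diff cnj_eq_inverse)

lemma smult_trig: "cmod z = 1 \<Longrightarrow> z \<cdot>\<^sub>v trig k i j z = trig k i (j + 1) z"
  by (cases "z = 0") (auto simp: trig_def smult_smult_assoc power_int_add mult.commute)

lemma L2_shift [simp]: "f \<in> L2 k \<Longrightarrow> (\<lambda>z. z \<cdot>\<^sub>v f z) \<in> L2 k"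
  by (rule L2_smult_fun) auto

lemma L2_bshift [simp]: "f \<in> L2 k \<Longrightarrow> (\<lambda>z. cnj z \<cdot>\<^sub>v f z) \<in> L2 k"
  by (rule L2_smult_fun) auto

lemma ip_shift: "f \<in> L2 k \<Longrightarrow> g \<in> L2 k \<Longrightarrow> ip (\<lambda>z. z \<cdot>\<^sub>v f z) g = ip f (\<lambda>z. cnj z \<cdot>\<^sub>v g z)"
  by (rule ip_smult_fun)

lemma ip_bshift: "f \<in> L2 k \<Longrightarrow> g \<in> L2 k \<Longrightarrow> ip (\<lambda>z. cnj z \<cdot>\<^sub>v f z) g = ip f (\<lambda>z. z \<cdot>\<^sub>v g z)"
  by (subst ip_smult_fun) auto

lemma ip_shift_shift:
  assumes "x \<in> L2 k" "y \<in> L2 k"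
  shows "ip (\<lambda>z. z \<cdot>\<^sub>v x z) (\<lambda>z. z \<cdot>\<^sub>v y z) = ip x y"
proof -
  have "ip (\<lambda>z. z \<cdot>\<^sub>v x z) (\<lambda>z. z \<cdot>\<^sub>v y z) = ip x (\<lambda>z. cnj z \<cdot>\<^sub>v (z \<cdot>\<^sub>v y z))"
    using assms by (intro ip_shift[of _ k]) auto
  also have "\<dots> = ip x y"
    by (intro ip_cong_right) (simp add: smult_smult_assoc cnj_unit_mult one_smult_vec)
  finally show ?thesis .
qed

lemma ip_shift_trig:
  "f \<in> L2 k \<Longrightarrow> ip (\<lambda>z. z \<cdot>\<^sub>v f z) (trig k i j) = ip f (trig k i (j - 1))"
  by (simp add: ip_shift[of _ k]) (auto intro!: ip_cong ae_eqI simp: cnj_smult_trig)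

lemma ip_bshift_trig:
  "f \<in> L2 k \<Longrightarrow> ip (\<lambda>z. cnj z \<cdot>\<^sub>v f z) (trig k i j) = ip f (trig k i (j + 1))"
  by (simp add: ip_bshift[of _ k]) (auto intro!: ip_cong ae_eqI simp: smult_trig)

lemma H2_shift [simp]: "f \<in> H2 k \<Longrightarrow> (\<lambda>z. z \<cdot>\<^sub>v f z) \<in> H2 k"
  by (rule H2_I) (auto simp: ip_shift_trig H2_trig)

lemma ip_shift_const:
  assumes "f \<in> H2 k" "c \<in> carrier_vec k"
  shows "ip (\<lambda>z. z \<cdot>\<^sub>v f z) (\<lambda>_. c) = 0" "ip (\<lambda>_. c) (\<lambda>z. z \<cdot>\<^sub>v f z) = 0"
proof -
  have "mean k (\<lambda>z. z \<cdot>\<^sub>v f z) = 0\<^sub>v k"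
    using assms by (intro eq_vecI) (auto simp: mean_def fourier_ip[of _ k] ip_shift_trig H2_trig)
  then show "ip (\<lambda>z. z \<cdot>\<^sub>v f z) (\<lambda>_. c) = 0"
    using assms by (simp add: ip_const_right[of _ k])
  then show "ip (\<lambda>_. c) (\<lambda>z. z \<cdot>\<^sub>v f z) = 0"
    using assms by (subst ip_cnj[of _ k]) auto
qed

text \<open>
  The backward shift on \<open>H\<^sub>2\<close>: once the constant coefficient is removed, division by \<open>z\<close> (which
  is multiplication by \<open>cnj z\<close> on the circle) produces no negative exponents.
\<close>

lemma H2_bshift [simp]:
  assumes "f \<in> H2 k" shows "(\<lambda>z. cnj z \<cdot>\<^sub>v (f z - mean k f)) \<in> H2 k"
proof -
  have "ip (\<lambda>z. cnj z \<cdot>\<^sub>v (f z - mean k f)) (trig k i j) = 0" if "i < k" "j < 0" for i j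
  proof (cases "j + 1 < 0")
    case True
    then show ?thesis
      using assms that by (simp add: ip_bshift_trig ip_minus_left[of _ k] H2_trig)
  next
    case False
    then have "j + 1 = 0" using that by simp
    then show ?thesis
      using assms that
      by (simp add: ip_bshift_trig ip_minus_left[of _ k] const_trig ip_const[of _ k])
        (simp add: mean_def fourier_ip[of _ k] const_trig)
  qed
  then show ?thesis using assms by (intro H2_I) auto
qed

lemma H2perp_bshift [simp]: "f \<in> H2perp k \<Longrightarrow> (\<lambda>z. cnj z \<cdot>\<^sub>v f z) \<in> H2perp k"
  by (rule H2perp_I) (auto simp: ip_bshift[of _ k] H2perp_orth)

section \<open>Bounded holomorphic functions on the disc\<close>

text \<open>
  Bounded analytic functions together with their values on the circle.  The values on the circle are
  tied to those in the disc by radial limits.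
\<close>

definition bdd_hol :: "(complex \<Rightarrow> complex) \<Rightarrow> bool" where
  "bdd_hol f \<longleftrightarrow> f holomorphic_on ball 0 1 \<and> (\<exists>B. \<forall>z\<in>ball 0 1. cmod (f z) \<le> B) \<and>
     (AE t in circ. ((\<lambda>r. f (of_real r * cis t)) \<longlongrightarrow> f (cis t)) (at_left (1::real)))"

lemma at_left_unit: "\<forall>\<^sub>F r in at_left (1::real). 0 < r \<and> r < 1"
  using eventually_at_left_real[of 0 "1::real"] by (auto elim: eventually_mono)

lemma radial_tendsto: "((\<lambda>r::real. of_real r * cis t) \<longlongrightarrow> cis t) (at_left 1)"
proof -
  have "((\<lambda>r::real. of_real r * cis t) \<longlongrightarrow> of_real 1 * cis t) (at_left 1)"
    by (intro tendsto_intros)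
  then show ?thesis by simp
qed

lemma bdd_hol_cong:
  assumes "bdd_hol f" "\<And>z. cmod z \<le> 1 \<Longrightarrow> f z = g z"
  shows "bdd_hol g"
proof -
  have ev: "\<forall>\<^sub>F r in at_left (1::real). f (of_real r * cis t) = g (of_real r * cis t)" for t
    using at_left_unit
    by eventually_elim (auto intro!: assms(2) simp: norm_mult)
  have "f holomorphic_on ball 0 1 \<longleftrightarrow> g holomorphic_on ball 0 1"
    by (intro holomorphic_cong) (auto simp: assms(2))
  moreover have "AE t in circ. ((\<lambda>r. g (of_real r * cis t)) \<longlongrightarrow> g (cis t)) (at_left (1::real))"
    using assms(1) tendsto_cong[OF ev] assms(2) by (simp add: bdd_hol_def)
  ultimately show ?thesis
    using assms by (auto simp: bdd_hol_def)
qed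

lemma bdd_hol_continuous:
  assumes "continuous_on (cball 0 1) f" "f holomorphic_on ball 0 1"
  shows "bdd_hol f"
proof -
  have "compact (f ` cball 0 1)" by (intro compact_continuous_image assms compact_cball)
  then have "bounded (f ` cball 0 1)" by (rule compact_imp_bounded)
  then obtain B where B: "\<forall>x\<in>f ` cball 0 1. norm x \<le> B" unfolding bounded_iff by auto
  have "((\<lambda>r. f (of_real r * cis t)) \<longlongrightarrow> f (cis t)) (at_left (1::real))" for t
  proof (rule continuous_on_tendsto_compose[OF assms(1)])
    show "((\<lambda>r::real. of_real r * cis t) \<longlongrightarrow> cis t) (at_left 1)"
      by (rule radial_tendsto)
    show "\<forall>\<^sub>F r in at_left 1. complex_of_real r * cis t \<in> cball 0 1"
      using at_left_unit by (auto elim!: eventually_mono simp: norm_mult)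
  qed auto
  then show ?thesis using assms B by (auto simp: bdd_hol_def intro!: exI[of _ B])
qed

lemma bdd_hol_const [simp]: "bdd_hol (\<lambda>_. c)"
  by (rule bdd_hol_continuous) auto

lemma bdd_hol_id [simp]: "bdd_hol (\<lambda>z. z)"
  by (rule bdd_hol_continuous) auto

lemma one_minus_nonzero:
  assumes "cmod a < 1" "cmod z \<le> 1" shows "1 - cnj a * z \<noteq> 0"
proof
  assume "1 - cnj a * z = 0"
  then have "cmod (cnj a * z) = 1" by simp
  moreover have "cmod a * cmod z \<le> cmod a * 1" by (intro mult_left_mono) (use assms in auto)
  ultimately show False using assms(1) by (simp add: norm_mult)
qed

lemma bdd_hol_kernel: "cmod a < 1 \<Longrightarrow> bdd_hol (\<lambda>z. 1 / (1 - cnj a * z))"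
  using one_minus_nonzero[of a]
  by (intro bdd_hol_continuous continuous_intros holomorphic_intros) auto

lemma bdd_hol_add: 
  assumes "bdd_hol f" "bdd_hol g" shows "bdd_hol (\<lambda>z. f z + g z)"
proof -
  obtain A B where "\<forall>z\<in>ball 0 1. cmod (f z) \<le> A" "\<forall>z\<in>ball 0 1. cmod (g z) \<le> B"
    using assms by (auto simp: bdd_hol_def)
  then have "\<forall>z\<in>ball 0 1. cmod (f z + g z) \<le> A + B"
    by (auto intro!: norm_triangle_le add_mono)
  moreover have "AE t in circ. ((\<lambda>r. f (of_real r * cis t) + g (of_real r * cis t)) \<longlongrightarrow> f (cis t) + g (cis t)) (at_left (1::real))"
    using assms unfolding bdd_hol_def by (auto intro: tendsto_add elim: eventually_elim2)
  ultimately show ?thesis using assms by (auto simp: bdd_hol_def intro!: holomorphic_intros)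
qed

lemma bdd_hol_mult: 
  assumes "bdd_hol f" "bdd_hol g" shows "bdd_hol (\<lambda>z. f z * g z)"
proof -
  obtain A B where "\<forall>z\<in>ball 0 1. cmod (f z) \<le> A" "\<forall>z\<in>ball 0 1. cmod (g z) \<le> B"
    using assms by (auto simp: bdd_hol_def)
  then have "\<forall>z\<in>ball 0 1. cmod (f z * g z) \<le> A * B"
    by (auto simp: norm_mult intro!: mult_mono order_trans[OF norm_ge_zero])
  moreover have "AE t in circ. ((\<lambda>r. f (of_real r * cis t) * g (of_real r * cis t)) \<longlongrightarrow> f (cis t) * g (cis t)) (at_left (1::real))"
    using assms unfolding bdd_hol_def by (auto intro: tendsto_mult elim: eventually_elim2)
  ultimately show ?thesis using assms by (auto simp: bdd_hol_def intro!: holomorphic_intros)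
qed

lemma bdd_hol_minus: "bdd_hol f \<Longrightarrow> bdd_hol g \<Longrightarrow> bdd_hol (\<lambda>z. f z - g z)"
  using bdd_hol_add[OF _ bdd_hol_mult[OF bdd_hol_const[of "-1"]], of f g] by simp

lemma bdd_hol_sum: "(\<And>i. i \<in> I \<Longrightarrow> bdd_hol (f i)) \<Longrightarrow> bdd_hol (\<lambda>z. \<Sum>i\<in>I. f i z)"
  by (induction I rule: infinite_finite_induct) (auto intro: bdd_hol_add)

text \<open>
  Radii that approach \<open>1\<close> along a sequence, as required for dominated convergence.
\<close>

definition rad :: "nat \<Rightarrow> real" where "rad n = 1 - 1 / real (n + 2)"

lemma rad_bounds: "0 < rad n" "rad n < 1"
  by (auto simp: rad_def)

lemma rad_at_left: "filterlim rad (at_left 1) sequentially"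
  unfolding filterlim_at
proof
  have "(\<lambda>n. 1 - 1 / real (n + 2)) \<longlonglongrightarrow> 1 - 0"
    by (intro tendsto_intros LIMSEQ_ignore_initial_segment[OF lim_1_over_n])
  then show "rad \<longlonglongrightarrow> 1" by (simp add: rad_def[abs_def])
qed (auto simp: rad_def)

lemma rad_cis_ball: "of_real (rad n) * cis t \<in> ball 0 1"
  using rad_bounds[of n] by (simp add: norm_mult)

lemma bdd_hol_measurable_rad:
  assumes "bdd_hol f"
  shows "(\<lambda>t. f (of_real (rad n) * cis t)) \<in> borel_measurable circ"
proof -
  have "continuous_on (ball 0 1) f"
    using assms by (auto simp: bdd_hol_def intro: holomorphic_on_imp_continuous_on)
  then have "continuous_on {0..2 * pi} (\<lambda>t. f (of_real (rad n) * cis t))"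
    by (rule continuous_on_compose2) (use rad_cis_ball in \<open>auto intro!: continuous_intros\<close>)
  then show ?thesis
    by (rule continuous_imp_measurable_on_sets_lebesgue) auto
qed

lemma bdd_hol_AE_rad:
  assumes "bdd_hol f"
  shows "AE t in circ. (\<lambda>n. f (of_real (rad n) * cis t)) \<longlonglongrightarrow> f (cis t)"
  using assms unfolding bdd_hol_def
  by (auto elim!: eventually_mono intro: filterlim_compose[OF _ rad_at_left])

lemma bdd_hol_ess_bounded:
  assumes "bdd_hol f" shows "ess_bounded (\<lambda>t. f (cis t))"
proof -
  obtain B where B: "\<And>z. z \<in> ball 0 1 \<Longrightarrow> cmod (f z) \<le> B"
    using assms unfolding bdd_hol_def by blast
  have "(\<lambda>t. lim (\<lambda>n. f (of_real (rad n) * cis t))) \<in> borel_measurable circ"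
    by (intro borel_measurable_lim_metric bdd_hol_measurable_rad assms)
  moreover have "AE t in circ. lim (\<lambda>n. f (of_real (rad n) * cis t)) = f (cis t)"
    using bdd_hol_AE_rad[OF assms] by eventually_elim (rule limI)
  ultimately have "(\<lambda>t. f (cis t)) \<in> borel_measurable circ"
    by (rule measurable_circ_AE_cong)
  moreover have "AE t in circ. cmod (f (cis t)) \<le> B"
    using bdd_hol_AE_rad[OF assms]
  proof eventually_elim
    case (elim t)
    then have "(\<lambda>n. cmod (f (of_real (rad n) * cis t))) \<longlonglongrightarrow> cmod (f (cis t))"
      by (intro tendsto_intros)
    then show ?case
      by (rule LIMSEQ_le_const2) (use B rad_cis_ball in auto)
  qed
  ultimately show ?thesis by (auto simp: ess_bounded_def)
qed

text \<open>
  A bounded analytic factor does not create negative Fourier coefficients.  On the circle of radius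
  \<open>r < 1\<close> the power series of \<open>f\<close> can be integrated term by term against \<open>\<phi>\<close>, and every term is
  a coefficient of \<open>\<phi>\<close> that vanishes; the boundary values of \<open>f\<close> are reached by dominated convergence.
\<close>

lemma bdd_hol_mult_coeff:
  assumes f: "bdd_hol f" and \<phi>: "sq_integrable \<phi>"
    and 0: "\<And>m::nat. m \<ge> 1 \<Longrightarrow> (LINT t|circ. \<phi> t * cis (of_nat m * t)) = 0"
    and m: "m \<ge> 1"
  shows "(LINT t|circ. f (cis t) * \<phi> t * cis (of_nat m * t)) = 0"
proof -
  have \<phi>m: "\<phi> \<in> borel_measurable circ" using \<phi> by (simp add: sq_integrable_def)
  have \<phi>i: "integrable circ \<phi>"
    using sq_integrable_prod_integrable[OF \<phi> ess_bounded_sq_integrable[OF ess_bounded_const[of 1]]]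
    by simp
  have cism: "(\<lambda>t. cis (of_nat j * t)) \<in> borel_measurable circ" for j :: nat
    by (rule continuous_imp_measurable_on_sets_lebesgue) (auto intro!: continuous_intros)
  have \<phi>ci: "integrable circ (\<lambda>t. \<phi> t * cis (of_nat j * t))" for j :: nat
    by (rule Bochner_Integration.integrable_bound[OF \<phi>i]) (use \<phi>m cism in \<open>auto simp: norm_mult\<close>)
  obtain B where B: "\<And>z. z \<in> ball 0 1 \<Longrightarrow> cmod (f z) \<le> B"
    using f unfolding bdd_hol_def by blast
  have hol: "f holomorphic_on ball 0 1" using f by (simp add: bdd_hol_def)
  define a where "a n = (deriv ^^ n) f 0 / fact n" for n
  have sums: "(\<lambda>n. a n * w ^ n) sums f w" if "w \<in> ball 0 1" for w
    using holomorphic_power_series[OF hol that] by (simp add: a_def)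
  have radial: "(LINT t|circ. f (of_real r * cis t) * \<phi> t * cis (of_nat m * t)) = 0"
    if r: "0 < r" "r < 1" for r
  proof -
    \<comment> \<open>convergence at a larger radius gives absolute convergence at \<open>r\<close>\<close>
    define \<rho> where "\<rho> = (1 + r) / 2"
    have "summable (\<lambda>n. a n * of_real \<rho> ^ n)"
    proof -
      have "complex_of_real \<rho> \<in> ball 0 1" using r unfolding \<rho>_def by (simp del: of_real_divide of_real_add)
      from sums[OF this] show ?thesis by (rule sums_summable)
    qed
    then have sm: "summable (\<lambda>n. cmod (a n) * r ^ n)"
      using powser_insidea[of a "of_real \<rho>" "of_real r"] r
      by (simp add: \<rho>_def norm_mult norm_power del: of_real_divide of_real_add)
    define h where "h n t = a n * of_real r ^ n * (\<phi> t * cis (of_nat (n + m) * t))" for n t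
    have hi: "integrable circ (h n)" for n
      unfolding h_def by (intro integrable_mult_right \<phi>ci)
    have hn: "norm (h n t) = cmod (a n) * r ^ n * cmod (\<phi> t)" for n t
      using r by (simp add: h_def norm_mult norm_power)
    have h0: "integral\<^sup>L circ (h n) = 0" for n
      unfolding h_def using 0[of "n + m"] m by simp
    have "(\<lambda>n. integral\<^sup>L circ (h n)) sums (LINT t|circ. (\<Sum>n. h n t))"
      by (rule sums_integral) (auto simp: hi hn intro!: summable_mult2 sm)
    then have "(LINT t|circ. (\<Sum>n. h n t)) = 0"
      by (simp add: h0 sums_unique2[OF _ sums_zero])
    moreover have "(\<Sum>n. h n t) = f (of_real r * cis t) * \<phi> t * cis (of_nat m * t)" for t
    proof (rule sums_unique[symmetric])
      have "(\<lambda>n. a n * (of_real r * cis t) ^ n) sums f (of_real r * cis t)"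
        by (rule sums) (use r in \<open>auto simp: norm_mult\<close>)
      then have "(\<lambda>n. a n * (of_real r * cis t) ^ n * (\<phi> t * cis (of_nat m * t))) sums
          (f (of_real r * cis t) * (\<phi> t * cis (of_nat m * t)))"
        by (rule sums_mult2)
      moreover have "a n * (of_real r * cis t) ^ n * (\<phi> t * cis (of_nat m * t)) = h n t" for n
      proof -
        have "cis (of_nat (n + m) * t) = cis t ^ n * cis (of_nat m * t)"
          using Complex.DeMoivre[of t n] by (simp add: distrib_right flip: cis_mult)
        then show ?thesis by (simp add: h_def power_mult_distrib)
      qed
      ultimately show "(\<lambda>n. h n t) sums (f (of_real r * cis t) * \<phi> t * cis (of_nat m * t))"
        by (simp add: mult.assoc)
    qed
    ultimately show ?thesis by simp
  qed
  have "(\<lambda>n. LINT t|circ. f (of_real (rad n) * cis t) * \<phi> t * cis (of_nat m * t))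
      \<longlonglongrightarrow> (LINT t|circ. f (cis t) * \<phi> t * cis (of_nat m * t))"
  proof (rule integral_dominated_convergence[where w = "\<lambda>t. B * cmod (\<phi> t)"])
    show "(\<lambda>t. f (cis t) * \<phi> t * cis (of_nat m * t)) \<in> borel_measurable circ"
      using bdd_hol_ess_bounded[OF f] \<phi>m cism by (auto simp: ess_bounded_def)
    show "(\<lambda>t. f (of_real (rad n) * cis t) * \<phi> t * cis (of_nat m * t)) \<in> borel_measurable circ" for n
      using bdd_hol_measurable_rad[OF f] \<phi>m cism by auto
    show "integrable circ (\<lambda>t. B * cmod (\<phi> t))" using \<phi>i by auto
    show "AE t in circ. (\<lambda>n. f (of_real (rad n) * cis t) * \<phi> t * cis (of_nat m * t))
        \<longlonglongrightarrow> f (cis t) * \<phi> t * cis (of_nat m * t)"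
      using bdd_hol_AE_rad[OF f] by eventually_elim (intro tendsto_intros)
    show "AE t in circ. norm (f (of_real (rad n) * cis t) * \<phi> t * cis (of_nat m * t))
        \<le> B * cmod (\<phi> t)" for n
      using B[OF rad_cis_ball[of n]] by (auto simp: norm_mult intro!: mult_right_mono)
  qed
  then show ?thesis
    by (simp add: radial[OF rad_bounds] LIMSEQ_const_iff)
qed

text \<open>
  Cauchy's formula with boundary values.  The quotient \<open>g = (f - f a) / (z - a)\<close> is again bounded and
  analytic, and \<open>(z - a) cnj (1 / (1 - cnj a z)) = z\<close> on the circle.  Hence the integral is \<open>f a\<close> times
  the integral of the conjugate kernel plus the integral of \<open>z g\<close>, and the latter is zero.
\<close>

lemma bdd_hol_cauchy:
  fixes f :: "complex \<Rightarrow> complex"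
  assumes f: "bdd_hol f" and a: "cmod a < 1"
  shows "(LINT t|circ. f (cis t) * cnj (1 / (1 - cnj a * cis t))) = of_real (2 * pi) * f a"
proof -
  have hol: "f holomorphic_on ball 0 1" using f by (simp add: bdd_hol_def)
  define g where "g z = (if z = a then deriv f a else (f z - f a) / (z - a))" for z
  have gh: "g holomorphic_on ball 0 1"
    unfolding g_def by (rule pole_lemma_open[OF hol]) auto
  obtain B where B: "\<And>z. z \<in> ball 0 1 \<Longrightarrow> cmod (f z) \<le> B"
    using f unfolding bdd_hol_def by blast
  define \<delta> where "\<delta> = (1 - cmod a) / 2"
  have \<delta>: "\<delta> > 0" using a by (simp add: \<delta>_def)
  have "continuous_on (cball 0 (cmod a + \<delta>)) g"
    by (rule continuous_on_subset[OF holomorphic_on_imp_continuous_on[OF gh]])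
      (use a in \<open>auto simp: \<delta>_def field_simps\<close>)
  then have "bounded (g ` cball 0 (cmod a + \<delta>))"
    by (intro compact_imp_bounded compact_continuous_image compact_cball)
  then obtain A where A: "\<And>z. cmod z \<le> cmod a + \<delta> \<Longrightarrow> cmod (g z) \<le> A"
    unfolding bounded_iff by (metis imageI mem_cball_0)
  \<comment> \<open>near \<open>a\<close> by compactness, elsewhere because the denominator is at least \<open>\<delta>\<close>\<close>
  have "cmod (g z) \<le> max A (2 * B / \<delta>)" if z: "z \<in> ball 0 1" for z
  proof (cases "cmod z \<le> cmod a + \<delta>")
    case True
    then show ?thesis using A[of z] by (simp add: max.coboundedI1)
  next
    case False
    then have d: "\<delta> \<le> cmod (z - a)" using norm_triangle_ineq2[of z a] by linarith
    have "cmod (g z) = cmod (f z - f a) / cmod (z - a)"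
      using d \<delta> by (auto simp: g_def norm_divide)
    also have "\<dots> \<le> (2 * B) / \<delta>"
    proof (rule frac_le)
      show "cmod (f z - f a) \<le> 2 * B"
        using norm_triangle_ineq4[of "f z" "f a"] B[OF z] B[of a] a by simp
    qed (use d \<delta> norm_ge_zero B[OF z] order_trans in \<open>auto intro: order_trans[OF norm_ge_zero]\<close>)
    finally show ?thesis by (simp add: max.coboundedI2)
  qed
  moreover have "AE t in circ. ((\<lambda>r. g (of_real r * cis t)) \<longlongrightarrow> g (cis t)) (at_left (1::real))"
  proof -
    have "AE t in circ. ((\<lambda>r. f (of_real r * cis t)) \<longlongrightarrow> f (cis t)) (at_left (1::real))"
      using f by (simp add: bdd_hol_def)
    then show ?thesis
    proof eventually_elim
      case (elim t)
      have ne: "cis t \<noteq> a" using a by auto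
      then have ev: "\<forall>\<^sub>F r in at_left (1::real). of_real r * cis t \<noteq> a"
        by (rule tendsto_imp_eventually_ne[OF radial_tendsto])
      have "((\<lambda>r. (f (of_real r * cis t) - f a) / (of_real r * cis t - a)) \<longlongrightarrow>
          (f (cis t) - f a) / (cis t - a)) (at_left (1::real))"
        by (intro tendsto_intros elim radial_tendsto) (use ne in auto)
      then show ?case
        using ne by (subst tendsto_cong[OF eventually_mono[OF ev]]) (auto simp: g_def)
    qed
  qed
  ultimately have g: "bdd_hol g" using gh unfolding bdd_hol_def by blast
  define y where "y t = 1 / (1 - cnj a * cis t)" for t
  have ne: "1 - cnj a * cis t \<noteq> 0" for t by (rule one_minus_nonzero) (use a in auto)
  have yb: "bdd_hol (\<lambda>z. 1 / (1 - cnj a * z))" by (rule bdd_hol_kernel[OF a])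
  have const: "integrable circ (\<lambda>t. c)" for c :: complex
    using finite_measure.integrable_const[OF finite_measure_circ] .
  have bdd_int: "integrable circ h" if "ess_bounded h" for h
    using sq_integrable_prod_integrable[OF ess_bounded_sq_integrable[OF that]
        ess_bounded_sq_integrable[OF ess_bounded_const[of 1]]] by simp
  have coeff: "(LINT t|circ. h (cis t) * cis t) = 0" if "bdd_hol h" for h
    using bdd_hol_mult_coeff[OF that ess_bounded_sq_integrable[OF ess_bounded_const[of 1]], of 1]
      integral_cis_int[of "int m" for m] by simp
  \<comment> \<open>\<open>y = 1 + cnj a z y\<close>, and \<open>z y\<close> has mean zero\<close>
  have "(LINT t|circ. y t) = (LINT t|circ. 1 + cnj a * (y t * cis t))"
    using ne by (intro Bochner_Integration.integral_cong) (auto simp: y_def field_simps)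
  also have "\<dots> = 2 * pi"
  proof -
    have "(LINT t|circ. y t * cis t) = 0" "integrable circ (\<lambda>t. y t * cis t)"
      using coeff[OF yb] bdd_int[OF ess_bounded_mult[OF bdd_hol_ess_bounded[OF yb] ess_bounded_cis(1)]]
      unfolding y_def .
    then show ?thesis using const by (simp add: measure_restrict_space scaleR_conv_of_real)
  qed
  finally have y1: "(LINT t|circ. cnj (y t)) = 2 * pi" by simp
  have "f (cis t) * cnj (y t) = f a * cnj (y t) + g (cis t) * cis t" for t
  proof -
    have "cis t \<noteq> a" using a by auto
    moreover have *: "cnj (y t) * (cis t - a) = cis t"
    proof -
      have "cis t * (1 - a * cnj (cis t)) = cis t - a"
        using cnj_unit_mult(2)[of "cis t"] by (simp add: algebra_simps)
      moreover have "1 - a * cnj (cis t) \<noteq> 0" using ne[of t] by (metis complex_cnj_cnj complex_cnj_diff complex_cnj_mult complex_cnj_one complex_cnj_zero)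
      ultimately show ?thesis by (simp add: y_def field_simps)
    qed
    ultimately have "g (cis t) * (cis t - a) = f (cis t) - f a" by (simp add: g_def)
    then have "g (cis t) * (cnj (y t) * (cis t - a)) = (f (cis t) - f a) * cnj (y t)"
      by (metis mult.assoc mult.commute)
    then show ?thesis unfolding * by (simp add: algebra_simps)
  qed
  then have "(LINT t|circ. f (cis t) * cnj (y t)) = (LINT t|circ. f a * cnj (y t) + g (cis t) * cis t)"
    by simp
  also have "\<dots> = f a * (2 * pi)"
  proof -
    have "(LINT t|circ. g (cis t) * cis t) = 0" "integrable circ (\<lambda>t. g (cis t) * cis t)"
      "integrable circ (\<lambda>t. cnj (y t))"
      using coeff[OF g] bdd_int[OF ess_bounded_mult[OF bdd_hol_ess_bounded[OF g] ess_bounded_cis(1)]]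
        bdd_int[OF ess_bounded_cnj[OF bdd_hol_ess_bounded[OF yb]]]
      unfolding y_def .
    with y1 show ?thesis by simp
  qed
  finally show ?thesis by (simp add: y_def mult.commute)
qed

section \<open>Rank conditions\<close>

lemma column_basis:
  fixes A :: "complex mat"
  assumes A: "A \<in> carrier_mat k m"
  obtains S where "finite S" "S \<subseteq> set (cols A)" "card S = vec_space.rank k A"
    "module.lin_indpt class_ring (module_vec TYPE(complex) k) S"
    "set (cols A) \<subseteq> module.span class_ring (module_vec TYPE(complex) k) S"
proof -
  interpret vec_space "TYPE(complex)" k .
  have c: "set (cols A) \<subseteq> carrier_vec k" using A cols_dim by blast
  have "lin_indpt {}" by (simp add: lin_dep_def)
  then obtain S where S: "finite S" "maximal S (\<lambda>T. T \<subseteq> set (cols A) \<and> lin_indpt T)"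
    using maximal_exists_superset[of "set (cols A)" "\<lambda>T. T \<subseteq> set (cols A) \<and> lin_indpt T" "{}"]
    by auto
  then have ind: "S \<subseteq> set (cols A)" "lin_indpt S" by (auto simp: maximal_def)
  have "v \<in> span S" if v: "v \<in> set (cols A)" for v
  proof (rule ccontr)
    assume n: "v \<notin> span S"
    have S_c: "S \<subseteq> carrier_vec k" using ind c by auto
    then have "v \<notin> S" using n span_mem by auto
    moreover from this have "lin_indpt (S \<union> {v})"
      using lin_dep_iff_in_span[of S v] n ind v c S_c by auto
    ultimately show False using S(2) v ind unfolding maximal_def by blast
  qed
  then show ?thesis
    using that[OF S(1) ind(1) rank_card_indpt[OF A S(2), symmetric] ind(2)] by auto
qed

text \<open>
  A vector orthogonal to all columns is orthogonal to their span.  The span is the whole space, so the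
  vector is orthogonal to itself.
\<close>

lemma full_row_rank_left_kernel:
  fixes A :: "complex mat"
  assumes A: "A \<in> carrier_mat k m" and r: "vec_space.rank k A = k"
    and v: "v \<in> carrier_vec k" and 0: "\<And>j. j < m \<Longrightarrow> col A j \<bullet>c v = 0"
  shows "v = 0\<^sub>v k"
proof -
  interpret vec_space "TYPE(complex)" k .
  obtain S where S: "finite S" "S \<subseteq> set (cols A)" "card S = k" "lin_indpt S"
    using column_basis[OF A] r by metis
  have c: "S \<subseteq> carrier_vec k" using A cols_dim S(2) by blast
  have "basis S"
    by (rule dim_li_is_basis) (use S c in \<open>auto simp: dim_is_n fin_dim\<close>)
  then have "v \<in> span S" using v by (auto simp: basis_def)
  then obtain a where a: "v = lincomb a S"
    using finite_in_span[OF S(1) c] by blast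
  have "x \<bullet>c v = 0" if "x \<in> S" for x
  proof -
    from that S(2) have "x \<in> set (cols A)" by auto
    then obtain j where "j < m" "x = col A j"
      using A by (auto simp: in_set_conv_nth)
    then show ?thesis using 0 by simp
  qed
  then have z: "(\<Sum>i<k. x $ i * cnj (v $ i)) = 0" if "x \<in> S" for x
    using that v by (simp add: cscalar_prod_sum[of _ k])
  have "v \<bullet>c v = (\<Sum>i<k. (\<Sum>x\<in>S. a x * x $ i) * cnj (v $ i))"
    using v lincomb_index[OF _ c, of _ a] by (simp add: cscalar_prod_sum[of _ k] a)
  also have "\<dots> = (\<Sum>x\<in>S. a x * (\<Sum>i<k. x $ i * cnj (v $ i)))"
    by (simp add: sum_distrib_right sum_distrib_left mult.assoc) (rule sum.swap)
  also have "\<dots> = 0" using z by simp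
  finally show ?thesis using v by simp
qed

text \<open>
  All columns of \<open>E\<close> are multiples of one column \<open>w\<close>, so \<open>E v\<close> is a multiple of \<open>w\<close> for every \<open>v\<close>;
  the factor is found by pairing with the normalized \<open>w\<close>, as \<open>E\<close> is Hermitian and fixes \<open>w\<close>.
\<close>

lemma rank1_projection_vector:
  assumes E: "E \<in> rank1_projections k"
  obtains \<epsilon> where "\<epsilon> \<in> carrier_vec k" "\<epsilon> \<bullet>c \<epsilon> = 1"
    "\<And>v. v \<in> carrier_vec k \<Longrightarrow> E *\<^sub>v v = (v \<bullet>c \<epsilon>) \<cdot>\<^sub>v \<epsilon>"
proof -
  interpret vec_space "TYPE(complex)" k .
  have Ec: "E \<in> carrier_mat k k" and EE: "E * E = E" and Ea: "mat_adjoint E = E"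
    and r: "rank E = 1" using E by (auto simp: rank1_projections_def)
  obtain S where S: "finite S" "S \<subseteq> set (cols E)" "card S = 1" "lin_indpt S" "set (cols E) \<subseteq> span S"
    using column_basis[OF Ec] r by metis
  then obtain w where w: "S = {w}" by (auto simp: card_1_singleton_iff)
  obtain i where i: "i < k" "w = col E i" using S(2) Ec by (auto simp: w in_set_conv_nth)
  have wc: "w \<in> carrier_vec k" using i Ec by auto
  have w0: "w \<noteq> 0\<^sub>v k" using zero_nin_lin_indpt[of S] S(4) wc by (auto simp: w)
  have "\<exists>c. col E j = c \<cdot>\<^sub>v w" if "j < k" for j
  proof -
    have sp: "col E j \<in> span {w}" using S(5) that Ec by (auto simp: w cols_def)
    have "{w} \<subseteq> carrier_vec k" using wc by simp
    from finite_in_span[OF _ this sp] obtain a where "lincomb a {w} = col E j" by auto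
    note a = this[symmetric]
    have "lincomb a {w} = a w \<cdot>\<^sub>v w"
      using wc lincomb_dim[of "{w}" a] by (intro eq_vecI) (auto simp: lincomb_index)
    then show ?thesis using a by auto
  qed
  then obtain d where d: "\<And>j. j < k \<Longrightarrow> col E j = d j \<cdot>\<^sub>v w" by metis
  have range: "E *\<^sub>v v = (\<Sum>j<k. d j * v $ j) \<cdot>\<^sub>v w" if "v \<in> carrier_vec k" for v
  proof (rule eq_vecI)
    fix l assume l: "l < dim_vec ((\<Sum>j<k. d j * v $ j) \<cdot>\<^sub>v w)"
    then have l: "l < k" using wc by simp
    have "E $$ (l, j) = d j * w $ l" if "j < k" for j
      using arg_cong[OF d[OF that], of "\<lambda>x. x $ l"] l that Ec wc by simp
    then show "(E *\<^sub>v v) $ l = ((\<Sum>j<k. d j * v $ j) \<cdot>\<^sub>v w) $ l"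
      using l Ec wc that
      by (simp add: scalar_prod_def lessThan_atLeast0 sum_distrib_right sum_distrib_left mult_ac)
  qed (use Ec wc in auto)
  have Ew: "E *\<^sub>v w = w"
  proof -
    have "w = E *\<^sub>v unit_vec k i" using i Ec by (intro eq_vecI) auto
    then show ?thesis using EE Ec by (metis assoc_mult_mat_vec unit_vec_carrier)
  qed
  have "w \<bullet>c w > 0" using w0 wc by simp
  then obtain r where r: "r > 0" "w \<bullet>c w = of_real r"
    by (auto simp: less_complex_def complex_eq_iff intro: that[of "Re (w \<bullet>c w)"])
  define \<epsilon> where "\<epsilon> = of_real (1 / sqrt r) \<cdot>\<^sub>v w"
  have \<epsilon>c: "\<epsilon> \<in> carrier_vec k" using wc by (simp add: \<epsilon>_def)
  have "\<epsilon> \<bullet>c \<epsilon> = of_real (1 / sqrt r) * (of_real (1 / sqrt r) * (w \<bullet>c w))"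
    using wc by (simp add: \<epsilon>_def conjugate_smult_vec del: of_real_divide)
  also have "\<dots> = 1"
    using r(1) unfolding r(2) by (simp flip: of_real_mult)
  finally have \<epsilon>1: "\<epsilon> \<bullet>c \<epsilon> = 1" .
  have E\<epsilon>: "E *\<^sub>v \<epsilon> = \<epsilon>"
    using Ew wc Ec by (simp add: \<epsilon>_def mult_mat_vec)
  have "E *\<^sub>v v = (v \<bullet>c \<epsilon>) \<cdot>\<^sub>v \<epsilon>" if v: "v \<in> carrier_vec k" for v
  proof -
    obtain c where c: "E *\<^sub>v v = c \<cdot>\<^sub>v \<epsilon>"
    proof
      have "w = of_real (sqrt r) \<cdot>\<^sub>v \<epsilon>"
        using r(1) wc by (simp add: \<epsilon>_def smult_smult_assoc)
      then show "E *\<^sub>v v = ((\<Sum>j<k. d j * v $ j) * of_real (sqrt r)) \<cdot>\<^sub>v \<epsilon>"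
        using range[OF v] by (simp add: smult_smult_assoc)
    qed
    have "(E *\<^sub>v v) \<bullet>c \<epsilon> = v \<bullet>c \<epsilon>"
      using cscalar_prod_mat_left[OF Ec v \<epsilon>c] Ea E\<epsilon> by simp
    then have "c = v \<bullet>c \<epsilon>" using c \<epsilon>1 \<epsilon>c by simp
    then show ?thesis using c by simp
  qed
  then show ?thesis using that \<epsilon>c \<epsilon>1 by blast
qed

section \<open>Matrix valued bounded holomorphic functions\<close>

definition Hinf :: "nat \<Rightarrow> nat \<Rightarrow> (complex \<Rightarrow> complex mat) set" where
  "Hinf k l = {G. (\<forall>z\<in>cball 0 1. G z \<in> carrier_mat k l) \<and>
     (\<forall>i<k. \<forall>j<l. bdd_hol (\<lambda>z. G z $$ (i, j)))}"

lemma Hinf_carrier: "G \<in> Hinf k l \<Longrightarrow> cmod z \<le> 1 \<Longrightarrow> G z \<in> carrier_mat k l"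
  by (auto simp: Hinf_def)

lemma Hinf_bdd_hol: "G \<in> Hinf k l \<Longrightarrow> i < k \<Longrightarrow> j < l \<Longrightarrow> bdd_hol (\<lambda>z. G z $$ (i, j))"
  by (auto simp: Hinf_def)

lemma Hinf_I:
  assumes "\<And>z. cmod z \<le> 1 \<Longrightarrow> G z \<in> carrier_mat k l"
    and "\<And>i j. i < k \<Longrightarrow> j < l \<Longrightarrow> bdd_hol (\<lambda>z. G z $$ (i, j))"
  shows "G \<in> Hinf k l"
  using assms by (auto simp: Hinf_def)

lemma Hinf_Linf [simp]: "G \<in> Hinf k l \<Longrightarrow> G \<in> Linf k l"
  by (rule Linf_I) (auto intro: Hinf_carrier Hinf_bdd_hol bdd_hol_ess_bounded)

lemma Hinf_mult:
  assumes G: "G \<in> Hinf k l" and H: "H \<in> Hinf l m"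
  shows "(\<lambda>z. G z * H z) \<in> Hinf k m"
proof (rule Hinf_I)
  fix i j assume ij: "i < k" "j < m"
  have "bdd_hol (\<lambda>z. \<Sum>r<l. G z $$ (i, r) * H z $$ (r, j))"
    using ij by (intro bdd_hol_sum bdd_hol_mult Hinf_bdd_hol[OF G] Hinf_bdd_hol[OF H]) auto
  then show "bdd_hol (\<lambda>z. (G z * H z) $$ (i, j))"
  proof (rule bdd_hol_cong)
    fix z :: complex assume "cmod z \<le> 1"
    then show "(\<Sum>r<l. G z $$ (i, r) * H z $$ (r, j)) = (G z * H z) $$ (i, j)"
      using ij Hinf_carrier[OF G, of z] Hinf_carrier[OF H, of z]
      by (simp add: scalar_prod_def lessThan_atLeast0)
  qed
next
  fix z :: complex assume "cmod z \<le> 1"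
  then show "G z * H z \<in> carrier_mat k m"
    using Hinf_carrier[OF G, of z] Hinf_carrier[OF H, of z] by simp
qed

lemma Hinf_cong:
  assumes "G \<in> Hinf k l" "\<And>z. cmod z \<le> 1 \<Longrightarrow> G z = H z"
  shows "H \<in> Hinf k l"
proof (rule Hinf_I)
  fix i j assume "i < k" "j < l"
  then show "bdd_hol (\<lambda>z. H z $$ (i, j))"
    by (rule bdd_hol_cong[OF Hinf_bdd_hol[OF assms(1)]]) (simp add: assms(2))
next
  fix z :: complex assume "cmod z \<le> 1"
  then show "H z \<in> carrier_mat k l" using Hinf_carrier[OF assms(1)] assms(2) by metis
qed

lemma Hinf_const [simp]: "A \<in> carrier_mat k l \<Longrightarrow> (\<lambda>_. A) \<in> Hinf k l"
  by (rule Hinf_I) auto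

lemma H2_coeff:
  assumes "x \<in> H2 k" "i < k" "m \<ge> 1"
  shows "(LINT t|circ. x (cis t) $ i * cis (of_nat m * t)) = 0"
proof -
  have "fourier x i (- int m) = 0" using assms unfolding H2_def by auto
  then show ?thesis by (simp add: fourier_def)
qed

lemma Hinf_H2:
  assumes G: "G \<in> Hinf k l" and x: "x \<in> H2 l"
  shows "mult_op G x \<in> H2 k"
proof (rule H2_I)
  have x2: "x \<in> L2 l" using x by simp
  show L2: "mult_op G x \<in> L2 k" by (rule L2_mult_op[OF Hinf_Linf[OF G] x2])
  fix i and j :: int assume i: "i < k" and j: "j < 0"
  define m where "m = nat (- j)"
  have m: "m \<ge> 1" "of_int j = - real m" using j by (auto simp: m_def)
  have eq: "mult_op G x (cis t) $ i = (\<Sum>r<l. G (cis t) $$ (i, r) * x (cis t) $ r)" for t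
    using Linf_cis[OF Hinf_Linf[OF G], of t] L2_cis[OF x2, of t] i
    by (simp add: mult_op_def scalar_prod_def lessThan_atLeast0)
  have int: "integrable circ (\<lambda>t. G (cis t) $$ (i, r) * x (cis t) $ r * cis (of_nat m * t))"
    if "r < l" for r
  proof -
    have "sq_integrable (\<lambda>t. G (cis t) $$ (i, r) * x (cis t) $ r)"
      using that i by (intro sq_integrable_mult bdd_hol_ess_bounded Hinf_bdd_hol[OF G] L2_sq[OF x2])
    moreover have "sq_integrable (\<lambda>t. cnj (cis (of_nat m * t)))"
      using ess_bounded_powi[of "int m"]
      by (intro ess_bounded_sq_integrable ess_bounded_cnj) (simp add: Complex.DeMoivre)
    ultimately show ?thesis using sq_integrable_prod_integrable by fastforce
  qed
  have "(LINT t|circ. mult_op G x (cis t) $ i * cis (of_nat m * t))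
      = (\<Sum>r<l. LINT t|circ. G (cis t) $$ (i, r) * x (cis t) $ r * cis (of_nat m * t))"
    using int by (simp add: eq sum_distrib_right)
  also have "\<dots> = 0"
    using i m by (intro sum.neutral ballI bdd_hol_mult_coeff Hinf_bdd_hol[OF G] L2_sq[OF x2]
      H2_coeff[OF x]) auto
  finally have "fourier (mult_op G x) i j = 0" by (simp add: fourier_def m)
  then show "ip (mult_op G x) (trig k i j) = 0" using L2 i by (simp add: fourier_ip[of _ k])
qed

lemma Hinf_adj_H2perp:
  assumes G: "G \<in> Hinf k l" and y: "y \<in> H2perp k"
  shows "mult_op (adj G) y \<in> H2perp l"
  using assms by (intro H2perp_I) (auto simp: ip_mult_op'[of _ k l] H2perp_orth Hinf_H2[of _ k l] L2_mult_op[of _ l k])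

lemma bdd_hol_H2:
  assumes a: "bdd_hol a" and x: "x \<in> H2 k"
  shows "(\<lambda>z. a z \<cdot>\<^sub>v x z) \<in> H2 k"
proof -
  have "(\<lambda>z. a z \<cdot>\<^sub>m 1\<^sub>m k) \<in> Hinf k k"
    using a by (intro Hinf_I) auto
  then have "mult_op (\<lambda>z. a z \<cdot>\<^sub>m 1\<^sub>m k) x \<in> H2 k" using x by (rule Hinf_H2)
  then show ?thesis
  proof (rule H2_ae)
    have x2: "x \<in> L2 k" using x by simp
    then show "(\<lambda>z. a z \<cdot>\<^sub>v x z) \<in> L2 k"
      by (intro L2_smult_fun bdd_hol_ess_bounded a)
    show "ae_eq (mult_op (\<lambda>z. a z \<cdot>\<^sub>m 1\<^sub>m k) x) (\<lambda>z. a z \<cdot>\<^sub>v x z)"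
      by (rule ae_eqI) (use L2_carrier[OF x2] in \<open>simp add: mult_op_def smult_mat_vec[of _ k k]\<close>)
  qed
qed

text \<open>
  Scalar products with the kernel functions \<open>v / (1 - cnj a z)\<close> evaluate at \<open>a\<close>.
\<close>

lemma Hinf_reproducing:
  assumes G: "G \<in> Hinf k l" and w: "w \<in> carrier_vec l" and v: "v \<in> carrier_vec k" and a: "cmod a < 1"
  shows "ip (mult_op G (\<lambda>_. w)) (\<lambda>z. (1 / (1 - cnj a * z)) \<cdot>\<^sub>v v) = (G a *\<^sub>v w) \<bullet>c v"
proof -
  define Y where "Y t = cnj (1 / (1 - cnj a * cis t))" for t
  have eq: "mult_op G (\<lambda>_. w) (cis t) \<bullet>c ((1 / (1 - cnj a * cis t)) \<cdot>\<^sub>v v) =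
      (\<Sum>i<k. \<Sum>j<l. w $ j * cnj (v $ i) * (G (cis t) $$ (i, j) * Y t))" for t
  proof -
    have "conjugate ((1 / (1 - cnj a * cis t)) \<cdot>\<^sub>v v) = Y t \<cdot>\<^sub>v conjugate v"
      by (intro eq_vecI) (auto simp: Y_def)
    then show ?thesis
      using Linf_cis[OF Hinf_Linf[OF G], of t] w v
      by (auto simp: mult_op_def scalar_prod_def lessThan_atLeast0
          sum_distrib_left sum_distrib_right mult_ac intro!: sum.cong)
  qed
  have int: "integrable circ (\<lambda>t. G (cis t) $$ (i, j) * Y t)" if "i < k" "j < l" for i j
    unfolding Y_def using that
    by (intro sq_integrable_prod_integrable ess_bounded_sq_integrable
        bdd_hol_ess_bounded[OF Hinf_bdd_hol[OF G]] bdd_hol_ess_bounded[OF bdd_hol_kernel[OF a]])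
  have val: "(LINT t|circ. G (cis t) $$ (i, j) * Y t) = of_real (2 * pi) * G a $$ (i, j)"
    if "i < k" "j < l" for i j
    unfolding Y_def using that by (intro bdd_hol_cauchy a Hinf_bdd_hol[OF G])
  have "(LINT t|circ. mult_op G (\<lambda>_. w) (cis t) \<bullet>c ((1 / (1 - cnj a * cis t)) \<cdot>\<^sub>v v))
     = (\<Sum>i<k. \<Sum>j<l. w $ j * cnj (v $ i) * (of_real (2 * pi) * G a $$ (i, j)))"
  proof -
    have "integrable circ (\<lambda>t. \<Sum>j<l. w $ j * cnj (v $ i) * (G (cis t) $$ (i, j) * Y t))"
      if "i < k" for i
      by (intro Bochner_Integration.integrable_sum integrable_mult_right) (use int that in auto)
    then have "(LINT t|circ. (\<Sum>i<k. \<Sum>j<l. w $ j * cnj (v $ i) * (G (cis t) $$ (i, j) * Y t)))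
      = (\<Sum>i<k. (LINT t|circ. (\<Sum>j<l. w $ j * cnj (v $ i) * (G (cis t) $$ (i, j) * Y t))))"
      by (intro Bochner_Integration.integral_sum) auto
    also have "\<dots> = (\<Sum>i<k. \<Sum>j<l. (LINT t|circ. w $ j * cnj (v $ i) * (G (cis t) $$ (i, j) * Y t)))"
      by (intro sum.cong refl Bochner_Integration.integral_sum integrable_mult_right) (use int in auto)
    also have "\<dots> = (\<Sum>i<k. \<Sum>j<l. w $ j * cnj (v $ i) * (of_real (2 * pi) * G a $$ (i, j)))"
      by (intro sum.cong refl) (simp add: val)
    finally show ?thesis unfolding eq .
  qed
  also have "\<dots> = of_real (2 * pi) * ((G a *\<^sub>v w) \<bullet>c v)"
    using Hinf_carrier[OF G, of a] w v a
    by (auto simp: cscalar_prod_sum[of _ k] scalar_prod_def lessThan_atLeast0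
        sum_distrib_left sum_distrib_right mult_ac intro!: sum.cong)
  finally show ?thesis by (simp add: ip_def)
qed

section \<open>Blaschke--Potapov products\<close>

definition inner_mvf :: "nat \<Rightarrow> (complex \<Rightarrow> complex mat) \<Rightarrow> bool" where
  "inner_mvf k b \<longleftrightarrow> b \<in> Hinf k k \<and> (\<forall>z. cmod z = 1 \<longrightarrow> mat_adjoint (b z) * b z = 1\<^sub>m k)"

text \<open>
  An orthonormal basis \<open>e 0, \<dots>, e (n - 1)\<close> of \<open>H\<^sub>2 \<ominus> b H\<^sub>2\<close> for inner \<open>b\<close>.  The last condition expresses
  that the \<open>e j\<close> are complete: \<open>b\<^sup>* x \<in> H\<^sub>2\<close> means that \<open>x = b (b\<^sup>* x)\<close> is in \<open>b H\<^sub>2\<close>.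
\<close>

definition model_basis ::
  "nat \<Rightarrow> (complex \<Rightarrow> complex mat) \<Rightarrow> nat \<Rightarrow> (nat \<Rightarrow> complex \<Rightarrow> complex vec) \<Rightarrow> bool" where
  "model_basis k b n e \<longleftrightarrow>
     (\<forall>j<n. e j \<in> H2 k) \<and>
     (\<forall>i<n. \<forall>j<n. ip (e i) (e j) = (if i = j then 1 else 0)) \<and>
     (\<forall>j<n. \<forall>x\<in>H2 k. ip (mult_op b x) (e j) = 0) \<and>
     (\<forall>x\<in>H2 k. (\<forall>j<n. ip x (e j) = 0) \<longrightarrow> mult_op (adj b) x \<in> H2 k)"

definition zero_poly :: "complex list \<Rightarrow> complex \<Rightarrow> complex" where
  "zero_poly as z = (\<Prod>a\<leftarrow>as. z - a)"

text \<open>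
  On the circle \<open>b\<^sup>* = b\<^sup>-\<^sup>1\<close>, so this says that \<open>b\<close> divides the scalar polynomial with the zeros
  \<open>as\<close>.
\<close>

definition divides_poly :: "nat \<Rightarrow> (complex \<Rightarrow> complex mat) \<Rightarrow> complex list \<Rightarrow> bool" where
  "divides_poly k b as \<longleftrightarrow>
     (\<forall>x\<in>H2 k. mult_op (adj b) (\<lambda>z. zero_poly as z \<cdot>\<^sub>v x z) \<in> H2 k)"

lemma bdd_hol_zero_poly [simp]: "bdd_hol (zero_poly as)"
  by (induction as) (auto simp: zero_poly_def[abs_def] intro!: bdd_hol_mult bdd_hol_minus)

lemma zero_poly_simps [simp]: "zero_poly [] z = 1" "zero_poly (a # as) z = (z - a) * zero_poly as z"
  "zero_poly (as @ bs) z = zero_poly as z * zero_poly bs z"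
  by (auto simp: zero_poly_def)

lemma inner_Hinf: "inner_mvf k b \<Longrightarrow> b \<in> Hinf k k"
  by (simp add: inner_mvf_def)

lemma inner_Linf: "inner_mvf k b \<Longrightarrow> b \<in> Linf k k"
  by (simp add: inner_mvf_def)

lemma inner_carrier: "inner_mvf k b \<Longrightarrow> cmod z = 1 \<Longrightarrow> b z \<in> carrier_mat k k"
  by (auto intro: Linf_carrier inner_Linf)

lemma inner_unitary:
  assumes "inner_mvf k b" "cmod z = 1"
  shows "mat_adjoint (b z) * b z = 1\<^sub>m k" "b z * mat_adjoint (b z) = 1\<^sub>m k"
proof -
  show 1: "mat_adjoint (b z) * b z = 1\<^sub>m k" using assms by (simp add: inner_mvf_def)
  have c: "b z \<in> carrier_mat k k" using assms by (rule inner_carrier)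
  show "b z * mat_adjoint (b z) = 1\<^sub>m k"
    by (rule mat_mult_left_right_inverse[OF _ c 1]) (use c in simp)
qed

lemma mult_op_assoc:
  assumes "G \<in> Linf k l" "H \<in> Linf l m" "x \<in> L2 m" "cmod z = 1"
  shows "mult_op G (mult_op H x) z = mult_op (\<lambda>z. G z * H z) x z"
  using Linf_carrier[OF assms(1,4)] Linf_carrier[OF assms(2,4)] L2_carrier[OF assms(3,4)]
  by (simp add: mult_op_def)

lemma inner_cancel:
  assumes b: "inner_mvf k b" and x: "x \<in> L2 k" and z: "cmod z = 1"
  shows "mult_op (adj b) (mult_op b x) z = x z" "mult_op b (mult_op (adj b) x) z = x z"
  using mult_op_assoc[OF Linf_adj[OF inner_Linf[OF b]] inner_Linf[OF b] x z]
    mult_op_assoc[OF inner_Linf[OF b] Linf_adj[OF inner_Linf[OF b]] x z]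
    inner_unitary[OF b z] L2_carrier[OF x z]
  by (simp_all add: mult_op_def)

lemma ip_inner:
  assumes b: "inner_mvf k b" and "x \<in> L2 k" "y \<in> L2 k"
  shows "ip (mult_op b x) (mult_op b y) = ip x y"
proof -
  have "ip (mult_op b x) (mult_op b y) = ip x (mult_op (adj b) (mult_op b y))"
    using assms by (intro ip_mult_op[of _ k k] inner_Linf L2_mult_op[of _ k k]) auto
  also have "\<dots> = ip x y"
    using assms by (intro ip_cong ae_eqI inner_cancel) auto
  finally show ?thesis .
qed

lemma inner_const:
  assumes "U \<in> carrier_mat k k" "mat_adjoint U * U = 1\<^sub>m k"
  shows "inner_mvf k (\<lambda>_. U)"
  using assms by (simp add: inner_mvf_def)

lemma model_basis_const:
  assumes "U \<in> carrier_mat k k"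
  shows "model_basis k (\<lambda>_. U) 0 e" "divides_poly k (\<lambda>_. U) []"
  using assms by (auto simp: model_basis_def divides_poly_def one_smult_vec intro!: Hinf_H2[of _ k k])

lemma inner_mult:
  assumes b1: "inner_mvf k b1" and b2: "inner_mvf k b2"
  shows "inner_mvf k (\<lambda>z. b1 z * b2 z)"
  unfolding inner_mvf_def
proof (intro conjI allI impI)
  show "(\<lambda>z. b1 z * b2 z) \<in> Hinf k k"
    by (intro Hinf_mult[of _ k k] inner_Hinf b1 b2)
  fix z :: complex assume z: "cmod z = 1"
  note c = inner_carrier[OF b1 z] inner_carrier[OF b2 z]
  have "mat_adjoint (b1 z * b2 z) * (b1 z * b2 z)
      = mat_adjoint (b2 z) * (mat_adjoint (b1 z) * (b1 z * b2 z))"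
    using c by (simp add: mat_adjoint_mult[of _ k k _ k] assoc_mult_mat[of _ k k _ k _ k])
  also have "mat_adjoint (b1 z) * (b1 z * b2 z) = (mat_adjoint (b1 z) * b1 z) * b2 z"
    using c by (simp add: assoc_mult_mat[of _ k k _ k _ k])
  finally show "mat_adjoint (b1 z * b2 z) * (b1 z * b2 z) = 1\<^sub>m k"
    using c inner_unitary(1)[OF b1 z] inner_unitary(1)[OF b2 z] by simp
qed

lemma mult_op_adj_mult:
  assumes "G \<in> Linf k l" "H \<in> Linf l m" "x \<in> L2 k" "cmod z = 1"
  shows "mult_op (adj (\<lambda>z. G z * H z)) x z = mult_op (adj H) (mult_op (adj G) x) z"
  using Linf_carrier[OF assms(1,4)] Linf_carrier[OF assms(2,4)] L2_carrier[OF assms(3,4)]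
  by (simp add: mult_op_def mat_adjoint_mult[of _ k l _ m] assoc_mult_mat_vec[of _ m l _ k])

text \<open>
  Scalar polynomials commute with matrices, hence
  \<open>(b\<^sub>1 b\<^sub>2)\<^sup>* p\<^sub>1 p\<^sub>2 = (b\<^sub>2\<^sup>* p\<^sub>2) (b\<^sub>1\<^sup>* p\<^sub>1)\<close>.
\<close>

lemma divides_poly_mult:
  assumes b1: "inner_mvf k b1" and b2: "inner_mvf k b2"
    and d1: "divides_poly k b1 as" and d2: "divides_poly k b2 bs"
  shows "divides_poly k (\<lambda>z. b1 z * b2 z) (as @ bs)"
  unfolding divides_poly_def
proof
  fix x assume x: "x \<in> H2 k"
  have scaled: "(\<lambda>z. zero_poly cs z \<cdot>\<^sub>v w z) \<in> L2 k" if "w \<in> L2 k" for cs w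
    using that by (intro L2_smult_fun bdd_hol_ess_bounded bdd_hol_zero_poly)
  define y where "y = mult_op (adj b1) (\<lambda>z. zero_poly as z \<cdot>\<^sub>v x z)"
  have y: "y \<in> H2 k" using d1 x by (simp add: divides_poly_def y_def)
  have "mult_op (adj b2) (\<lambda>z. zero_poly bs z \<cdot>\<^sub>v y z) \<in> H2 k"
    using d2 y by (simp add: divides_poly_def)
  then show "mult_op (adj (\<lambda>z. b1 z * b2 z)) (\<lambda>z. zero_poly (as @ bs) z \<cdot>\<^sub>v x z) \<in> H2 k"
  proof (rule H2_ae)
    show "mult_op (adj (\<lambda>z. b1 z * b2 z)) (\<lambda>z. zero_poly (as @ bs) z \<cdot>\<^sub>v x z) \<in> L2 k"
      using x by (intro L2_mult_op[of _ k k] scaled Linf_adj inner_Linf inner_mult b1 b2) simp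
    show "ae_eq (mult_op (adj b2) (\<lambda>z. zero_poly bs z \<cdot>\<^sub>v y z))
        (mult_op (adj (\<lambda>z. b1 z * b2 z)) (\<lambda>z. zero_poly (as @ bs) z \<cdot>\<^sub>v x z))"
    proof (rule ae_eqI)
      fix z :: complex assume z: "cmod z = 1"
      note c = inner_carrier[OF b1 z] inner_carrier[OF b2 z] L2_carrier[OF H2_L2[OF x] z]
      have "mult_op (adj (\<lambda>z. b1 z * b2 z)) (\<lambda>z. zero_poly (as @ bs) z \<cdot>\<^sub>v x z) z
         = mult_op (adj b2) (mult_op (adj b1) (\<lambda>z. zero_poly (as @ bs) z \<cdot>\<^sub>v x z)) z"
        by (rule mult_op_adj_mult[OF inner_Linf[OF b1] inner_Linf[OF b2] scaled z]) (use x in simp)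
      also have "\<dots> = mult_op (adj b2) (\<lambda>z. zero_poly bs z \<cdot>\<^sub>v y z) z"
      proof -
        have "mat_adjoint (b1 z) *\<^sub>v (zero_poly (as @ bs) z \<cdot>\<^sub>v x z)
          = zero_poly bs z \<cdot>\<^sub>v (mat_adjoint (b1 z) *\<^sub>v (zero_poly as z \<cdot>\<^sub>v x z))"
          using c by (simp add: mult_mat_vec[of _ k k] smult_smult_assoc mult.commute)
        then show ?thesis by (simp add: mult_op_def y_def)
      qed
      finally show "mult_op (adj b2) (\<lambda>z. zero_poly bs z \<cdot>\<^sub>v y z) z
         = mult_op (adj (\<lambda>z. b1 z * b2 z)) (\<lambda>z. zero_poly (as @ bs) z \<cdot>\<^sub>v x z) z" ..
    qed
  qed
qed

text \<open>
  The decomposition \<open>H(b\<^sub>1 b\<^sub>2) = H(b\<^sub>1) \<oplus> b\<^sub>1 H(b\<^sub>2)\<close>.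
\<close>

lemma model_basis_mult:
  assumes b1: "inner_mvf k b1" and b2: "inner_mvf k b2"
    and m1: "model_basis k b1 n1 e1" and m2: "model_basis k b2 n2 e2"
  shows "model_basis k (\<lambda>z. b1 z * b2 z) (n1 + n2)
    (\<lambda>j. if j < n1 then e1 j else mult_op b1 (e2 (j - n1)))"
    (is "model_basis k ?b ?n ?e")
proof -
  note L1 = inner_Linf[OF b1] and L2 = inner_Linf[OF b2]
  have e1: "e1 j \<in> H2 k" if "j < n1" for j using m1 that by (simp add: model_basis_def)
  have e2: "e2 j \<in> H2 k" if "j < n2" for j using m2 that by (simp add: model_basis_def)
  have o1: "ip (e1 i) (e1 j) = (if i = j then 1 else 0)" if "i < n1" "j < n1" for i j
    using m1 that by (simp add: model_basis_def)
  have o2: "ip (e2 i) (e2 j) = (if i = j then 1 else 0)" if "i < n2" "j < n2" for i j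
    using m2 that by (simp add: model_basis_def)
  have p1: "ip (mult_op b1 x) (e1 j) = 0" if "j < n1" "x \<in> H2 k" for x j
    using m1 that by (simp add: model_basis_def)
  have p2: "ip (mult_op b2 x) (e2 j) = 0" if "j < n2" "x \<in> H2 k" for x j
    using m2 that by (simp add: model_basis_def)
  have b1H: "mult_op b1 x \<in> H2 k" if "x \<in> H2 k" for x
    by (rule Hinf_H2[OF inner_Hinf[OF b1] that])
  have b2H: "mult_op b2 x \<in> H2 k" if "x \<in> H2 k" for x
    by (rule Hinf_H2[OF inner_Hinf[OF b2] that])
  have p1': "ip (e1 j) (mult_op b1 x) = 0" if "j < n1" "x \<in> H2 k" for x j
    using p1[OF that] by (subst ip_cnj[of _ k]) (auto simp: e1 b1H that)
  have split: "ip (mult_op ?b x) y = ip (mult_op b1 (mult_op b2 x)) y" if "x \<in> H2 k" for x y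
    using that by (intro ip_cong ae_eqI mult_op_assoc[OF L1 L2, symmetric]) auto
  show ?thesis unfolding model_basis_def
  proof (intro conjI allI impI ballI)
    fix j assume "j < ?n"
    then show "?e j \<in> H2 k" by (cases "j < n1") (auto intro!: e1 e2 b1H)
  next
    fix i j assume "i < ?n" "j < ?n"
    then show "ip (?e i) (?e j) = (if i = j then 1 else 0)"
      by (auto simp: o1 o2 p1 p1' e2 ip_inner[OF b1])
  next
    fix j x assume "j < ?n" "x \<in> H2 k"
    then show "ip (mult_op ?b x) (?e j) = 0"
      by (auto simp: split p1 p2 e2 b2H ip_inner[OF b1])
  next
    fix x assume x: "x \<in> H2 k" and o: "\<forall>j<?n. ip x (?e j) = 0"
    define y where "y = mult_op (adj b1) x"
    have "ip x (e1 j) = 0" if "j < n1" for j using o[rule_format, of j] that by simp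
    then have y: "y \<in> H2 k" using m1 x by (simp add: model_basis_def y_def)
    have "ip y (e2 j) = 0" if "j < n2" for j
      using o[rule_format, of "n1 + j"] that x L1 e2 by (simp add: y_def ip_mult_op'[of _ k k])
    then have "mult_op (adj b2) y \<in> H2 k" using m2 y by (simp add: model_basis_def)
    then show "mult_op (adj ?b) x \<in> H2 k"
    proof (rule H2_ae)
      show "mult_op (adj ?b) x \<in> L2 k"
        using x by (intro L2_mult_op[of _ k k] Linf_adj inner_Linf inner_mult b1 b2) simp
      show "ae_eq (mult_op (adj b2) y) (mult_op (adj ?b) x)"
        using mult_op_adj_mult[OF L1 L2 H2_L2[OF x]] by (intro ae_eqI) (simp add: y_def)
    qed
  qed
qed

context
  fixes k :: nat and a :: complex and E :: "complex mat"
  assumes a: "cmod a < 1" and E: "E \<in> rank1_projections k"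
begin

private definition "\<beta> z = (z - a) / (1 - cnj a * z)"
private definition "y z = 1 / (1 - cnj a * z)"

private lemma Ec: "E \<in> carrier_mat k k" and EE: "E * E = E" and Ea: "mat_adjoint E = E"
  using E by (auto simp: rank1_projections_def)

private lemma factor_eq: "bp_factor k (a, E) z = (1\<^sub>m k - E) + \<beta> z \<cdot>\<^sub>m E"
  by (simp add: bp_factor_def \<beta>_def)

private lemma y_ne: "cmod z = 1 \<Longrightarrow> 1 - cnj a * z \<noteq> 0"
  using one_minus_nonzero[OF a, of z] by simp

private lemma y_bdd_hol: "bdd_hol y"
  unfolding y_def[abs_def] by (rule bdd_hol_kernel[OF a])

private lemma \<beta>_bdd_hol: "bdd_hol \<beta>"
proof -
  have "bdd_hol (\<lambda>z. (z - a) * y z)" by (intro bdd_hol_mult bdd_hol_minus y_bdd_hol) auto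
  then show ?thesis by (simp add: \<beta>_def[abs_def] y_def)
qed

private lemma cnj_diff: "cmod z = 1 \<Longrightarrow> cnj (z - a) = cnj z * (1 - cnj a * z)"
  using cnj_unit_mult(1)[of z] by (simp add: algebra_simps)

text \<open>
  On the circle division by \<open>z - a\<close> is multiplication by \<open>cnj (z * y z)\<close>.
\<close>

private lemma diff_y: "cmod z = 1 \<Longrightarrow> (z - a) * (cnj z * cnj (y z)) = 1"
proof -
  assume z: "cmod z = 1"
  have "z - a = z * cnj (1 - cnj a * z)" using arg_cong[OF cnj_diff[OF z], of cnj] by simp
  moreover have "cnj (1 - cnj a * z) \<noteq> 0" using y_ne[OF z] by (metis complex_cnj_zero_iff)
  ultimately show ?thesis
    using cnj_unit_mult(2)[OF z] by (simp add: y_def del: complex_cnj_diff complex_cnj_mult)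
qed

private lemma cnj_\<beta>: "cmod z = 1 \<Longrightarrow> cnj (\<beta> z) = (1 - cnj a * z) * (cnj z * cnj (y z))"
  using cnj_diff[of z] by (simp add: \<beta>_def y_def mult_ac)

private lemma \<beta>_unit: "cmod z = 1 \<Longrightarrow> cnj (\<beta> z) * \<beta> z = 1"
proof -
  assume z: "cmod z = 1"
  have "cnj (\<beta> z) * \<beta> z = ((z - a) * (cnj z * cnj (y z))) * ((1 - cnj a * z) / (1 - cnj a * z))"
  proof -
    have "D * q * (n / D) = n * q * (D / D)" for D q n :: complex by simp
    then show ?thesis unfolding cnj_\<beta>[OF z] unfolding \<beta>_def .
  qed
  then show ?thesis using diff_y[OF z] y_ne[OF z] by simp
qed

private lemma adj_factor: "adj (bp_factor k (a, E)) z = (1\<^sub>m k - E) + cnj (\<beta> z) \<cdot>\<^sub>m E"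
proof -
  have "cnj (E $$ (j, i)) = E $$ (i, j)" if "i < k" "j < k" for i j
    using arg_cong[OF Ea, of "\<lambda>M. M $$ (i, j)"] that Ec by simp
  then show ?thesis using Ec by (intro eq_matI) (auto simp: factor_eq)
qed

lemma inner_bp_factor: "inner_mvf k (bp_factor k (a, E))"
  unfolding inner_mvf_def
proof (intro conjI allI impI)
  show "bp_factor k (a, E) \<in> Hinf k k"
  proof (rule Hinf_I)
    fix i j assume ij: "i < k" "j < k"
    have "bdd_hol (\<lambda>z. (1\<^sub>m k - E) $$ (i, j) + \<beta> z * E $$ (i, j))"
      by (intro bdd_hol_add bdd_hol_mult \<beta>_bdd_hol bdd_hol_const)
    then show "bdd_hol (\<lambda>z. bp_factor k (a, E) z $$ (i, j))"
      using ij Ec by (simp add: factor_eq)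
  qed (use Ec in \<open>simp add: factor_eq\<close>)
  fix z :: complex assume z: "cmod z = 1"
  define P where "P = 1\<^sub>m k - E"
  have Pc: "P \<in> carrier_mat k k" unfolding P_def by (rule minus_carrier_mat[OF Ec])
  have PE: "P * E = 0\<^sub>m k k" "E * P = 0\<^sub>m k k"
    using Ec EE by (auto simp: P_def minus_mult_distrib_mat[of _ k k _ _ k] mult_minus_distrib_mat[of _ k k _ k])
  have PP: "P * P = P"
  proof -
    have "P * P = (1\<^sub>m k - E) * P" by (simp add: P_def)
    also have "\<dots> = P - E * P" using Pc Ec by (simp add: minus_mult_distrib_mat[of _ k k _ _ k])
    finally show ?thesis using PE Pc by (auto intro!: eq_matI)
  qed
  have "(P + cnj (\<beta> z) \<cdot>\<^sub>m E) * (P + \<beta> z \<cdot>\<^sub>m E) = 1\<^sub>m k"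
  proof -
    have "(P + cnj (\<beta> z) \<cdot>\<^sub>m E) * (P + \<beta> z \<cdot>\<^sub>m E)
      = P * P + cnj (\<beta> z) \<cdot>\<^sub>m (E * P) + \<beta> z \<cdot>\<^sub>m (P * E + cnj (\<beta> z) \<cdot>\<^sub>m (E * E))"
      using Pc Ec by (simp add: add_mult_distrib_mat[of _ k k _ _ k] mult_add_distrib_mat[of _ k k _ k]
          mult_smult_distrib[of _ k k _ k] mult_smult_assoc_mat[of _ k k _ k])
    also have "\<dots> = P + (cnj (\<beta> z) * \<beta> z) \<cdot>\<^sub>m E"
      unfolding PP PE EE using Pc Ec by (intro eq_matI) auto
    also have "\<dots> = 1\<^sub>m k"
      unfolding \<beta>_unit[OF z] using Ec by (intro eq_matI) (auto simp: P_def)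
    finally show ?thesis .
  qed
  then show "mat_adjoint (bp_factor k (a, E) z) * bp_factor k (a, E) z = 1\<^sub>m k"
    unfolding adj_factor unfolding factor_eq P_def .
qed

private lemma adj_factor_apply:
  assumes "v \<in> carrier_vec k"
  shows "mat_adjoint (bp_factor k (a, E) z) *\<^sub>v v = (v - E *\<^sub>v v) + cnj (\<beta> z) \<cdot>\<^sub>v (E *\<^sub>v v)"
  unfolding adj_factor
  using add_mult_distrib_mat_vec[OF minus_carrier_mat[OF Ec] smult_carrier_mat[OF Ec] assms, of "1\<^sub>m k"]
    minus_mult_distrib_mat_vec[OF one_carrier_mat Ec assms] smult_mat_vec[OF Ec assms] assms
  by simp

private abbreviation "Eop \<equiv> mult_op (\<lambda>_. E)"

private lemma Eop_H2: "x \<in> H2 k \<Longrightarrow> Eop x \<in> H2 k"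
  by (rule Hinf_H2[OF Hinf_const[OF Ec]])

text \<open>
  The only singular part of the adjoint factor is \<open>cnj (\<beta> z)\<close>, and \<open>cnj (\<beta> z) (z - a) = 1 - cnj a z\<close> on the
  circle.
\<close>

lemma divides_poly_bp_factor: "divides_poly k (bp_factor k (a, E)) [a]"
  unfolding divides_poly_def
proof
  fix x assume x: "x \<in> H2 k"
  have "(\<lambda>z. (z - a) \<cdot>\<^sub>v (x z - Eop x z) + (1 - cnj a * z) \<cdot>\<^sub>v Eop x z) \<in> H2 k"
    using x by (intro H2_add bdd_hol_H2 H2_minus Eop_H2 bdd_hol_minus bdd_hol_mult) auto
  then show "mult_op (adj (bp_factor k (a, E))) (\<lambda>z. zero_poly [a] z \<cdot>\<^sub>v x z) \<in> H2 k"
  proof (rule H2_ae)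
    show "mult_op (adj (bp_factor k (a, E))) (\<lambda>z. zero_poly [a] z \<cdot>\<^sub>v x z) \<in> L2 k"
      using x by (intro L2_mult_op[of _ k k] L2_smult_fun Linf_adj inner_Linf[OF inner_bp_factor]
          bdd_hol_ess_bounded bdd_hol_zero_poly) auto
    show "ae_eq (\<lambda>z. (z - a) \<cdot>\<^sub>v (x z - Eop x z) + (1 - cnj a * z) \<cdot>\<^sub>v Eop x z)
      (mult_op (adj (bp_factor k (a, E))) (\<lambda>z. zero_poly [a] z \<cdot>\<^sub>v x z))"
    proof (rule ae_eqI)
      fix z :: complex assume z: "cmod z = 1"
      have xc: "x z \<in> carrier_vec k" using L2_carrier[OF H2_L2[OF x] z] .
      have "cnj (\<beta> z) * (z - a) = ((z - a) * (cnj z * cnj (y z))) * (1 - cnj a * z)"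
        unfolding cnj_\<beta>[OF z] by (simp only: mult_ac)
      then have *: "cnj (\<beta> z) * (z - a) = 1 - cnj a * z" unfolding diff_y[OF z] mult_1_left .
      have Ex: "E *\<^sub>v x z \<in> carrier_vec k" using Ec xc by (rule mult_mat_vec_carrier)
      have "mat_adjoint (bp_factor k (a, E) z) *\<^sub>v ((z - a) \<cdot>\<^sub>v x z)
        = (z - a) \<cdot>\<^sub>v (mat_adjoint (bp_factor k (a, E) z) *\<^sub>v x z)"
        by (rule mult_mat_vec[OF mat_adjoint_carrier[OF inner_carrier[OF inner_bp_factor z]] xc])
      also have "\<dots> = (z - a) \<cdot>\<^sub>v ((x z - E *\<^sub>v x z) + cnj (\<beta> z) \<cdot>\<^sub>v (E *\<^sub>v x z))"
        unfolding adj_factor_apply[OF xc] ..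
      also have "\<dots> = (z - a) \<cdot>\<^sub>v (x z - E *\<^sub>v x z) + (cnj (\<beta> z) * (z - a)) \<cdot>\<^sub>v (E *\<^sub>v x z)"
        using smult_add_distrib_vec[OF minus_carrier_vec[OF xc Ex] smult_carrier_vec[THEN iffD2, OF Ex], of "z - a"]
        by (simp only: smult_smult_assoc mult.commute)
      finally show "(z - a) \<cdot>\<^sub>v (x z - Eop x z) + (1 - cnj a * z) \<cdot>\<^sub>v Eop x z
         = mult_op (adj (bp_factor k (a, E))) (\<lambda>z. zero_poly [a] z \<cdot>\<^sub>v x z) z"
        unfolding * mult_op_def zero_poly_simps mult_1_right by (rule sym)
    qed
  qed
qed

text \<open>
  The model space of one factor is spanned by \<open>\<epsilon> / (1 - cnj a z)\<close>, where \<open>\<epsilon>\<close> is a unit vector in the range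
  of \<open>E\<close>.  If \<open>x \<in> H\<^sub>2\<close> is orthogonal to this kernel, then \<open>E x\<close> vanishes at \<open>a\<close>, and it remains to see that
  \<open>\<omega> = E x / (z - a)\<close> is in \<open>H\<^sub>2\<close>.  The equation \<open>E x = z \<omega> - a \<omega>\<close> links consecutive Fourier
  coefficients of \<open>\<omega>\<close>: the one with index \<open>-1\<close> vanishes because it is a scalar product of \<open>x\<close> with the kernel,
  and all others with negative index vanish by induction.
\<close>

lemma model_basis_bp_factor: "\<exists>e. model_basis k (bp_factor k (a, E)) 1 (\<lambda>_. e)"
proof -
  obtain \<epsilon> where \<epsilon>: "\<epsilon> \<in> carrier_vec k" "\<epsilon> \<bullet>c \<epsilon> = 1"
    and E\<epsilon>: "\<And>v. v \<in> carrier_vec k \<Longrightarrow> E *\<^sub>v v = (v \<bullet>c \<epsilon>) \<cdot>\<^sub>v \<epsilon>"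
    using rank1_projection_vector[OF E] by blast
  have r: "1 - (cmod a)\<^sup>2 > 0" using a by (simp add: abs_square_less_1)
  \<comment> \<open>normalizes the kernel, whose squared norm is its value \<open>1 / (1 - (cmod a)\<^sup>2)\<close> at \<open>a\<close>\<close>
  define c where "c = complex_of_real (sqrt (1 - (cmod a)\<^sup>2))"
  have cc: "c * cnj c = 1 - a * cnj a" "c \<noteq> 0"
  proof -
    have "c * cnj c = complex_of_real (sqrt (1 - (cmod a)\<^sup>2) * sqrt (1 - (cmod a)\<^sup>2))"
      by (simp only: c_def complex_cnj_complex_of_real of_real_mult)
    also have "sqrt (1 - (cmod a)\<^sup>2) * sqrt (1 - (cmod a)\<^sup>2) = 1 - (cmod a)\<^sup>2" using r by simp
    also have "complex_of_real (1 - (cmod a)\<^sup>2) = 1 - a * cnj a"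
      by (simp add: complex_norm_square del: of_real_power)
    finally show "c * cnj c = 1 - a * cnj a" .
    show "c \<noteq> 0" using r by (simp add: c_def)
  qed
  define f where "f z = y z \<cdot>\<^sub>v \<epsilon>" for z
  define e where "e z = c \<cdot>\<^sub>v f z" for z
  have f: "f \<in> H2 k" unfolding f_def using \<epsilon> by (intro bdd_hol_H2 y_bdd_hol) auto
  have e: "e \<in> H2 k" unfolding e_def[abs_def] using f by simp
  have repr: "ip (\<lambda>z. y z \<cdot>\<^sub>v w) (\<lambda>z. y z \<cdot>\<^sub>v v) = y a * (w \<bullet>c v)"
    if "w \<in> carrier_vec k" "v \<in> carrier_vec k" for w v
  proof -
    have G: "(\<lambda>z. y z \<cdot>\<^sub>m 1\<^sub>m k) \<in> Hinf k k" using y_bdd_hol by (intro Hinf_I) auto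
    have "mult_op (\<lambda>z. y z \<cdot>\<^sub>m 1\<^sub>m k) (\<lambda>_. w) = (\<lambda>z. y z \<cdot>\<^sub>v w)"
      using that by (auto simp: mult_op_def smult_mat_vec[of _ k k])
    then show ?thesis
      using Hinf_reproducing[OF G that a] that by (simp add: smult_mat_vec[of _ k k] flip: y_def)
  qed
  have ee: "ip e e = 1"
  proof -
    have "ip e e = c * cnj c * ip f f"
      unfolding e_def[abs_def] using f by (simp add: ip_smult_left[of _ k] ip_smult_right[of _ k])
    also have "ip f f = y a" unfolding f_def[abs_def] using repr[OF \<epsilon>(1) \<epsilon>(1)] \<epsilon>(2) by simp
    finally have "ip e e = (1 - a * cnj a) / (1 - cnj a * a)" unfolding cc(1) y_def by simp
    moreover have "1 - a * cnj a \<noteq> 0" using cc by (metis complex_cnj_zero_iff mult_eq_0_iff)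
    ultimately show ?thesis by (simp add: mult.commute)
  qed
  have orth: "ip (mult_op (bp_factor k (a, E)) x) e = 0" if x: "x \<in> H2 k" for x
  proof -
    have "ip (mult_op (bp_factor k (a, E)) x) e = ip x (mult_op (adj (bp_factor k (a, E))) e)"
      using x e by (intro ip_mult_op[of _ k k] inner_Linf[OF inner_bp_factor]) auto
    also have "\<dots> = ip x (\<lambda>z. cnj (z * y z) \<cdot>\<^sub>v (c \<cdot>\<^sub>v \<epsilon>))"
    proof (rule ip_cong_right)
      fix z :: complex assume z: "cmod z = 1"
      have "e z \<in> carrier_vec k" "E *\<^sub>v e z = e z"
        using \<epsilon> by (auto simp: e_def f_def E\<epsilon>)
      then have "mult_op (adj (bp_factor k (a, E))) e z = cnj (\<beta> z) \<cdot>\<^sub>v e z"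
        by (simp add: mult_op_def adj_factor_apply)
      also have "\<dots> = (cnj (\<beta> z) * (c * y z)) \<cdot>\<^sub>v \<epsilon>"
        by (simp add: e_def f_def smult_smult_assoc)
      also have "cnj (\<beta> z) * (c * y z) = ((1 - cnj a * z) * y z) * (cnj z * cnj (y z) * c)"
        unfolding cnj_\<beta>[OF z] by (simp only: mult_ac)
      also have "(1 - cnj a * z) * y z = 1" using y_ne[OF z] by (simp add: y_def)
      also have "(1 * (cnj z * cnj (y z) * c)) \<cdot>\<^sub>v \<epsilon> = cnj (z * y z) \<cdot>\<^sub>v (c \<cdot>\<^sub>v \<epsilon>)"
        by (simp add: smult_smult_assoc)
      finally show "mult_op (adj (bp_factor k (a, E))) e z = cnj (z * y z) \<cdot>\<^sub>v (c \<cdot>\<^sub>v \<epsilon>)" .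
    qed
    also have "\<dots> = ip (\<lambda>z. (z * y z) \<cdot>\<^sub>v x z) (\<lambda>_. c \<cdot>\<^sub>v \<epsilon>)"
      using x \<epsilon> by (intro ip_smult_fun[of _ k, symmetric]) auto
    also have "\<dots> = ip (\<lambda>z. z \<cdot>\<^sub>v (y z \<cdot>\<^sub>v x z)) (\<lambda>_. c \<cdot>\<^sub>v \<epsilon>)"
      by (simp add: smult_smult_assoc)
    also have "\<dots> = 0"
      using x \<epsilon> by (intro ip_shift_const[of _ k] bdd_hol_H2 y_bdd_hol) auto
    finally show ?thesis .
  qed
  have div: "mult_op (adj (bp_factor k (a, E))) x \<in> H2 k" if x: "x \<in> H2 k" and xe: "ip x e = 0" for x
  proof -
    define w where "w = Eop x"
    have w: "w \<in> H2 k" using Eop_H2[OF x] by (simp add: w_def)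
    define \<omega> where "\<omega> z = (cnj z * cnj (y z)) \<cdot>\<^sub>v w z" for z
    have \<omega>2: "\<omega> \<in> L2 k"
      unfolding \<omega>_def using w
      by (intro L2_smult_fun ess_bounded_mult ess_bounded_cnj bdd_hol_ess_bounded[OF y_bdd_hol]) auto
    have rec: "ip w (trig k i j) = ip \<omega> (trig k i (j - 1)) - a * ip \<omega> (trig k i j)" for i j
    proof -
      have "ip w (trig k i j) = ip (\<lambda>z. z \<cdot>\<^sub>v \<omega> z - a \<cdot>\<^sub>v \<omega> z) (trig k i j)"
      proof (rule ip_cong_left)
        fix z :: complex assume z: "cmod z = 1"
        have wc: "w z \<in> carrier_vec k" using L2_carrier[OF H2_L2[OF w] z] .
        have "z \<cdot>\<^sub>v \<omega> z - a \<cdot>\<^sub>v \<omega> z = ((z - a) * (cnj z * cnj (y z))) \<cdot>\<^sub>v w z"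
          using wc by (intro eq_vecI) (auto simp: \<omega>_def algebra_simps)
        then show "w z = z \<cdot>\<^sub>v \<omega> z - a \<cdot>\<^sub>v \<omega> z" by (simp add: diff_y[OF z])
      qed
      also have "\<dots> = ip \<omega> (trig k i (j - 1)) - a * ip \<omega> (trig k i j)"
        using \<omega>2 by (simp add: ip_minus_left[of _ k] ip_smult_left[of _ k] ip_shift_trig)
      finally show ?thesis .
    qed
    have start: "ip \<omega> (trig k i (- 1)) = 0" if i: "i < k" for i
    proof -
      have "ip \<omega> (trig k i (- 1)) = ip w (\<lambda>z. cnj (cnj z * cnj (y z)) \<cdot>\<^sub>v trig k i (- 1) z)"
        unfolding \<omega>_def using w by (intro ip_smult_fun[of _ k]) auto
      also have "\<dots> = ip w (\<lambda>z. y z \<cdot>\<^sub>v unit_vec k i)"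
      proof (rule ip_cong_right)
        fix z :: complex assume z: "cmod z = 1"
        then have "z \<noteq> 0" by auto
        then have "z * y z * inverse z = y z" by simp
        then show "cnj (cnj z * cnj (y z)) \<cdot>\<^sub>v trig k i (- 1) z = y z \<cdot>\<^sub>v unit_vec k i"
          by (simp only: trig_def smult_smult_assoc complex_cnj_mult complex_cnj_cnj
              power_int_minus power_int_1_right)
      qed
      also have "\<dots> = ip x (mult_op (adj (\<lambda>_. E)) (\<lambda>z. y z \<cdot>\<^sub>v unit_vec k i))"
        unfolding w_def using x Ec
        by (intro ip_mult_op[of _ k k] Hinf_Linf H2_L2 bdd_hol_H2 y_bdd_hol) auto
      also have "\<dots> = ip x (\<lambda>z. (cnj (\<epsilon> $ i) / c) \<cdot>\<^sub>v e z)"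
      proof (rule ip_cong_right)
        fix z :: complex assume z: "cmod z = 1"
        have Eu: "E *\<^sub>v unit_vec k i = cnj (\<epsilon> $ i) \<cdot>\<^sub>v \<epsilon>"
          unfolding E\<epsilon>[OF unit_vec_carrier] using i \<epsilon>(1) by simp
        have "mult_op (adj (\<lambda>_. E)) (\<lambda>z. y z \<cdot>\<^sub>v unit_vec k i) z = y z \<cdot>\<^sub>v (E *\<^sub>v unit_vec k i)"
          unfolding mult_op_def Ea by (rule mult_mat_vec[OF Ec unit_vec_carrier])
        also have "\<dots> = (cnj (\<epsilon> $ i) / c * (c * y z)) \<cdot>\<^sub>v \<epsilon>"
          unfolding Eu smult_smult_assoc using cc(2) by (simp add: mult.commute)
        also have "\<dots> = (cnj (\<epsilon> $ i) / c) \<cdot>\<^sub>v e z"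
          unfolding e_def f_def smult_smult_assoc ..
        finally show "mult_op (adj (\<lambda>_. E)) (\<lambda>z. y z \<cdot>\<^sub>v unit_vec k i) z = (cnj (\<epsilon> $ i) / c) \<cdot>\<^sub>v e z" .
      qed
      also have "\<dots> = cnj (cnj (\<epsilon> $ i) / c) * ip x e"
        by (rule ip_smult_right[OF H2_L2[OF e] H2_L2[OF x]])
      also have "\<dots> = 0" unfolding xe by (rule mult_zero_right)
      finally show ?thesis .
    qed
    have neg: "ip \<omega> (trig k i (- 1 - int n)) = 0" if "i < k" for i n
    proof (induction n)
      case (Suc n)
      have "ip w (trig k i (- 1 - int n)) = 0" using w that by (intro H2_trig) auto
      then show ?case using rec[of i "- 1 - int n"] Suc by (simp add: algebra_simps)
    qed (use start that in simp)
    have \<omega>: "\<omega> \<in> H2 k"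
    proof (rule H2_I[OF \<omega>2])
      fix i and j :: int assume "i < k" "j < 0"
      then show "ip \<omega> (trig k i j) = 0" using neg[of i "nat (- 1 - j)"] by simp
    qed
    have "(\<lambda>z. (x z - w z) + (1 - cnj a * z) \<cdot>\<^sub>v \<omega> z) \<in> H2 k"
      using x w \<omega> by (intro H2_add H2_minus bdd_hol_H2 bdd_hol_minus bdd_hol_mult) auto
    then show ?thesis
    proof (rule H2_ae)
      show "mult_op (adj (bp_factor k (a, E))) x \<in> L2 k"
        using x by (intro L2_mult_op[of _ k k] Linf_adj inner_Linf[OF inner_bp_factor]) auto
      show "ae_eq (\<lambda>z. (x z - w z) + (1 - cnj a * z) \<cdot>\<^sub>v \<omega> z) (mult_op (adj (bp_factor k (a, E))) x)"
      proof (rule ae_eqI)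
        fix z :: complex assume z: "cmod z = 1"
        have xc: "x z \<in> carrier_vec k" using L2_carrier[OF H2_L2[OF x] z] .
        show "(x z - w z) + (1 - cnj a * z) \<cdot>\<^sub>v \<omega> z = mult_op (adj (bp_factor k (a, E))) x z"
          unfolding w_def \<omega>_def mult_op_def adj_factor_apply[OF xc] cnj_\<beta>[OF z]
          by (simp only: smult_smult_assoc)
      qed
    qed
  qed
  have "model_basis k (bp_factor k (a, E)) 1 (\<lambda>_. e)"
    unfolding model_basis_def
  proof (intro conjI allI ballI impI)
    fix x assume "x \<in> H2 k" "\<forall>j<1::nat. ip x e = 0"
    then show "mult_op (adj (bp_factor k (a, E))) x \<in> H2 k" by (intro div) auto
  qed (use e ee orth in simp_all)
  then show ?thesis by blast
qed

end

text \<open>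
  Induction over the factors.  The constant unitary matrix counts as an inner function with trivial model
  space.
\<close>

lemma bp_product_structure:
  assumes "bp_product \<kappa> k b"
  shows "inner_mvf k b" "\<exists>e. model_basis k b \<kappa> e"
    "\<exists>as. set as \<subseteq> ball 0 1 \<and> divides_poly k b as"
proof -
  obtain U xs where U: "U \<in> carrier_mat k k" "mat_adjoint U * U = 1\<^sub>m k"
    and xs: "length xs = \<kappa>" "set xs \<subseteq> ball 0 1 \<times> rank1_projections k"
    and b: "\<And>z. z \<in> cball 0 1 \<Longrightarrow> b z = U * foldr (\<lambda>x B. bp_factor k x z * B) xs (1\<^sub>m k)"
    using assms unfolding bp_product_def by blast
  define p where "p xs z = foldr (\<lambda>x B. bp_factor k x z * B) xs (1\<^sub>m k)" for xs z
  have p: "inner_mvf k (p xs) \<and> (\<exists>e. model_basis k (p xs) (length xs) e) \<and>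
      (\<exists>as. set as \<subseteq> ball 0 1 \<and> divides_poly k (p xs) as)"
    using xs(2)
  proof (induction xs)
    case Nil
    have "p [] = (\<lambda>_. 1\<^sub>m k)" by (auto simp: p_def)
    then show ?case
      using inner_const[of "1\<^sub>m k" k] model_basis_const[of "1\<^sub>m k" k] by (auto intro: exI[of _ "[]"])
  next
    case (Cons x xs)
    obtain a E where x: "x = (a, E)" by (cases x)
    with Cons.prems have "a \<in> ball 0 1" and E: "E \<in> rank1_projections k" by auto
    then have a: "cmod a < 1" by simp
    have "set xs \<subseteq> ball 0 1 \<times> rank1_projections k" using Cons.prems by simp
    with Cons.IH obtain e as where IH: "inner_mvf k (p xs)" "model_basis k (p xs) (length xs) e"
      "set as \<subseteq> ball 0 1" "divides_poly k (p xs) as" by blast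
    obtain e1 where e1: "model_basis k (bp_factor k (a, E)) 1 (\<lambda>_. e1)"
      using model_basis_bp_factor[OF a E] by blast
    note F = inner_bp_factor[OF a E]
    have eq: "p (x # xs) = (\<lambda>z. bp_factor k (a, E) z * p xs z)" by (simp add: p_def x fun_eq_iff)
    have "inner_mvf k (p (x # xs))" unfolding eq by (rule inner_mult[OF F IH(1)])
    moreover have "\<exists>e. model_basis k (p (x # xs)) (length (x # xs)) e"
    proof -
      have "length (x # xs) = 1 + length xs" by simp
      then show ?thesis unfolding eq using model_basis_mult[OF F IH(1) e1 IH(2)] by (intro exI) (simp only:)
    qed
    moreover have "divides_poly k (p (x # xs)) (a # as)"
      unfolding eq using divides_poly_mult[OF F IH(1) divides_poly_bp_factor[OF a E] IH(4)] by simp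
    moreover have "set (a # as) \<subseteq> ball 0 1" using a IH(3) by simp
    ultimately show ?case by blast
  qed
  then obtain e as where p: "inner_mvf k (p xs)" "model_basis k (p xs) \<kappa> e"
      "set as \<subseteq> ball 0 1" "divides_poly k (p xs) as" unfolding xs(1) by blast
  let ?b = "\<lambda>z. U * p xs z"
  note UI = inner_const[OF U]
  have 1: "inner_mvf k ?b" by (rule inner_mult[OF UI p(1)])
  have 2: "model_basis k ?b \<kappa> (\<lambda>j. mult_op (\<lambda>_. U) (e j))"
    using model_basis_mult[OF UI p(1) model_basis_const(1)[OF U(1)] p(2)] by simp
  have 3: "divides_poly k ?b as"
    using divides_poly_mult[OF UI p(1) model_basis_const(2)[OF U(1)] p(4)] by simp
  have bb: "b z = ?b z" if "cmod z \<le> 1" for z using b[of z] that by (simp add: p_def)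
  have bH: "b \<in> Hinf k k" by (rule Hinf_cong[OF inner_Hinf[OF 1]]) (simp add: bb)
  show "inner_mvf k b" using 1 bH by (simp add: inner_mvf_def bb)
  have m: "ae_eq (mult_op ?b x) (mult_op b x)" "ae_eq (mult_op (adj ?b) x) (mult_op (adj b) x)" for x
    by (auto intro!: ae_eqI simp: mult_op_def bb)
  have adj: "mult_op (adj b) x \<in> H2 k" if "mult_op (adj ?b) x \<in> H2 k" "x \<in> L2 k" for x
    by (rule H2_ae[OF that(1) m(2)]) (use that bH in \<open>auto intro!: L2_mult_op[of _ k k]\<close>)
  have ipb: "ip (mult_op b x) w = ip (mult_op ?b x) w" for x w
    by (rule ip_cong[OF ae_eq_sym[OF m(1)] ae_eq_refl])
  have "model_basis k b \<kappa> (\<lambda>j. mult_op (\<lambda>_. U) (e j))"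
    unfolding model_basis_def
  proof (intro conjI ballI impI)
    fix x assume x: "x \<in> H2 k" "\<forall>j<\<kappa>. ip x (mult_op (\<lambda>_. U) (e j)) = 0"
    then have "mult_op (adj ?b) x \<in> H2 k" using 2 unfolding model_basis_def by blast
    then show "mult_op (adj b) x \<in> H2 k" using x(1) by (intro adj) auto
  qed (use 2 in \<open>simp_all add: model_basis_def ipb\<close>)
  then show "\<exists>e. model_basis k b \<kappa> e" by blast
  have "divides_poly k b as"
    unfolding divides_poly_def
  proof
    fix x assume x: "x \<in> H2 k"
    show "mult_op (adj b) (\<lambda>z. zero_poly as z \<cdot>\<^sub>v x z) \<in> H2 k"
    proof (rule adj)
      show "mult_op (adj ?b) (\<lambda>z. zero_poly as z \<cdot>\<^sub>v x z) \<in> H2 k"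
        using 3 x unfolding divides_poly_def by blast
      show "(\<lambda>z. zero_poly as z \<cdot>\<^sub>v x z) \<in> L2 k"
        using x by (intro H2_L2 bdd_hol_H2 bdd_hol_zero_poly)
    qed
  qed
  then show "\<exists>as. set as \<subseteq> ball 0 1 \<and> divides_poly k b as" using p(3) by blast
qed

section \<open>Schur functions and boundary values\<close>

lemma neg_eigs_1x1:
  assumes "c \<in> \<real>" "neg_eigs (Matrix.mat 1 1 (\<lambda>_. c)) = 0"
  shows "Re c \<ge> 0"
proof (rule ccontr)
  assume "\<not> Re c \<ge> 0"
  let ?A = "Matrix.mat 1 1 (\<lambda>_. c)"
  have "char_poly ?A = (\<Prod>a\<leftarrow>diag_mat ?A. [:- a, 1:])"
    by (rule char_poly_upper_triangular[of _ 1]) (auto simp: upper_triangular_def)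
  then have cp: "char_poly ?A = [:- c, 1:]" by (simp add: diag_mat_def)
  have "c \<in># filter_mset (\<lambda>x. x \<in> \<real> \<and> Re x < 0) (proots (char_poly ?A))"
    unfolding cp using assms(1) \<open>\<not> Re c \<ge> 0\<close> by simp
  then show False using assms(2) unfolding neg_eigs_def by auto
qed

text \<open>
  The Gram matrix of a single point \<open>z\<close> and the \<open>i\<close>-th unit vector has the single entry
  \<open>(1 - S) / (1 - (cmod z)\<^sup>2)\<close>, where \<open>S\<close> is the squared norm of the \<open>i\<close>-th row of \<open>s z\<close>; absence of negative
  eigenvalues means \<open>S \<le> 1\<close>.
\<close>

lemma schur_entry_bound:
  assumes s: "s \<in> schur_class p q" and z: "z \<in> hol_domain p q s" and i: "i < p" and j: "j < q"
  shows "cmod (s z $$ (i, j)) \<le> 1"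
proof -
  have zb: "cmod z < 1" using z by (simp add: hol_domain_def)
  have sc: "s z \<in> carrier_mat p q"
    using s zb by (simp add: gen_schur_def meromorphic_mvf_def)
  let ?K = "schur_kernel p s z z" and ?u = "unit_vec p i :: complex vec"
  define S where "S = (\<Sum>r<q. (cmod (s z $$ (i, r)))\<^sup>2)"
  define c where "c = complex_of_real ((1 - S) / (1 - (cmod z)\<^sup>2))"
  have "(s z * mat_adjoint (s z)) $$ (i, i) = of_real S"
    using sc i by (simp add: scalar_prod_def S_def lessThan_atLeast0 complex_norm_square del: of_real_power)
  then have Kii: "?K $$ (i, i) = c"
    using sc i by (simp add: schur_kernel_def c_def complex_norm_square del: of_real_power)
  have Kc: "?K \<in> carrier_mat p p" unfolding schur_kernel_def
    by (intro smult_carrier_mat minus_carrier_mat mult_carrier_mat[OF sc] mat_adjoint_carrier sc)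
  have "(?K *\<^sub>v ?u) \<bullet>c ?u = c"
    using Kc i Kii by simp
  then have g: "gram (schur_kernel p s) [(z, ?u)] = Matrix.mat 1 1 (\<lambda>_. c)"
    by (intro eq_matI) (auto simp: gram_def)
  have "neg_eigs (gram (schur_kernel p s) [(z, ?u)]) \<le> 0"
    using s z unfolding gen_schur_def has_neg_squares_def
    by (elim CollectE conjE allE[of _ "[(z, ?u)]"]) auto
  then have "Re c \<ge> 0" using g by (intro neg_eigs_1x1) (auto simp: c_def)
  moreover have "1 - (cmod z)\<^sup>2 > 0" using zb by (simp add: abs_square_less_1)
  ultimately have "S \<le> 1" by (simp add: c_def field_simps)
  moreover have "(cmod (s z $$ (i, j)))\<^sup>2 \<le> S"
    unfolding S_def using j by (intro member_le_sum) auto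
  ultimately have "(cmod (s z $$ (i, j)))\<^sup>2 \<le> 1" by linarith
  then show ?thesis by (simp add: abs_square_le_1)
qed

lemma eventually_hol_domain:
  assumes s: "meromorphic_mvf p q s" and z: "z \<in> ball 0 1"
  shows "\<forall>\<^sub>F w in at z. w \<in> hol_domain p q s"
proof -
  have an: "\<forall>\<^sub>F w in at z. (\<lambda>w. s w $$ (i, j)) analytic_on {w}" if "i < p" "j < q" for i j
  proof -
    have "(\<lambda>w. s w $$ (i, j)) meromorphic_on ball 0 1"
      using s that unfolding meromorphic_mvf_def nicely_meromorphic_on_def by blast
    then have "(\<lambda>w. s w $$ (i, j)) meromorphic_on {z}"
      by (rule meromorphic_on_subset) (use z in auto)
    then have "isolated_singularity_at (\<lambda>w. s w $$ (i, j)) z"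
      by (intro meromorphic_on_isolated_singularity)
    then obtain r where r: "r > 0" "(\<lambda>w. s w $$ (i, j)) analytic_on ball z r - {z}"
      by (auto simp: isolated_singularity_at_def)
    have "\<forall>\<^sub>F w in at z. w \<in> ball z r - {z}"
      using r(1) by (auto simp: eventually_at dist_commute intro!: exI[of _ r])
    then show ?thesis by eventually_elim (use r(2) in \<open>auto intro: analytic_on_subset\<close>)
  qed
  have "\<forall>\<^sub>F w in at z. w \<in> ball 0 1"
    using z by (intro eventually_at_in_open') auto
  moreover have "\<forall>\<^sub>F w in at z. \<forall>i\<in>{..<p}. \<forall>j\<in>{..<q}. (\<lambda>w. s w $$ (i, j)) analytic_on {w}"
    by (intro eventually_ball_finite ballI an) auto
  ultimately show ?thesis by eventually_elim (auto simp: hol_domain_def)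
qed

text \<open>
  Poles are isolated in the disc but could accumulate at the circle.  A radius therefore contains points of
  holomorphy arbitrarily close to its end point, which is enough to identify limits.
\<close>

lemma frequently_hol_domain:
  assumes s: "meromorphic_mvf p q s"
  shows "\<exists>\<^sub>F r in at_left (1::real). of_real r * cis t \<in> hol_domain p q s"
  unfolding frequently_def
proof
  assume "\<forall>\<^sub>F r in at_left (1::real). of_real r * cis t \<notin> hol_domain p q s"
  with at_left_unit have "\<forall>\<^sub>F r in at_left (1::real). 0 < r \<and> r < 1 \<and> of_real r * cis t \<notin> hol_domain p q s"
    by eventually_elim auto
  then obtain b where b: "b < 1" "\<And>r. b < r \<Longrightarrow> r < 1 \<Longrightarrow> 0 < r \<and> of_real r * cis t \<notin> hol_domain p q s"
    unfolding eventually_at_left_field by blast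
  define r0 where "r0 = (b + 1) / 2"
  have r0: "b < r0" "r0 < 1" using b(1) by (auto simp: r0_def)
  have lim: "filterlim (\<lambda>r. of_real r * cis t) (at (of_real r0 * cis t)) (at r0)"
    by (rule filterlim_atI) (auto intro!: tendsto_eq_intros simp: eventually_at_filter)
  have "\<forall>\<^sub>F w in at (of_real r0 * cis t). w \<in> hol_domain p q s"
    using b(2)[OF r0] r0 by (intro eventually_hol_domain[OF s]) (simp add: norm_mult)
  then have "\<forall>\<^sub>F r in at r0. of_real r * cis t \<in> hol_domain p q s"
    by (rule eventually_compose_filterlim[OF _ lim])
  moreover have "\<forall>\<^sub>F r in at r0. r \<in> {b<..<1}"
    using r0 by (intro eventually_at_in_open') auto
  ultimately have "\<forall>\<^sub>F r in at r0. False"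
    by eventually_elim (use b(2) in auto)
  then show False by simp
qed

text \<open>
  A Schur function is contractive off its poles and therefore has none.
\<close>

lemma schur_Hinf:
  assumes s: "s \<in> schur_class p q" and b: "bdry_values p q s"
  shows "s \<in> Hinf p q"
proof (rule Hinf_I)
  have m: "meromorphic_mvf p q s" using s by (simp add: gen_schur_def)
  fix z :: complex assume "cmod z \<le> 1"
  then show "s z \<in> carrier_mat p q"
    using m b by (cases "cmod z = 1") (auto simp: meromorphic_mvf_def bdry_values_def)
next
  have m: "meromorphic_mvf p q s" using s by (simp add: gen_schur_def)
  fix i j assume ij: "i < p" "j < q"
  let ?f = "\<lambda>z. s z $$ (i, j)"
  have nm: "?f nicely_meromorphic_on ball 0 1"
    using m ij by (simp add: meromorphic_mvf_def)
  have ev: "\<forall>\<^sub>F w in at z. cmod (?f w) \<le> 1" if "z \<in> ball 0 1" for z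
    using eventually_hol_domain[OF m that] by eventually_elim (rule schur_entry_bound[OF s _ ij])
  have an: "?f analytic_on {z}" if z: "z \<in> ball 0 1" for z
  proof (rule nicely_meromorphic_on_imp_analytic_at[OF nm z])
    show "\<not> is_pole ?f z"
    proof
      assume "is_pole ?f z"
      then have "\<forall>\<^sub>F w in at z. 2 \<le> cmod (?f w)"
        unfolding is_pole_def filterlim_at_infinity[OF order_refl] by (elim allE[of _ 2]) simp
      with ev[OF z] have "\<forall>\<^sub>F w in at z. False" by eventually_elim simp
      then show False by simp
    qed
  qed
  have bd: "cmod (?f z) \<le> 1" if z: "z \<in> ball 0 1" for z
  proof -
    have "(?f \<longlongrightarrow> ?f z) (at z)"
      using analytic_at_imp_isCont[OF an[OF z]] by (simp add: isCont_def)
    then have "((\<lambda>w. cmod (?f w)) \<longlongrightarrow> cmod (?f z)) (at z)" by (rule tendsto_norm)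
    then show ?thesis by (rule tendsto_upperbound[OF _ ev[OF z]]) simp
  qed
  have "?f holomorphic_on ball 0 1"
    using an by (intro analytic_imp_holomorphic) (simp add: analytic_on_analytic_at[of _ "ball 0 1"])
  moreover have "AE t in circ. ((\<lambda>r. ?f (of_real r * cis t)) \<longlongrightarrow> ?f (cis t)) (at_left (1::real))"
    using b ij unfolding bdry_values_def by (auto elim!: eventually_mono)
  ultimately show "bdd_hol ?f" using bd unfolding bdd_hol_def by blast
qed

lemma frequently_eq_limit_unique:
  fixes f g :: "'b \<Rightarrow> complex"
  assumes "(f \<longlongrightarrow> a) F" "(g \<longlongrightarrow> b) F" "\<exists>\<^sub>F x in F. f x = g x"
  shows "a = b"
proof (rule ccontr)
  assume "a \<noteq> b"
  have "((\<lambda>x. f x - g x) \<longlongrightarrow> a - b) F" by (intro tendsto_diff assms)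
  then have "\<forall>\<^sub>F x in F. f x - g x \<noteq> 0"
    by (rule tendsto_imp_eventually_ne) (use \<open>a \<noteq> b\<close> in simp)
  then have "\<forall>\<^sub>F x in F. f x \<noteq> g x" by eventually_elim auto
  with assms(3) show False by (simp add: frequently_def)
qed

lemma Hinf_radial:
  assumes "G \<in> Hinf k l"
  shows "AE t in circ. \<forall>i<k. \<forall>j<l.
    ((\<lambda>r. G (of_real r * cis t) $$ (i, j)) \<longlongrightarrow> G (cis t) $$ (i, j)) (at_left (1::real))"
proof -
  have "AE t in circ. \<forall>i\<in>{..<k}. \<forall>j\<in>{..<l}.
    ((\<lambda>r. G (of_real r * cis t) $$ (i, j)) \<longlongrightarrow> G (cis t) $$ (i, j)) (at_left (1::real))"
    using Hinf_bdd_hol[OF assms] by (intro AE_finite_allI) (auto simp: bdd_hol_def)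
  then show ?thesis by (auto elim!: eventually_mono)
qed

text \<open>
  At a boundary point where \<open>b\<close> has a unitary radial limit its determinant stays away from zero.
\<close>

lemma radial_frequently_invertible:
  assumes s: "meromorphic_mvf p q s" and b: "inner_mvf k b"
    and lim: "\<forall>i<k. \<forall>j<k. ((\<lambda>r. b (of_real r * cis t) $$ (i, j)) \<longlongrightarrow> b (cis t) $$ (i, j)) (at_left (1::real))"
  shows "\<exists>\<^sub>F r in at_left (1::real). of_real r * cis t \<in> hol_domain p q s \<and>
    Determinant.det (b (of_real r * cis t)) \<noteq> 0 \<and> b (of_real r * cis t) \<in> carrier_mat k k"
proof -
  have bc: "b (cis t) \<in> carrier_mat k k" using b by (intro inner_carrier) auto
  have cc: "\<forall>\<^sub>F r in at_left (1::real). b (of_real r * cis t) \<in> carrier_mat k k"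
    using at_left_unit by eventually_elim (auto intro!: Hinf_carrier[OF inner_Hinf[OF b]] simp: norm_mult)
  have "Determinant.det (mat_adjoint (b (cis t)) * b (cis t)) = 1"
    using inner_unitary(1)[OF b, of "cis t"] by simp
  then have "Determinant.det (b (cis t)) \<noteq> 0"
    using bc det_mult[of "mat_adjoint (b (cis t))" k "b (cis t)"] by auto
  moreover have "((\<lambda>r. Determinant.det (b (of_real r * cis t))) \<longlongrightarrow> Determinant.det (b (cis t))) (at_left (1::real))"
    by (rule det_tendsto[OF cc bc]) (use lim in auto)
  ultimately have "\<forall>\<^sub>F r in at_left (1::real). Determinant.det (b (of_real r * cis t)) \<noteq> 0"
    by (intro tendsto_imp_eventually_ne)
  with cc have "\<forall>\<^sub>F r in at_left (1::real). Determinant.det (b (of_real r * cis t)) \<noteq> 0 \<and>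
      b (of_real r * cis t) \<in> carrier_mat k k" by eventually_elim auto
  then show ?thesis
    by (intro frequently_rev_mp[OF frequently_hol_domain[OF s, of t]]) (auto elim: eventually_mono)
qed

lemma radial_limit_product:
  fixes P Q R :: "complex \<Rightarrow> complex mat"
  assumes P: "\<forall>i<k. \<forall>j<l. ((\<lambda>r. P (of_real r * cis t) $$ (i, j)) \<longlongrightarrow> P (cis t) $$ (i, j)) (at_left (1::real))"
    and Q: "\<forall>i<l. \<forall>j<m. ((\<lambda>r. Q (of_real r * cis t) $$ (i, j)) \<longlongrightarrow> Q (cis t) $$ (i, j)) (at_left (1::real))"
    and R: "\<forall>i<k. \<forall>j<m. ((\<lambda>r. R (of_real r * cis t) $$ (i, j)) \<longlongrightarrow> R (cis t) $$ (i, j)) (at_left (1::real))"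
    and c: "P (cis t) \<in> carrier_mat k l" "Q (cis t) \<in> carrier_mat l m" "R (cis t) \<in> carrier_mat k m"
    and fr: "\<exists>\<^sub>F r in at_left (1::real). P (of_real r * cis t) \<in> carrier_mat k l \<and>
      Q (of_real r * cis t) \<in> carrier_mat l m \<and>
      P (of_real r * cis t) * Q (of_real r * cis t) = R (of_real r * cis t)"
  shows "P (cis t) * Q (cis t) = R (cis t)"
proof (rule eq_matI)
  fix i j assume "i < dim_row (R (cis t))" "j < dim_col (R (cis t))"
  then have ij: "i < k" "j < m" using c(3) by auto
  have "(\<Sum>h<l. P (cis t) $$ (i, h) * Q (cis t) $$ (h, j)) = R (cis t) $$ (i, j)"
  proof (rule frequently_eq_limit_unique)
    show "((\<lambda>r. \<Sum>h<l. P (of_real r * cis t) $$ (i, h) * Q (of_real r * cis t) $$ (h, j)) \<longlongrightarrow>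
      (\<Sum>h<l. P (cis t) $$ (i, h) * Q (cis t) $$ (h, j))) (at_left (1::real))"
      using P Q ij by (intro tendsto_sum tendsto_mult) auto
    show "((\<lambda>r. R (of_real r * cis t) $$ (i, j)) \<longlongrightarrow> R (cis t) $$ (i, j)) (at_left (1::real))"
      using R ij by auto
    show "\<exists>\<^sub>F r in at_left (1::real).
        (\<Sum>h<l. P (of_real r * cis t) $$ (i, h) * Q (of_real r * cis t) $$ (h, j)) = R (of_real r * cis t) $$ (i, j)"
      using fr
    proof (rule frequently_elim1)
      fix r :: real
      let ?z = "of_real r * cis t"
      assume h: "P ?z \<in> carrier_mat k l \<and> Q ?z \<in> carrier_mat l m \<and> P ?z * Q ?z = R ?z"
      then have "(P ?z * Q ?z) $$ (i, j) = R ?z $$ (i, j)" by simp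
      then show "(\<Sum>h<l. P ?z $$ (i, h) * Q ?z $$ (h, j)) = R ?z $$ (i, j)"
        using conjunct1[OF h] conjunct1[OF conjunct2[OF h]] ij by (simp add: scalar_prod_def lessThan_atLeast0)
    qed
  qed
  then show "(P (cis t) * Q (cis t)) $$ (i, j) = R (cis t) $$ (i, j)"
    using c ij by (simp add: scalar_prod_def lessThan_atLeast0)
qed (use c in auto)

text \<open>
  The identity \<open>b\<^sub>l s = s\<^sub>l\<close> holds wherever \<open>s\<close> is holomorphic and \<open>b\<^sub>l\<close> invertible; almost every radius contains
  such points arbitrarily close to the circle, so it holds for the limits.
\<close>

lemma left_KL_boundary:
  assumes s: "meromorphic_mvf p q s" and sb: "bdry_values p q s"
    and b: "inner_mvf p bl" and sl: "sl \<in> Hinf p q"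
    and kl: "\<And>z. z \<in> hol_domain p q s \<Longrightarrow> invertible_mat (bl z) \<Longrightarrow> s z = minv (bl z) * sl z"
  shows "AE t in circ. bl (cis t) * s (cis t) = sl (cis t)"
proof -
  have "AE t in circ. \<forall>i<p. \<forall>j<q.
        ((\<lambda>r. s (of_real r * cis t) $$ (i, j)) \<longlongrightarrow> s (cis t) $$ (i, j)) (at_left (1::real))"
    using sb by (simp add: bdry_values_def)
  with Hinf_radial[OF inner_Hinf[OF b]] Hinf_radial[OF sl] show ?thesis
  proof eventually_elim
    case (elim t)
    have c: "bl (cis t) \<in> carrier_mat p p" "s (cis t) \<in> carrier_mat p q" "sl (cis t) \<in> carrier_mat p q"
      using inner_carrier[OF b] Hinf_carrier[OF sl] sb by (auto simp: bdry_values_def)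
    show ?case
    proof (rule radial_limit_product[where P = bl and Q = s and R = sl and t = t, OF elim(1,3,2) c];
        rule frequently_elim1[OF radial_frequently_invertible[OF s b elim(1)]])
      fix r :: real
      let ?z = "of_real r * cis t"
      assume h: "?z \<in> hol_domain p q s \<and> Determinant.det (bl ?z) \<noteq> 0 \<and> bl ?z \<in> carrier_mat p p"
      then have zb: "?z \<in> ball 0 1" by (simp add: hol_domain_def)
      have sc: "s ?z \<in> carrier_mat p q" using s zb by (simp add: meromorphic_mvf_def)
      have slc: "sl ?z \<in> carrier_mat p q" using zb by (intro Hinf_carrier[OF sl]) auto
      note inv = minv_adj_mat[of "bl ?z" p]
      have "bl ?z * s ?z = bl ?z * (minv (bl ?z) * sl ?z)" using h inv kl by simp
      also have "\<dots> = sl ?z" using h inv slc by (simp flip: assoc_mult_mat[of _ p p _ p _ q])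
      finally show "bl ?z \<in> carrier_mat p p \<and> s ?z \<in> carrier_mat p q \<and> bl ?z * s ?z = sl ?z"
        using h sc by blast
    qed
  qed
qed

lemma right_KL_boundary:
  assumes s: "meromorphic_mvf p q s" and sb: "bdry_values p q s"
    and b: "inner_mvf q br" and sr: "sr \<in> Hinf p q"
    and kl: "\<And>z. z \<in> hol_domain p q s \<Longrightarrow> invertible_mat (br z) \<Longrightarrow> s z = sr z * minv (br z)"
  shows "AE t in circ. s (cis t) * br (cis t) = sr (cis t)"
proof -
  have "AE t in circ. \<forall>i<p. \<forall>j<q.
        ((\<lambda>r. s (of_real r * cis t) $$ (i, j)) \<longlongrightarrow> s (cis t) $$ (i, j)) (at_left (1::real))"
    using sb by (simp add: bdry_values_def)
  with Hinf_radial[OF inner_Hinf[OF b]] Hinf_radial[OF sr] show ?thesis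
  proof eventually_elim
    case (elim t)
    have c: "s (cis t) \<in> carrier_mat p q" "br (cis t) \<in> carrier_mat q q" "sr (cis t) \<in> carrier_mat p q"
      using inner_carrier[OF b] Hinf_carrier[OF sr] sb by (auto simp: bdry_values_def)
    show ?case
    proof (rule radial_limit_product[where P = s and Q = br and R = sr and t = t, OF elim(3,1,2) c];
        rule frequently_elim1[OF radial_frequently_invertible[OF s b elim(1)]])
      fix r :: real
      let ?z = "of_real r * cis t"
      assume h: "?z \<in> hol_domain p q s \<and> Determinant.det (br ?z) \<noteq> 0 \<and> br ?z \<in> carrier_mat q q"
      then have zb: "?z \<in> ball 0 1" by (simp add: hol_domain_def)
      have sc: "s ?z \<in> carrier_mat p q" using s zb by (simp add: meromorphic_mvf_def)
      have src: "sr ?z \<in> carrier_mat p q" using zb by (intro Hinf_carrier[OF sr]) auto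
      note inv = minv_adj_mat[of "br ?z" q]
      have "s ?z * br ?z = (sr ?z * minv (br ?z)) * br ?z" using h inv kl by simp
      also have "\<dots> = sr ?z" using h inv src by (simp add: assoc_mult_mat[of _ p q _ q _ q])
      finally show "s ?z \<in> carrier_mat p q \<and> br ?z \<in> carrier_mat q q \<and> s ?z * br ?z = sr ?z"
        using h sc by blast
    qed
  qed
qed

section \<open>The matrix function F on the circle\<close>

text \<open>
  By Cramer's rule the entries are quotients of determinants.
\<close>

lemma resolvent_continuous:
  assumes A: "A \<in> carrier_mat n n" and B: "B \<in> carrier_mat n n"
    and d: "\<And>z. cmod z = 1 \<Longrightarrow> Determinant.det (A - z \<cdot>\<^sub>m B) \<noteq> 0" and ij: "i < n" "j < n"
  shows "continuous_on (sphere 0 1) (\<lambda>z. minv (A - z \<cdot>\<^sub>m B) $$ (i, j))"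
proof -
  define R where "R z = A - z \<cdot>\<^sub>m B" for z
  have Rc: "R z \<in> carrier_mat n n" for z using A B by (simp add: R_def minus_carrier_mat)
  have lim: "((\<lambda>z. R z $$ (a, b)) \<longlongrightarrow> R w $$ (a, b)) (at w within sphere 0 1)"
    if "a < n" "b < n" for a b w
    using that A B by (auto simp: R_def intro!: tendsto_intros)
  have "((\<lambda>z. minv (R z) $$ (i, j)) \<longlongrightarrow> minv (R w) $$ (i, j)) (at w within sphere 0 1)"
    if w: "w \<in> sphere 0 1" for w
  proof -
    have eq: "minv (R z) $$ (i, j) =
      1 / Determinant.det (R z) * ((- 1) ^ (j + i) * Determinant.det (mat_delete (R z) j i))"
      if "z \<in> sphere 0 1" for z
      using minv_adj_mat(1)[OF Rc[of z]] d[of z] that ij Rc[of z] A B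
      by (simp add: R_def adj_mat_def cofactor_def)
    have del: "mat_delete (R z) j i $$ (a, b) = R z $$ (if a < j then a else Suc a, if b < i then b else Suc b)"
      if "a < n - 1" "b < n - 1" for a b z
      using that Rc[of z] by (simp add: mat_delete_def)
    have delc: "mat_delete (R z) j i \<in> carrier_mat (n - 1) (n - 1)" for z
      using Rc[of z] by (auto simp: mat_delete_def)
    have dl: "((\<lambda>z. Determinant.det (mat_delete (R z) j i)) \<longlongrightarrow> Determinant.det (mat_delete (R w) j i))
        (at w within sphere 0 1)"
    proof (rule det_tendsto[OF always_eventually[OF allI[OF delc]] delc])
      fix a b assume ab: "a < n - 1" "b < n - 1"
      then show "((\<lambda>z. mat_delete (R z) j i $$ (a, b)) \<longlongrightarrow> mat_delete (R w) j i $$ (a, b)) (at w within sphere 0 1)"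
        unfolding del[OF ab] by (intro lim) auto
    qed
    have dR: "((\<lambda>z. Determinant.det (R z)) \<longlongrightarrow> Determinant.det (R w)) (at w within sphere 0 1)"
      by (rule det_tendsto) (use Rc lim in auto)
    have "((\<lambda>z. 1 / Determinant.det (R z) * ((- 1) ^ (j + i) * Determinant.det (mat_delete (R z) j i))) \<longlongrightarrow>
       1 / Determinant.det (R w) * ((- 1) ^ (j + i) * Determinant.det (mat_delete (R w) j i))) (at w within sphere 0 1)"
      using d[of w] w by (intro tendsto_intros dl dR) (auto simp: R_def)
    then show ?thesis
      unfolding eq[OF w]
      by (rule Lim_transform_eventually) (auto simp: eventually_at_filter eq)
  qed
  then show ?thesis unfolding continuous_on_def R_def by blast
qed

text \<open>
  The pencil is block diagonal with blocks \<open>A\<^sub>1 - z\<close> and \<open>1 - z A\<^sub>2 = z (cnj z - A\<^sub>2)\<close>, and neither \<open>z\<close> nor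
  \<open>cnj z\<close> is an eigenvalue, being on the circle.
\<close>

lemma pencil_det_nonzero:
  assumes A1: "A1 \<in> carrier_mat n1 n1" and A2: "A2 \<in> carrier_mat n2 n2"
    and sp: "spectrum A1 \<union> spectrum A2 \<subseteq> ball 0 1" and z: "cmod z = 1"
  shows "Determinant.det (Mmat n1 n2 A1 - z \<cdot>\<^sub>m Nmat n1 n2 A2) \<noteq> 0"
proof -
  let ?B1 = "A1 - z \<cdot>\<^sub>m 1\<^sub>m n1" and ?B2 = "1\<^sub>m n2 - z \<cdot>\<^sub>m A2"
  have eq: "Mmat n1 n2 A1 - z \<cdot>\<^sub>m Nmat n1 n2 A2 = four_block_mat ?B1 (0\<^sub>m n1 n2) (0\<^sub>m n2 n1) ?B2"
    using A1 A2 by (intro eq_matI) (auto simp: Mmat_def Nmat_def)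
  have nosp: "\<not> eigenvalue A1 w" "\<not> eigenvalue A2 w" if "cmod w = 1" for w
    using sp that by (auto simp: spectrum_def)
  have "Determinant.det ?B1 \<noteq> 0"
  proof
    assume "Determinant.det ?B1 = 0"
    then obtain v where v: "v \<in> carrier_vec n1" "v \<noteq> 0\<^sub>v n1" "?B1 *\<^sub>v v = 0\<^sub>v n1"
      using det_0_iff_vec_prod_zero[of ?B1 n1] A1 by (auto simp: minus_carrier_mat)
    have "?B1 *\<^sub>v v = A1 *\<^sub>v v - z \<cdot>\<^sub>v v"
      using A1 v(1) by (simp add: minus_mult_distrib_mat_vec[of _ n1 n1] smult_mat_vec[of _ n1 n1])
    then have 0: "A1 *\<^sub>v v - z \<cdot>\<^sub>v v = 0\<^sub>v n1" using v(3) by simp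
    have "(A1 *\<^sub>v v) $ i = (z \<cdot>\<^sub>v v) $ i" if "i < n1" for i
      using A1 v(1) that arg_cong[OF 0, of "\<lambda>x. x $ i"] by simp
    then have ev: "A1 *\<^sub>v v = z \<cdot>\<^sub>v v" by (intro eq_vecI) (use A1 v(1) in auto)
    have "eigenvector A1 v z" unfolding eigenvector_def ev using A1 v(1,2) by simp
    then have "eigenvalue A1 z" unfolding eigenvalue_def by blast
    then show False using nosp z by blast
  qed
  moreover have "Determinant.det ?B2 \<noteq> 0"
  proof
    assume "Determinant.det ?B2 = 0"
    then obtain v where v: "v \<in> carrier_vec n2" "v \<noteq> 0\<^sub>v n2" "?B2 *\<^sub>v v = 0\<^sub>v n2"
      using det_0_iff_vec_prod_zero[of ?B2 n2] A2 by (auto simp: minus_carrier_mat)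
    have "?B2 *\<^sub>v v = v - z \<cdot>\<^sub>v (A2 *\<^sub>v v)"
      using A2 v(1) by (simp add: minus_mult_distrib_mat_vec[of _ n2 n2] smult_mat_vec[of _ n2 n2])
    then have 0: "v - z \<cdot>\<^sub>v (A2 *\<^sub>v v) = 0\<^sub>v n2" using v(3) by simp
    have vi: "v $ i = z * (A2 *\<^sub>v v) $ i" if "i < n2" for i
    proof -
      have "v $ i - z * (A2 *\<^sub>v v) $ i = (v - z \<cdot>\<^sub>v (A2 *\<^sub>v v)) $ i"
        using A2 v(1) that by (simp del: index_mult_mat_vec)
      also have "\<dots> = 0" unfolding 0 using that by simp
      finally show ?thesis by (simp only: right_minus_eq)
    qed
    have "(A2 *\<^sub>v v) $ i = (cnj z \<cdot>\<^sub>v v) $ i" if "i < n2" for i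
    proof -
      have "cnj z * v $ i = (cnj z * z) * (A2 *\<^sub>v v) $ i"
        unfolding vi[OF that] by (simp only: mult.assoc)
      then have "cnj z * v $ i = (A2 *\<^sub>v v) $ i" unfolding cnj_unit_mult(1)[OF z] mult_1_left .
      then show ?thesis using v(1) that by (simp only: index_smult_vec carrier_vecD)
    qed
    then have ev: "A2 *\<^sub>v v = cnj z \<cdot>\<^sub>v v" by (intro eq_vecI) (use A2 v(1) in auto)
    have "eigenvector A2 v (cnj z)" unfolding eigenvector_def ev using A2 v(1,2) by simp
    then have "eigenvalue A2 (cnj z)" unfolding eigenvalue_def by blast
    then show False using nosp z by simp
  qed
  ultimately show ?thesis
    unfolding eq using A1 A2 by (subst det_four_block_mat_lower_left_zero[of _ n1 _ n2]) auto
qed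

lemma Fmat_Linf:
  assumes A: "A \<in> carrier_mat n n" and B: "B \<in> carrier_mat n n" and C: "C \<in> carrier_mat m n"
    and d: "\<And>z. cmod z = 1 \<Longrightarrow> Determinant.det (A - z \<cdot>\<^sub>m B) \<noteq> 0"
  shows "Fmat C A B \<in> Linf m n"
    and "\<And>z. cmod z = 1 \<Longrightarrow> Fmat C A B z * (A - z \<cdot>\<^sub>m B) = C"
proof -
  have Rc: "A - z \<cdot>\<^sub>m B \<in> carrier_mat n n" for z using A B by (simp add: minus_carrier_mat)
  have "(\<lambda>z. minv (A - z \<cdot>\<^sub>m B)) \<in> Linf n n"
    using minv_adj_mat(4)[OF Rc d] resolvent_continuous[OF A B d]
    by (intro Linf_I) (auto intro: ess_bounded_continuous[where a = "\<lambda>z. minv (A - z \<cdot>\<^sub>m B) $$ _"])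
  then have "(\<lambda>z. C * minv (A - z \<cdot>\<^sub>m B)) \<in> Linf m n"
    using C by (intro Linf_mult[of "\<lambda>_. C" m n]) auto
  then show "Fmat C A B \<in> Linf m n" by (simp add: Fmat_def[abs_def])
  fix z :: complex assume z: "cmod z = 1"
  note inv = minv_adj_mat[OF Rc d[OF z]]
  have "C * minv (A - z \<cdot>\<^sub>m B) * (A - z \<cdot>\<^sub>m B) = C * (minv (A - z \<cdot>\<^sub>m B) * (A - z \<cdot>\<^sub>m B))"
    by (rule assoc_mult_mat[OF C inv(4) Rc])
  then show "Fmat C A B z * (A - z \<cdot>\<^sub>m B) = C" using C inv(3) by (simp add: Fmat_def)
qed

section \<open>Finite expansions\<close>

definition vsum :: "nat \<Rightarrow> nat \<Rightarrow> (nat \<Rightarrow> complex) \<Rightarrow> (nat \<Rightarrow> complex \<Rightarrow> complex vec) \<Rightarrow> complex \<Rightarrow> complex vec" where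
  "vsum n k c e = (\<lambda>z. Matrix.vec k (\<lambda>i. \<Sum>j<n. c j * e j z $ i))"

lemma vsum_L2 [simp]:
  assumes "\<And>j. j < n \<Longrightarrow> e j \<in> L2 k" shows "vsum n k c e \<in> L2 k"
  using assms unfolding vsum_def
  by (intro L2_I) (auto intro!: sq_integrable_sum sq_integrable_mult L2_sq)

lemma ip_vsum_left:
  assumes "\<And>j. j < n \<Longrightarrow> e j \<in> L2 k" "g \<in> L2 k"
  shows "ip (vsum n k c e) g = (\<Sum>j<n. c j * ip (e j) g)"
  using assms(1)
proof (induction n)
  case 0
  have "ip (vsum 0 k c e) g = ip (\<lambda>z. 0 \<cdot>\<^sub>v g z) g"
    using assms(2) by (intro ip_cong_left) (auto simp: vsum_def intro!: eq_vecI dest!: L2_carrier)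
  then show ?case using assms(2) by (simp add: ip_smult_left[of _ k])
next
  case (Suc n)
  have "ip (vsum (Suc n) k c e) g = ip (\<lambda>z. vsum n k c e z + c n \<cdot>\<^sub>v e n z) g"
  proof (rule ip_cong_left)
    fix z :: complex assume "cmod z = 1"
    then have "e n z \<in> carrier_vec k" using L2_carrier[OF Suc.prems[of n]] by simp
    then show "vsum (Suc n) k c e z = vsum n k c e z + c n \<cdot>\<^sub>v e n z"
      by (intro eq_vecI) (auto simp: vsum_def)
  qed
  also have "\<dots> = ip (vsum n k c e) g + c n * ip (e n) g"
    using Suc.prems assms(2) by (simp add: ip_add_left[of _ k] ip_smult_left[of _ k])
  finally show ?case using Suc by simp
qed

lemma ip_vsum_right:
  assumes "\<And>j. j < n \<Longrightarrow> e j \<in> L2 k" "g \<in> L2 k"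
  shows "ip g (vsum n k c e) = (\<Sum>j<n. cnj (c j) * ip g (e j))"
proof -
  have "ip g (vsum n k c e) = (\<Sum>j<n. cnj (c j * ip (e j) g))"
    using assms by (subst ip_cnj[of _ k]) (auto simp: ip_vsum_left)
  also have "\<dots> = (\<Sum>j<n. cnj (c j) * ip g (e j))"
    using assms by (intro sum.cong refl) (simp add: ip_cnj[of g k])
  finally show ?thesis .
qed

lemma vsum_H2:
  assumes "\<And>j. j < n \<Longrightarrow> e j \<in> H2 k" shows "vsum n k c e \<in> H2 k"
  by (rule H2_I) (use assms in \<open>auto simp: ip_vsum_left H2_trig\<close>)

lemma vsum_H2perp:
  assumes "\<And>j. j < n \<Longrightarrow> e j \<in> H2perp k" shows "vsum n k c e \<in> H2perp k"
  by (rule H2perp_I) (use assms in \<open>auto simp: ip_vsum_left H2perp_orth[of _ k] intro!: sum.neutral\<close>)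

lemma ae_zero_diff:
  assumes f: "f \<in> L2 k" and g: "g \<in> L2 k" and z: "ae_eq (\<lambda>z. f z - g z) (\<lambda>_. 0\<^sub>v k)"
  shows "ae_eq f g"
  using z unfolding ae_eq_def
proof eventually_elim
  case (elim t)
  have c: "f (cis t) \<in> carrier_vec k" "g (cis t) \<in> carrier_vec k" using f g by auto
  show ?case
  proof (rule eq_vecI)
    fix i assume "i < dim_vec (g (cis t))"
    then show "f (cis t) $ i = g (cis t) $ i"
      using c arg_cong[OF elim, of "\<lambda>x. x $ i"] by simp
  qed (use c in auto)
qed

lemma ip_zero_left:
  assumes f: "ae_eq f (\<lambda>_. 0\<^sub>v k)" and g: "g \<in> L2 k"
  shows "ip f g = 0"
proof -
  have "ip f g = ip (\<lambda>z. 0 \<cdot>\<^sub>v 0\<^sub>v k) g" using ip_cong[OF f ae_eq_refl] by simp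
  also have "\<dots> = 0 * ip (\<lambda>_. 0\<^sub>v k) g" by (rule ip_smult_left[of _ k]) (use g in auto)
  finally show ?thesis by simp
qed

section \<open>Coprimeness and the backward shift\<close>

lemma shift_mult_op:
  assumes "G \<in> Linf k l" "x \<in> L2 l" "cmod z = 1"
  shows "mult_op G (\<lambda>z. z \<cdot>\<^sub>v x z) z = z \<cdot>\<^sub>v mult_op G x z"
  using Linf_carrier[OF assms(1,3)] L2_carrier[OF assms(2,3)]
  by (simp add: mult_op_def mult_mat_vec[of _ k l])

text \<open>
  The backward shift minus \<open>cnj a\<close>, the adjoint on \<open>H\<^sub>2\<close> of multiplication by \<open>z - a\<close>.
\<close>

definition bshift_minus :: "nat \<Rightarrow> complex \<Rightarrow> (complex \<Rightarrow> complex vec) \<Rightarrow> complex \<Rightarrow> complex vec" where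
  "bshift_minus k a b = (\<lambda>z. cnj z \<cdot>\<^sub>v (b z - mean k b) - cnj a \<cdot>\<^sub>v b z)"

lemma bshift_minus_H2: "b \<in> H2 k \<Longrightarrow> bshift_minus k a b \<in> H2 k"
  by (simp add: bshift_minus_def)

lemma ip_bshift_minus:
  assumes b: "b \<in> H2 k" and x: "x \<in> H2 k"
  shows "ip (bshift_minus k a b) x = ip b (\<lambda>z. (z - a) \<cdot>\<^sub>v x z)"
proof -
  have "ip (bshift_minus k a b) x = ip b (\<lambda>z. z \<cdot>\<^sub>v x z) - cnj a * ip b x"
    using b x unfolding bshift_minus_def
    by (simp add: ip_minus_left[of _ k] ip_smult_left[of _ k] ip_bshift[of _ k] ip_shift_const[of _ k])
  also have "\<dots> = ip b (\<lambda>z. z \<cdot>\<^sub>v x z - a \<cdot>\<^sub>v x z)"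
    using b x by (simp add: ip_minus_right[of _ k] ip_smult_right[of _ k])
  also have "\<dots> = ip b (\<lambda>z. (z - a) \<cdot>\<^sub>v x z)"
    using L2_carrier[OF H2_L2[OF x]]
    by (intro ip_cong_right eq_vecI) (auto simp: algebra_simps)
  finally show ?thesis .
qed

text \<open>
  The kernel of the Toeplitz operator with symbol \<open>G\<^sup>*\<close> is invariant under the backward shift, because \<open>G\<close>
  commutes with multiplication by \<open>z\<close>.
\<close>

lemma bshift_minus_adj:
  assumes G: "G \<in> Hinf k l" and b: "b \<in> H2 k" and p: "mult_op (adj G) b \<in> H2perp l"
  shows "mult_op (adj G) (bshift_minus k a b) \<in> H2perp l"
proof (rule H2perp_I)
  have GL: "G \<in> Linf k l" using G by simp
  have D: "bshift_minus k a b \<in> H2 k" by (rule bshift_minus_H2[OF b])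
  show "mult_op (adj G) (bshift_minus k a b) \<in> L2 l"
    by (rule L2_mult_op[OF Linf_adj[OF GL] H2_L2[OF D]])
  fix x assume x: "x \<in> H2 l"
  have Gx: "mult_op G x \<in> H2 k" by (rule Hinf_H2[OF G x])
  have x': "(\<lambda>z. (z - a) \<cdot>\<^sub>v x z) \<in> H2 l" using x by (intro bdd_hol_H2 bdd_hol_minus) auto
  have "ip (mult_op (adj G) (bshift_minus k a b)) x = ip (bshift_minus k a b) (mult_op G x)"
    by (rule ip_mult_op'[OF GL H2_L2[OF D] H2_L2[OF x]])
  also have "\<dots> = ip b (\<lambda>z. (z - a) \<cdot>\<^sub>v mult_op G x z)" by (rule ip_bshift_minus[OF b Gx])
  also have "\<dots> = ip b (mult_op G (\<lambda>z. (z - a) \<cdot>\<^sub>v x z))"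
    using Linf_carrier[OF GL] L2_carrier[OF H2_L2[OF x]]
    by (intro ip_cong_right) (simp add: mult_op_def mult_mat_vec[of _ k l])
  also have "\<dots> = ip (mult_op (adj G) b) (\<lambda>z. (z - a) \<cdot>\<^sub>v x z)"
    by (rule ip_mult_op'[OF GL H2_L2[OF b] H2_L2[OF x'], symmetric])
  also have "\<dots> = 0" by (rule H2perp_orth[OF p x'])
  finally show "ip (mult_op (adj G) (bshift_minus k a b)) x = 0" .
qed

text \<open>
  Eigenvectors of the backward shift are kernel functions.
\<close>

lemma bshift_eigenvector:
  assumes b: "b \<in> H2 k" and z: "ae_eq (bshift_minus k a b) (\<lambda>_. 0\<^sub>v k)" and a: "cmod a < 1"
  shows "ae_eq b (\<lambda>z. (1 / (1 - cnj a * z)) \<cdot>\<^sub>v mean k b)"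
  using z unfolding ae_eq_def
proof eventually_elim
  case (elim t)
  let ?z = "cis t"
  have c: "b ?z \<in> carrier_vec k" "mean k b \<in> carrier_vec k" using b by auto
  have ne: "1 - cnj a * ?z \<noteq> 0" by (rule one_minus_nonzero[OF a]) simp
  show ?case
  proof (rule eq_vecI)
    fix i assume "i < dim_vec ((1 / (1 - cnj a * ?z)) \<cdot>\<^sub>v mean k b)"
    then have i: "i < k" using c by simp
    have "cnj ?z * (b ?z $ i - mean k b $ i) = cnj a * b ?z $ i"
      using arg_cong[OF elim, of "\<lambda>x. x $ i"] i c by (simp add: bshift_minus_def)
    then have "?z * (cnj ?z * (b ?z $ i - mean k b $ i)) = ?z * (cnj a * b ?z $ i)" by simp
    then have "b ?z $ i - mean k b $ i = ?z * cnj a * b ?z $ i"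
      using cnj_unit_mult(2)[of ?z] by (simp flip: mult.assoc)
    then have "b ?z $ i * (1 - cnj a * ?z) = mean k b $ i" by (simp add: algebra_simps)
    then show "b ?z $ i = ((1 / (1 - cnj a * ?z)) \<cdot>\<^sub>v mean k b) $ i"
      using ne i c by (simp add: field_simps)
  qed (use c in simp)
qed

text \<open>
  The reproducing property turns orthogonality of \<open>G\<^sup>* b\<close> to the constants into \<open>G(a)\<^sup>* v = 0\<close>.
\<close>

lemma eigenvector_left_kernel:
  assumes G: "G \<in> Hinf k l" and b: "b \<in> H2 k" and a: "cmod a < 1" and v: "v \<in> carrier_vec k"
    and e: "ae_eq b (\<lambda>z. (1 / (1 - cnj a * z)) \<cdot>\<^sub>v v)"
    and p: "mult_op (adj G) b \<in> H2perp l" and j: "j < l"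
  shows "col (G a) j \<bullet>c v = 0"
proof -
  have GL: "G \<in> Linf k l" using G by simp
  have u: "(unit_vec l j :: complex vec) \<in> carrier_vec l" by simp
  have Gu: "mult_op G (\<lambda>_. unit_vec l j) \<in> L2 k" by (rule L2_mult_op[OF GL L2_const[OF u]])
  have "(G a *\<^sub>v unit_vec l j) \<bullet>c v = ip (mult_op G (\<lambda>_. unit_vec l j)) (\<lambda>z. (1 / (1 - cnj a * z)) \<cdot>\<^sub>v v)"
    by (rule Hinf_reproducing[OF G u v a, symmetric])
  also have "\<dots> = ip (mult_op G (\<lambda>_. unit_vec l j)) b"
    by (rule ip_cong[OF ae_eq_refl ae_eq_sym[OF e]])
  also have "\<dots> = cnj (ip b (mult_op G (\<lambda>_. unit_vec l j)))"
    by (rule ip_cnj[OF Gu H2_L2[OF b]])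
  also have "ip b (mult_op G (\<lambda>_. unit_vec l j)) = ip (mult_op (adj G) b) (\<lambda>_. unit_vec l j)"
    by (rule ip_mult_op'[OF GL H2_L2[OF b] L2_const[OF u], symmetric])
  also have "\<dots> = 0" by (rule H2perp_orth[OF p const_H2[OF u]])
  also have "G a *\<^sub>v unit_vec l j = col (G a) j"
    using j Hinf_carrier[OF G, of a] a by (intro eq_vecI) auto
  finally show ?thesis by simp
qed

text \<open>
  Induction over the zeros of the polynomial.  Applying the backward shift minus \<open>cnj a\<close> removes the zero \<open>a\<close>
  and preserves the other assumptions, so the result vanishes by induction.  Then \<open>b\<close> is an eigenvector
  \<open>v / (1 - cnj a z)\<close> and \<open>v\<close> is orthogonal to the columns of \<open>[b\<^sub>l(a) s\<^sub>l(a)]\<close>, a matrix of full row rank.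
\<close>

lemma coprime_trivial_kernel:
  assumes bl: "bl \<in> Hinf p p" and sl: "sl \<in> Hinf p q"
    and cop: "\<And>z. z \<in> ball 0 1 \<Longrightarrow> vec_space.rank p (hcat (bl z) (sl z)) = p"
    and as: "set as \<subseteq> ball 0 1"
    and b: "b \<in> H2 p" "mult_op (adj bl) b \<in> H2perp p" "mult_op (adj sl) b \<in> H2perp q"
    and o: "\<And>x. x \<in> H2 p \<Longrightarrow> ip b (\<lambda>z. zero_poly as z \<cdot>\<^sub>v x z) = 0"
  shows "ae_eq b (\<lambda>_. 0\<^sub>v p)"
  using as b o
proof (induction as arbitrary: b)
  case Nil
  have "ip b b = 0" using Nil.prems(5)[OF Nil.prems(2)] by (simp add: one_smult_vec)
  then show ?case using Nil.prems(2) by (intro ip_self_zero) auto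
next
  case (Cons a as)
  note b = Cons.prems(2-4)
  have a: "cmod a < 1" using Cons.prems(1) by simp
  have D: "ae_eq (bshift_minus p a b) (\<lambda>_. 0\<^sub>v p)"
  proof (rule Cons.IH)
    show "set as \<subseteq> ball 0 1" using Cons.prems(1) by simp
    show "bshift_minus p a b \<in> H2 p" by (rule bshift_minus_H2[OF b(1)])
    show "mult_op (adj bl) (bshift_minus p a b) \<in> H2perp p" by (rule bshift_minus_adj[OF bl b(1,2)])
    show "mult_op (adj sl) (bshift_minus p a b) \<in> H2perp q" by (rule bshift_minus_adj[OF sl b(1,3)])
    fix x assume x: "x \<in> H2 p"
    then have "(\<lambda>z. zero_poly as z \<cdot>\<^sub>v x z) \<in> H2 p" by (intro bdd_hol_H2 bdd_hol_zero_poly)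
    from ip_bshift_minus[OF b(1) this]
    show "ip (bshift_minus p a b) (\<lambda>z. zero_poly as z \<cdot>\<^sub>v x z) = 0"
      using Cons.prems(5)[OF x] by (simp add: smult_smult_assoc)
  qed
  note e = bshift_eigenvector[OF b(1) D a]
  let ?A = "hcat (bl a) (sl a)"
  have c: "bl a \<in> carrier_mat p p" "sl a \<in> carrier_mat p q"
    using a Hinf_carrier[OF bl] Hinf_carrier[OF sl] by auto
  have "mean p b = 0\<^sub>v p"
  proof (rule full_row_rank_left_kernel)
    show "?A \<in> carrier_mat p (p + q)" by (rule hcat_carrier[OF c])
    show "vec_space.rank p ?A = p" using cop a by simp
    fix j assume j: "j < p + q"
    have "col ?A j = (if j < p then col (bl a) j else col (sl a) (j - p))"
      using c j by (intro eq_vecI) (auto simp: hcat_def)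
    then show "col ?A j \<bullet>c mean p b = 0"
      using eigenvector_left_kernel[OF bl b(1) a mean_carrier e b(2), of j]
        eigenvector_left_kernel[OF sl b(1) a mean_carrier e b(3), of "j - p"] j by auto
  qed simp
  then show ?case using e by simp
qed

section \<open>The operators Y and \<Gamma>\<close>

text \<open>
  The boundary form of a left coprime and a right factorization.  Both Blaschke--Potapov products have the same
  degree \<open>\<kappa>\<close>; this makes \<open>Y\<close> an operator between spaces of equal dimension.
\<close>

locale krein_langer =
  fixes p q \<kappa> :: nat and s bl br sl sr :: "complex \<Rightarrow> complex mat"
  assumes bl: "bp_product \<kappa> p bl" and br: "bp_product \<kappa> q br"
    and sl: "sl \<in> Hinf p q" and sr: "sr \<in> Hinf p q" and s: "s \<in> Linf p q"
    and bl_s: "AE t in circ. bl (cis t) * s (cis t) = sl (cis t)"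
    and s_br: "AE t in circ. s (cis t) * br (cis t) = sr (cis t)"
    and cop: "\<And>z. z \<in> ball 0 1 \<Longrightarrow> vec_space.rank p (hcat (bl z) (sl z)) = p"
begin

abbreviation "B \<equiv> mult_op bl"
abbreviation "B' \<equiv> mult_op (adj bl)"
abbreviation "R \<equiv> mult_op br"
abbreviation "R' \<equiv> mult_op (adj br)"
abbreviation "S \<equiv> mult_op s"
abbreviation "S' \<equiv> mult_op (adj s)"
abbreviation "SL \<equiv> mult_op sl"
abbreviation "SL' \<equiv> mult_op (adj sl)"
abbreviation "SR' \<equiv> mult_op (adj sr)"

lemmas bl_inner = bp_product_structure(1)[OF bl] and br_inner = bp_product_structure(1)[OF br]
lemmas bl_Hinf = inner_Hinf[OF bl_inner] and br_Hinf = inner_Hinf[OF br_inner]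
lemmas bl_Linf = inner_Linf[OF bl_inner] and br_Linf = inner_Linf[OF br_inner]
  and sl_Linf = Hinf_Linf[OF sl] and sr_Linf = Hinf_Linf[OF sr]

lemma B_L2 [simp]: "x \<in> L2 p \<Longrightarrow> B x \<in> L2 p" and B'_L2 [simp]: "x \<in> L2 p \<Longrightarrow> B' x \<in> L2 p"
  and R_L2 [simp]: "y \<in> L2 q \<Longrightarrow> R y \<in> L2 q" and R'_L2 [simp]: "y \<in> L2 q \<Longrightarrow> R' y \<in> L2 q"
  and S_L2 [simp]: "y \<in> L2 q \<Longrightarrow> S y \<in> L2 p" and S'_L2 [simp]: "x \<in> L2 p \<Longrightarrow> S' x \<in> L2 q"
  and SL_L2 [simp]: "y \<in> L2 q \<Longrightarrow> SL y \<in> L2 p" and SL'_L2 [simp]: "x \<in> L2 p \<Longrightarrow> SL' x \<in> L2 q"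
  and SR'_L2 [simp]: "x \<in> L2 p \<Longrightarrow> SR' x \<in> L2 q"
  using bl_Linf br_Linf s sl_Linf sr_Linf
  by (auto intro: L2_mult_op Linf_adj)

lemma ip_B: "x \<in> L2 p \<Longrightarrow> y \<in> L2 p \<Longrightarrow> ip (B x) y = ip x (B' y)"
  by (rule ip_mult_op[OF bl_Linf])
lemma ip_B': "x \<in> L2 p \<Longrightarrow> y \<in> L2 p \<Longrightarrow> ip (B' x) y = ip x (B y)"
  by (rule ip_mult_op'[OF bl_Linf])
lemma ip_R': "x \<in> L2 q \<Longrightarrow> y \<in> L2 q \<Longrightarrow> ip (R' x) y = ip x (R y)"
  by (rule ip_mult_op'[OF br_Linf])
lemma ip_S: "x \<in> L2 q \<Longrightarrow> y \<in> L2 p \<Longrightarrow> ip (S x) y = ip x (S' y)"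
  by (rule ip_mult_op[OF s])
lemma ip_S': "x \<in> L2 p \<Longrightarrow> y \<in> L2 q \<Longrightarrow> ip (S' x) y = ip x (S y)"
  by (rule ip_mult_op'[OF s])

lemma B_H2 [simp]: "x \<in> H2 p \<Longrightarrow> B x \<in> H2 p" and R_H2 [simp]: "y \<in> H2 q \<Longrightarrow> R y \<in> H2 q"
  and SL_H2 [simp]: "y \<in> H2 q \<Longrightarrow> SL y \<in> H2 p"
  by (fact Hinf_H2[OF bl_Hinf] Hinf_H2[OF br_Hinf] Hinf_H2[OF sl])+

lemma B'_H2perp [simp]: "x \<in> H2perp p \<Longrightarrow> B' x \<in> H2perp p"
  and R'_H2perp [simp]: "y \<in> H2perp q \<Longrightarrow> R' y \<in> H2perp q"
  and SR'_H2perp [simp]: "x \<in> H2perp p \<Longrightarrow> SR' x \<in> H2perp q"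
  by (fact Hinf_adj_H2perp[OF bl_Hinf] Hinf_adj_H2perp[OF br_Hinf] Hinf_adj_H2perp[OF sr])+

lemma B_cancel: "x \<in> L2 p \<Longrightarrow> ae_eq (B (B' x)) x" "x \<in> L2 p \<Longrightarrow> ae_eq (B' (B x)) x"
  by (auto intro!: ae_eqI inner_cancel[OF bl_inner])
lemma R_cancel: "x \<in> L2 q \<Longrightarrow> ae_eq (R (R' x)) x" "x \<in> L2 q \<Longrightarrow> ae_eq (R' (R x)) x"
  by (auto intro!: ae_eqI inner_cancel[OF br_inner])

lemma mult_op_cong: "ae_eq x y \<Longrightarrow> ae_eq (mult_op G x) (mult_op G y)"
  unfolding ae_eq_def mult_op_def by (auto elim: eventually_mono)

lemma B_S: assumes y: "y \<in> L2 q" shows "ae_eq (B (S y)) (SL y)"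
  unfolding ae_eq_def using bl_s
proof eventually_elim
  case (elim t)
  show ?case using mult_op_assoc[OF bl_Linf s y, of "cis t"] elim by (simp add: mult_op_def)
qed

lemma SL'_eq: assumes x: "x \<in> L2 p" shows "ae_eq (SL' x) (S' (B' x))"
  unfolding ae_eq_def using bl_s
proof eventually_elim
  case (elim t)
  show ?case using mult_op_adj_mult[OF bl_Linf s x, of "cis t"] elim by (simp add: mult_op_def)
qed

lemma S'_eq: assumes x: "x \<in> L2 p" shows "ae_eq (S' x) (R (SR' x))"
  unfolding ae_eq_def using s_br
proof eventually_elim
  case (elim t)
  have "R (SR' x) (cis t) = R (R' (S' x)) (cis t)"
    using mult_op_adj_mult[OF s br_Linf x, of "cis t"] elim by (simp add: mult_op_def)
  also have "\<dots> = S' x (cis t)" using x by (intro inner_cancel[OF br_inner]) auto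
  finally show ?case ..
qed

text \<open>
  \<open>h \<bottom> b\<^sub>l\<^sup>* H2perp\<close> is the same as \<open>b\<^sub>l h \<bottom> H2perp\<close>.
\<close>

lemma Hstar_iff: "h \<in> Hstar p bl \<longleftrightarrow> h \<in> H2perp p \<and> B h \<in> H2 p"
proof -
  have "(\<forall>g\<in>H2perp p. ip h (B' g) = 0) \<longleftrightarrow> B h \<in> H2 p" if h: "h \<in> H2perp p"
  proof -
    have eq: "ip h (B' g) = ip (B h) g" if "g \<in> H2perp p" for g
      by (rule ip_B[symmetric]) (use h that in auto)
    show ?thesis
    proof
      assume "\<forall>g\<in>H2perp p. ip h (B' g) = 0"
      then show "B h \<in> H2 p" using eq h by (intro H2_I_orth) auto
    next
      assume "B h \<in> H2 p"
      then show "\<forall>g\<in>H2perp p. ip h (B' g) = 0" using eq H2_orth by metis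
    qed
  qed
  then show ?thesis by (auto simp: Hstar_def ominus_def)
qed

lemma Hspace_iff: "y \<in> Hspace q br \<longleftrightarrow> y \<in> H2 q \<and> R' y \<in> H2perp q"
proof -
  have "(\<forall>g\<in>H2 q. ip y (R g) = 0) \<longleftrightarrow> R' y \<in> H2perp q" if y: "y \<in> H2 q"
  proof -
    have eq: "ip y (R g) = ip (R' y) g" if "g \<in> H2 q" for g
      by (rule ip_R'[symmetric]) (use y that in auto)
    show ?thesis
    proof
      assume "\<forall>g\<in>H2 q. ip y (R g) = 0"
      then show "R' y \<in> H2perp q" using eq y by (intro H2perp_I) auto
    next
      assume "R' y \<in> H2perp q"
      then show "\<forall>g\<in>H2 q. ip y (R g) = 0" using eq H2perp_orth by metis
    qed
  qed
  then show ?thesis by (auto simp: Hspace_def ominus_def)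
qed

text \<open>
  The assumptions describe an element \<open>h\<close> of \<open>H\<^sub>*(b\<^sub>l)\<close> with \<open>Y h = 0\<close>.  For \<open>b = b\<^sub>l h\<close> one has
  \<open>b\<^sub>l\<^sup>* b = h\<close> and \<open>s\<^sub>l\<^sup>* b = s\<^sup>* h\<close>; moreover \<open>b \<bottom> p H\<^sub>2\<close> for a polynomial \<open>p\<close> divisible by \<open>b\<^sub>l\<close>, since
  \<open>h \<bottom> H\<^sub>2\<close>.
\<close>

lemma Y_injective:
  assumes h: "h \<in> H2perp p" "B h \<in> H2 p" "S' h \<in> H2perp q"
  shows "ae_eq h (\<lambda>_. 0\<^sub>v p)"
proof -
  obtain as where as: "set as \<subseteq> ball 0 1" "divides_poly p bl as"
    using bp_product_structure(3)[OF bl] by blast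
  have hL: "h \<in> L2 p" using h by simp
  have 1: "B' (B h) \<in> H2perp p"
    by (rule H2perp_ae[OF h(1) ae_eq_sym[OF B_cancel(2)[OF hL]]]) (use hL in simp)
  have 2: "SL' (B h) \<in> H2perp q"
  proof (rule H2perp_ae[OF h(3)])
    have "ae_eq (S' (B' (B h))) (S' h)" by (rule mult_op_cong[OF B_cancel(2)[OF hL]])
    then show "ae_eq (S' h) (SL' (B h))"
      by (rule ae_eq_sym[OF ae_eq_trans[OF SL'_eq[OF B_L2[OF hL]]]])
  qed (use hL in simp)
  have "ae_eq (B h) (\<lambda>_. 0\<^sub>v p)"
  proof (rule coprime_trivial_kernel[OF bl_Hinf sl cop as(1) h(2) 1 2])
    fix x assume x: "x \<in> H2 p"
    let ?x = "\<lambda>z. zero_poly as z \<cdot>\<^sub>v x z"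
    have xL: "?x \<in> L2 p" using x by (intro H2_L2 bdd_hol_H2 bdd_hol_zero_poly)
    have "B' ?x \<in> H2 p" using as(2) x unfolding divides_poly_def by blast
    then have "ip h (B' ?x) = 0" by (rule H2perp_orth[OF h(1)])
    then show "ip (B h) ?x = 0" using hL xL by (simp add: ip_B)
  qed
  then have "ae_eq (B' (B h)) (B' (\<lambda>_. 0\<^sub>v p))" by (rule mult_op_cong)
  moreover have "ae_eq (B' (\<lambda>_. 0\<^sub>v p)) (\<lambda>_. 0\<^sub>v p)"
  proof (rule ae_eqI)
    fix z :: complex assume "cmod z = 1"
    then have "bl z \<in> carrier_mat p p" by (rule inner_carrier[OF bl_inner])
    then show "B' (\<lambda>_. 0\<^sub>v p) z = 0\<^sub>v p" by (intro eq_vecI) (auto simp: mult_op_def)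
  qed
  ultimately have "ae_eq (B' (B h)) (\<lambda>_. 0\<^sub>v p)" by (rule ae_eq_trans)
  then show ?thesis by (rule ae_eq_trans[OF ae_eq_sym[OF B_cancel(2)[OF hL]]])
qed

text \<open>
  Orthonormal bases of \<open>H(b\<^sub>r)\<close> and \<open>H(b\<^sub>l)\<close>; the latter is carried to \<open>H\<^sub>*(b\<^sub>l) = b\<^sub>l\<^sup>* H(b\<^sub>l)\<close>.
\<close>

definition "er = (SOME e. model_basis q br \<kappa> e)"
definition "el = (SOME e. model_basis p bl \<kappa> e)"
definition "l j = B' (el j)"

lemma er: "model_basis q br \<kappa> er" and el: "model_basis p bl \<kappa> el"
  unfolding er_def el_def
  by (rule someI_ex[OF bp_product_structure(2)[OF br]], rule someI_ex[OF bp_product_structure(2)[OF bl]])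

lemma er_H2 [simp]: "j < \<kappa> \<Longrightarrow> er j \<in> H2 q"
  and er_orth: "i < \<kappa> \<Longrightarrow> j < \<kappa> \<Longrightarrow> ip (er i) (er j) = (if i = j then 1 else 0)"
  and R_er: "j < \<kappa> \<Longrightarrow> y \<in> H2 q \<Longrightarrow> ip (R y) (er j) = 0"
  using er by (simp_all add: model_basis_def)

lemma el_H2 [simp]: "j < \<kappa> \<Longrightarrow> el j \<in> H2 p"
  and el_orth: "i < \<kappa> \<Longrightarrow> j < \<kappa> \<Longrightarrow> ip (el i) (el j) = (if i = j then 1 else 0)"
  and B_el: "j < \<kappa> \<Longrightarrow> x \<in> H2 p \<Longrightarrow> ip (B x) (el j) = 0"
  using el by (simp_all add: model_basis_def)

lemma er_div: "y \<in> H2 q \<Longrightarrow> (\<And>j. j < \<kappa> \<Longrightarrow> ip y (er j) = 0) \<Longrightarrow> R' y \<in> H2 q"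
  using er by (simp add: model_basis_def)

lemma el_div: "x \<in> H2 p \<Longrightarrow> (\<And>j. j < \<kappa> \<Longrightarrow> ip x (el j) = 0) \<Longrightarrow> B' x \<in> H2 p"
  using el by (simp add: model_basis_def)

lemma er_R: "j < \<kappa> \<Longrightarrow> y \<in> H2 q \<Longrightarrow> ip (er j) (R y) = 0"
  using R_er[of j y] by (subst ip_cnj[of _ q]) auto

lemma el_B: "j < \<kappa> \<Longrightarrow> x \<in> H2 p \<Longrightarrow> ip (el j) (B x) = 0"
  using B_el[of j x] by (subst ip_cnj[of _ p]) auto

lemma er_Hspace: "j < \<kappa> \<Longrightarrow> er j \<in> Hspace q br"
  unfolding Hspace_iff by (auto intro!: H2perp_I simp: ip_R' er_R)

lemma l_H2perp [simp]: "j < \<kappa> \<Longrightarrow> l j \<in> H2perp p"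
  unfolding l_def by (auto intro!: H2perp_I simp: ip_B' el_B)

lemma l_orth: "i < \<kappa> \<Longrightarrow> j < \<kappa> \<Longrightarrow> ip (l i) (l j) = (if i = j then 1 else 0)"
  using ip_cong[OF ae_eq_refl B_cancel(1)[of "el j"], of "el i"]
  by (simp add: l_def ip_B' el_orth)

lemma B_l: "j < \<kappa> \<Longrightarrow> B (l j) \<in> H2 p"
  unfolding l_def by (rule H2_ae[OF el_H2 ae_eq_sym[OF B_cancel(1)]]) auto

definition "rsum c = vsum \<kappa> q c er"
definition "lsum c = vsum \<kappa> p c l"

lemma rsum_H2 [simp]: "rsum c \<in> H2 q" unfolding rsum_def by (intro vsum_H2) simp
lemma lsum_H2perp [simp]: "lsum c \<in> H2perp p" unfolding lsum_def by (intro vsum_H2perp) simp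

lemma ip_rsum: "f \<in> L2 q \<Longrightarrow> ip (rsum c) f = (\<Sum>j<\<kappa>. c j * ip (er j) f)"
  unfolding rsum_def by (intro ip_vsum_left) auto
lemma ip_rsum_right: "f \<in> L2 q \<Longrightarrow> ip f (rsum c) = (\<Sum>j<\<kappa>. cnj (c j) * ip f (er j))"
  unfolding rsum_def by (intro ip_vsum_right) auto
lemma ip_lsum: "f \<in> L2 p \<Longrightarrow> ip (lsum c) f = (\<Sum>j<\<kappa>. c j * ip (l j) f)"
  unfolding lsum_def by (intro ip_vsum_left) auto

lemma ip_rsum_er: "j < \<kappa> \<Longrightarrow> ip (rsum c) (er j) = c j"
  by (simp add: ip_rsum er_orth if_distrib cong: if_cong)
lemma ip_lsum_l: "j < \<kappa> \<Longrightarrow> ip (lsum c) (l j) = c j"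
  by (simp add: ip_lsum l_orth if_distrib cong: if_cong)

lemma rsum_Hspace: "rsum c \<in> Hspace q br"
proof -
  have "ip (R' (rsum c)) y = 0" if "y \<in> H2 q" for y
    using that by (simp add: ip_R' ip_rsum er_R)
  then show ?thesis unfolding Hspace_iff by (auto intro!: H2perp_I)
qed

lemma lsum_Hstar: "lsum c \<in> Hstar p bl"
proof -
  have "ip (B (lsum c)) g = 0" if g: "g \<in> H2perp p" for g
  proof -
    have "ip (l j) (B' g) = 0" if "j < \<kappa>" for j
      using that g H2_orth[OF B_l[OF that] g] by (simp flip: ip_B)
    then show ?thesis using g by (simp add: ip_B ip_lsum)
  qed
  then show ?thesis unfolding Hstar_iff by (auto intro!: H2_I_orth)
qed

lemma Hspace_zero:
  assumes y: "y \<in> Hspace q br" and o: "\<And>j. j < \<kappa> \<Longrightarrow> ip y (er j) = 0"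
  shows "ae_eq y (\<lambda>_. 0\<^sub>v q)"
proof -
  have y2: "y \<in> H2 q" "R' y \<in> H2perp q" using y by (auto simp: Hspace_iff)
  have "ip (R' y) (R' y) = 0" by (rule H2perp_orth[OF y2(2) er_div[OF y2(1) o]])
  then have "ip y (R (R' y)) = 0" using y2 by (simp add: ip_R')
  then have "ip y y = 0" using ip_cong[OF ae_eq_refl R_cancel(1)[of y], of y] y2 by simp
  then show ?thesis using y2 by (intro ip_self_zero) auto
qed

lemma Hstar_zero:
  assumes h: "h \<in> Hstar p bl" and o: "\<And>j. j < \<kappa> \<Longrightarrow> ip h (l j) = 0"
  shows "ae_eq h (\<lambda>_. 0\<^sub>v p)"
proof -
  have h2: "h \<in> H2perp p" "B h \<in> H2 p" using h by (auto simp: Hstar_iff)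
  have "ip (B h) (el j) = 0" if "j < \<kappa>" for j using o[OF that] that h2 by (simp add: ip_B l_def)
  then have "B' (B h) \<in> H2 p" by (rule el_div[OF h2(2)])
  then have "ip h (B' (B h)) = 0" by (rule H2perp_orth[OF h2(1)])
  then have "ip h h = 0" using ip_cong[OF ae_eq_refl B_cancel(2)[of h], of h] h2 by simp
  then show ?thesis using h2 by (intro ip_self_zero) auto
qed

lemma Hspace_minus:
  assumes y: "y \<in> Hspace q br" "y' \<in> Hspace q br"
  shows "(\<lambda>z. y z - y' z) \<in> Hspace q br"
proof -
  have H: "y \<in> H2 q" "y' \<in> H2 q" "R' y \<in> H2perp q" "R' y' \<in> H2perp q"
    using y unfolding Hspace_iff by auto
  have "ip (R' (\<lambda>z. y z - y' z)) g = 0" if g: "g \<in> H2 q" for g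
    using H(1,2) g H2perp_orth[OF H(3) g] H2perp_orth[OF H(4) g]
    by (simp add: ip_R' ip_minus_left[of _ q])
  then have "R' (\<lambda>z. y z - y' z) \<in> H2perp q" using H by (intro H2perp_I) auto
  then show ?thesis using H unfolding Hspace_iff by simp
qed

lemma Hstar_minus:
  assumes h: "h \<in> Hstar p bl" "h' \<in> Hstar p bl"
  shows "(\<lambda>z. h z - h' z) \<in> Hstar p bl"
proof -
  have H: "h \<in> H2perp p" "h' \<in> H2perp p" "B h \<in> H2 p" "B h' \<in> H2 p"
    using h unfolding Hstar_iff by auto
  have "ip (B (\<lambda>z. h z - h' z)) g = 0" if g: "g \<in> H2perp p" for g
    using H(1,2) g H2_orth[OF H(3) g] H2_orth[OF H(4) g]
    by (simp add: ip_B ip_minus_left[of _ p])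
  then have "B (\<lambda>z. h z - h' z) \<in> H2 p" using H by (intro H2_I_orth) auto
  then show ?thesis using H unfolding Hstar_iff by simp
qed

lemma Hspace_L2: "y \<in> Hspace q br \<Longrightarrow> y \<in> L2 q" and Hstar_L2: "h \<in> Hstar p bl \<Longrightarrow> h \<in> L2 p"
  by (auto simp: Hspace_iff Hstar_iff)

lemma Hspace_eqI:
  assumes y: "y \<in> Hspace q br" "y' \<in> Hspace q br" and o: "\<And>j. j < \<kappa> \<Longrightarrow> ip y (er j) = ip y' (er j)"
  shows "ae_eq y y'"
proof (rule ae_zero_diff[OF Hspace_L2[OF y(1)] Hspace_L2[OF y(2)] Hspace_zero[OF Hspace_minus[OF y]]])
  fix j assume "j < \<kappa>"
  then show "ip (\<lambda>z. y z - y' z) (er j) = 0"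
    using o[of j] Hspace_L2 y by (simp add: ip_minus_left[of _ q])
qed

lemma Hstar_eqI:
  assumes y: "y \<in> Hstar p bl" "y' \<in> Hstar p bl" and o: "\<And>j. j < \<kappa> \<Longrightarrow> ip y (l j) = ip y' (l j)"
  shows "ae_eq y y'"
proof (rule ae_zero_diff[OF Hstar_L2[OF y(1)] Hstar_L2[OF y(2)] Hstar_zero[OF Hstar_minus[OF y]]])
  fix j assume "j < \<kappa>"
  then show "ip (\<lambda>z. y z - y' z) (l j) = 0"
    using o[of j] Hstar_L2 y by (simp add: ip_minus_left[of _ p])
qed

lemma proj_Hspace:
  assumes f: "f \<in> L2 q"
  shows "proj (Hspace q br) f \<in> Hspace q br"
    and "j < \<kappa> \<Longrightarrow> ip (proj (Hspace q br) f) (er j) = ip f (er j)"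
proof -
  let ?g = "rsum (\<lambda>j. ip f (er j))"
  have "ip (\<lambda>z. f z - ?g z) h = 0" if h: "h \<in> Hspace q br" for h
  proof -
    have hL: "h \<in> L2 q" by (rule Hspace_L2[OF h])
    have "ae_eq h (rsum (\<lambda>j. ip h (er j)))"
      by (rule Hspace_eqI[OF h rsum_Hspace]) (simp add: ip_rsum_er)
    then have "ip (\<lambda>z. f z - ?g z) h = ip (\<lambda>z. f z - ?g z) (rsum (\<lambda>j. ip h (er j)))"
      by (rule ip_cong[OF ae_eq_refl])
    also have "\<dots> = 0"
      using f by (simp add: ip_rsum_right ip_minus_left[of _ q] ip_rsum_er)
    finally show ?thesis .
  qed
  then have "\<exists>g. g \<in> Hspace q br \<and> (\<forall>h\<in>Hspace q br. ip (\<lambda>z. f z - g z) h = 0)"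
    using rsum_Hspace by blast
  from someI_ex[OF this]
  have P: "proj (Hspace q br) f \<in> Hspace q br"
    "\<And>h. h \<in> Hspace q br \<Longrightarrow> ip (\<lambda>z. f z - proj (Hspace q br) f z) h = 0"
    unfolding proj_def by auto
  show "proj (Hspace q br) f \<in> Hspace q br" by (fact P)
  show "ip (proj (Hspace q br) f) (er j) = ip f (er j)" if "j < \<kappa>"
    using P(2)[OF er_Hspace[OF that]] f Hspace_L2[OF P(1)] that by (simp add: ip_minus_left[of _ q])
qed

text \<open>
  As \<open>b\<^sub>r\<^sup>* w \<bottom> H\<^sub>2\<close> means \<open>w \<bottom> b\<^sub>r H\<^sub>2\<close>, only the finitely many basis vectors of \<open>H(b\<^sub>r)\<close> remain to be
  tested.
\<close>

lemma H2perp_test: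
  assumes w: "w \<in> L2 q" and R: "R' w \<in> H2perp q" and o: "\<And>j. j < \<kappa> \<Longrightarrow> ip w (er j) = 0"
  shows "w \<in> H2perp q"
proof (rule H2perp_I[OF w])
  fix x assume x: "x \<in> H2 q"
  let ?c = "rsum (\<lambda>j. ip x (er j))"
  let ?r = "\<lambda>z. x z - ?c z"
  have r: "?r \<in> H2 q" using x by simp
  have "ip ?r (er j) = 0" if "j < \<kappa>" for j
    using that x by (simp add: ip_minus_left[of _ q] ip_rsum_er)
  then have "R' ?r \<in> H2 q" by (rule er_div[OF r])
  then have "ip (R' w) (R' ?r) = 0" by (rule H2perp_orth[OF R])
  then have "ip w (R (R' ?r)) = 0" using w r by (simp add: ip_R')
  then have "ip w ?r = 0" using ip_cong[OF ae_eq_refl R_cancel(1)[of ?r], of w] r by simp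
  then show "ip w x = 0"
    using w x o by (simp add: ip_minus_right[of _ q] ip_rsum_right)
qed

lemma R'_S': "h \<in> H2perp p \<Longrightarrow> R' (S' h) \<in> H2perp q"
proof -
  assume h: "h \<in> H2perp p"
  have 1: "ae_eq (R' (S' h)) (R' (R (SR' h)))" by (rule mult_op_cong[OF S'_eq]) (use h in simp)
  have 2: "ae_eq (R' (R (SR' h))) (SR' h)" by (rule R_cancel) (use h in simp)
  show ?thesis
    by (rule H2perp_ae[OF SR'_H2perp[OF h] ae_eq_sym[OF ae_eq_trans[OF 1 2]]]) (use h in simp)
qed

text \<open>
  \<open>s\<^sup>* h = b\<^sub>r s\<^sub>r\<^sup>* h\<close> is orthogonal to \<open>b\<^sub>r H\<^sub>2\<close>.  Its projection onto \<open>H\<^sub>2\<close> is therefore the projection onto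
  \<open>H(b\<^sub>r)\<close>, a finite sum.
\<close>

lemma Yop_spec:
  assumes h: "h \<in> Hstar p bl"
  shows "Yop q s h \<in> H2 q" "x \<in> H2 q \<Longrightarrow> ip (Yop q s h) x = ip (S' h) x"
    "ae_eq (Yop q s h) (rsum (\<lambda>j. ip (S' h) (er j)))"
proof -
  have h2: "h \<in> H2perp p" "h \<in> L2 p" using h by (auto simp: Hstar_iff)
  let ?g = "rsum (\<lambda>j. ip (S' h) (er j))"
  have "(\<lambda>z. S' h z - ?g z) \<in> H2perp q"
  proof (rule H2perp_test)
    have "R' (\<lambda>z. S' h z - ?g z) \<in> L2 q" using h2 by simp
    moreover have "ip (R' (\<lambda>z. S' h z - ?g z)) x = 0" if x: "x \<in> H2 q" for x
      using h2 x H2perp_orth[OF R'_S'[OF h2(1)] x]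
      by (simp add: ip_R' ip_minus_left[of _ q] ip_rsum er_R)
    ultimately show "R' (\<lambda>z. S' h z - ?g z) \<in> H2perp q" by (rule H2perp_I)
  qed (use h2 in \<open>simp_all add: ip_minus_left[of _ q] ip_rsum_er\<close>)
  then have g: "?g \<in> H2 q \<and> (\<forall>x\<in>H2 q. ip (\<lambda>z. S' h z - ?g z) x = 0)"
    using H2perp_orth[of "\<lambda>z. S' h z - ?g z" q] by simp
  from someI[of "\<lambda>g. g \<in> H2 q \<and> (\<forall>x\<in>H2 q. ip (\<lambda>z. S' h z - g z) x = 0)", OF g]
  have Y: "Yop q s h \<in> H2 q" "\<And>x. x \<in> H2 q \<Longrightarrow> ip (\<lambda>z. S' h z - Yop q s h z) x = 0"
    unfolding Yop_def proj_def by auto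
  show YH: "Yop q s h \<in> H2 q" by (fact Y)
  show Yip: "ip (Yop q s h) x = ip (S' h) x" if "x \<in> H2 q" for x
    using Y(2)[OF that] YH h2 that by (simp add: ip_minus_left[of _ q])
  show "ae_eq (Yop q s h) ?g"
  proof (rule ae_zero_diff[of _ q])
    let ?d = "\<lambda>z. Yop q s h z - ?g z"
    have d: "?d \<in> H2 q" using YH by simp
    have "ip (S' h) ?d = ip ?g ?d"
      using g d h2 by (simp add: ip_minus_left[of "S' h" q ?g])
    then have "ip ?d ?d = 0"
      using Yip[OF d] YH d by (simp add: ip_minus_left[of "Yop q s h" q ?g])
    then show "ae_eq ?d (\<lambda>_. 0\<^sub>v q)" using d by (intro ip_self_zero) auto
  qed (use YH in auto)
qed

lemma Yop_eq_proj_iff: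
  assumes h: "h \<in> Hstar p bl" and f: "f \<in> L2 q"
  shows "ae_eq (Yop q s h) (proj (Hspace q br) f) \<longleftrightarrow> (\<forall>j<\<kappa>. ip (S' h) (er j) = ip f (er j))"
proof
  assume "ae_eq (Yop q s h) (proj (Hspace q br) f)"
  from ip_cong[OF this ae_eq_refl] show "\<forall>j<\<kappa>. ip (S' h) (er j) = ip f (er j)"
    using Yop_spec(2)[OF h] proj_Hspace(2)[OF f] by auto
next
  assume o: "\<forall>j<\<kappa>. ip (S' h) (er j) = ip f (er j)"
  have "ae_eq (rsum (\<lambda>j. ip (S' h) (er j))) (proj (Hspace q br) f)"
    using o proj_Hspace[OF f] by (intro Hspace_eqI rsum_Hspace) (auto simp: ip_rsum_er)
  with Yop_spec(3)[OF h] show "ae_eq (Yop q s h) (proj (Hspace q br) f)" by (rule ae_eq_trans)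
qed

text \<open>
  The matrix of \<open>Y\<close> in the two orthonormal bases.
\<close>

definition "T = Matrix.mat \<kappa> \<kappa> (\<lambda>(i, j). ip (S' (l j)) (er i))"

lemma T_carrier [simp]: "T \<in> carrier_mat \<kappa> \<kappa>" by (simp add: T_def)

lemma ip_S'_lsum:
  assumes i: "i < \<kappa>"
  shows "ip (S' (lsum c)) (er i) = (T *\<^sub>v Matrix.vec \<kappa> c) $ i"
  using i by (simp add: ip_S' ip_lsum T_def scalar_prod_def lessThan_atLeast0 mult.commute)

text \<open>
  A null vector of \<open>T\<close> is the coordinate vector of an element of the kernel of \<open>Y\<close>.
\<close>

lemma det_T: "Determinant.det T \<noteq> 0"
proof
  assume "Determinant.det T = 0"
  then obtain v where v: "v \<in> carrier_vec \<kappa>" "v \<noteq> 0\<^sub>v \<kappa>" "T *\<^sub>v v = 0\<^sub>v \<kappa>"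
    using det_0_iff_vec_prod_zero[OF T_carrier] by auto
  have vv: "Matrix.vec \<kappa> (\<lambda>j. v $ j) = v" using v(1) by (intro eq_vecI) auto
  let ?h = "lsum (\<lambda>j. v $ j)"
  have hp: "?h \<in> H2perp p" "B ?h \<in> H2 p" using lsum_Hstar by (auto simp: Hstar_iff)
  have "S' ?h \<in> H2perp q"
    by (rule H2perp_test[OF _ R'_S'[OF hp(1)]]) (use v(3) vv in \<open>auto simp: ip_S'_lsum\<close>)
  then have z: "ae_eq ?h (\<lambda>_. 0\<^sub>v p)" by (rule Y_injective[OF hp])
  have "v $ j = 0" if "j < \<kappa>" for j
    using ip_lsum_l[OF that, of "\<lambda>j. v $ j"] ip_zero_left[OF z, of "l j"] that by simp
  then have "v = 0\<^sub>v \<kappa>" using v(1) by (intro eq_vecI) auto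
  then show False using v(2) by simp
qed

lemmas T_inv = minv_adj_mat(2-4)[OF T_carrier det_T]

abbreviation "\<Gamma> \<equiv> Gop p q s bl br"

text \<open>
  Solvability of \<open>T c = d\<close> provides an element that the choice in \<open>Gop\<close> can pick.
\<close>

lemma \<Gamma>_spec:
  assumes f: "f \<in> L2 q"
  shows "\<Gamma> f \<in> Hstar p bl" "j < \<kappa> \<Longrightarrow> ip (S' (\<Gamma> f)) (er j) = ip f (er j)"
proof -
  define d where "d = Matrix.vec \<kappa> (\<lambda>j. ip f (er j))"
  have dc: "d \<in> carrier_vec \<kappa>" by (simp add: d_def)
  define c where "c = minv T *\<^sub>v d"
  have cc: "c \<in> carrier_vec \<kappa>" unfolding c_def using T_inv(3) dc by (rule mult_mat_vec_carrier)
  have cv: "Matrix.vec \<kappa> (\<lambda>j. c $ j) = c" using cc by (intro eq_vecI) auto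
  have "T *\<^sub>v c = (T * minv T) *\<^sub>v d"
    unfolding c_def by (rule assoc_mult_mat_vec[OF T_carrier T_inv(3) dc, symmetric])
  then have Tc: "T *\<^sub>v c = d" using T_inv(1) dc by simp
  have "ip (S' (lsum (\<lambda>j. c $ j))) (er j) = ip f (er j)" if "j < \<kappa>" for j
    using that by (simp add: ip_S'_lsum cv Tc) (simp add: d_def)
  then have "\<exists>h. h \<in> Hstar p bl \<and> ae_eq (Yop q s h) (proj (Hspace q br) f)"
    using lsum_Hstar Yop_eq_proj_iff[OF lsum_Hstar f] by blast
  from someI_ex[OF this] have G: "\<Gamma> f \<in> Hstar p bl" "ae_eq (Yop q s (\<Gamma> f)) (proj (Hspace q br) f)"
    unfolding Gop_def by auto
  show "\<Gamma> f \<in> Hstar p bl" by (fact G)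
  show "ip (S' (\<Gamma> f)) (er j) = ip f (er j)" if "j < \<kappa>"
    using G(2) that unfolding Yop_eq_proj_iff[OF G(1) f] by blast
qed

text \<open>
  \<open>\<Gamma>\<close> has finite rank: the coordinates of \<open>\<Gamma> f\<close> are \<open>T\<^sup>-\<^sup>1\<close> applied to those of the projection of \<open>f\<close>.  Hence
  \<open>\<langle>\<Gamma> f, g\<rangle> = \<langle>f, k\<rangle>\<close> with an explicit linear combination \<open>k\<close> of the basis of \<open>H(b\<^sub>r)\<close>.
\<close>

lemma adjoint_\<Gamma>:
  assumes g: "g \<in> L2 p"
  shows "adjoint_op q \<Gamma> g \<in> L2 q" "f \<in> L2 q \<Longrightarrow> ip (\<Gamma> f) g = ip f (adjoint_op q \<Gamma> g)"
proof -
  define a where "a i = cnj (\<Sum>j<\<kappa>. minv T $$ (j, i) * ip (l j) g)" for i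
  have "ip (\<Gamma> f) g = ip f (rsum a)" if f: "f \<in> L2 q" for f
  proof -
    let ?h = "\<Gamma> f"
    note h = \<Gamma>_spec[OF f]
    define c where "c = Matrix.vec \<kappa> (\<lambda>j. ip ?h (l j))"
    define d where "d = Matrix.vec \<kappa> (\<lambda>j. ip f (er j))"
    have cd: "c \<in> carrier_vec \<kappa>" "d \<in> carrier_vec \<kappa>" by (auto simp: c_def d_def)
    have hs: "ae_eq ?h (lsum (\<lambda>j. ip ?h (l j)))"
      by (rule Hstar_eqI[OF h(1) lsum_Hstar]) (simp add: ip_lsum_l)
    have "ip (S' ?h) (er i) = ip (S' (lsum (\<lambda>j. ip ?h (l j)))) (er i)" for i
      by (rule ip_cong[OF mult_op_cong[OF hs] ae_eq_refl])
    then have e: "ip f (er i) = (T *\<^sub>v c) $ i" if "i < \<kappa>" for i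
      using h(2)[OF that] ip_S'_lsum[OF that, of "\<lambda>j. ip ?h (l j)"] unfolding c_def by simp
    have "T *\<^sub>v c = d"
    proof (rule eq_vecI)
      fix i assume "i < dim_vec d"
      then show "(T *\<^sub>v c) $ i = d $ i" using e[of i] by (simp add: d_def del: index_mult_mat_vec)
    qed (use carrier_matD[OF T_carrier] in \<open>simp add: d_def\<close>)
    then have "minv T *\<^sub>v d = (minv T * T) *\<^sub>v c"
      using assoc_mult_mat_vec[OF T_inv(3) T_carrier cd(1)] by simp
    then have mc: "minv T *\<^sub>v d = c" using T_inv(2) cd by simp
    have cj: "ip ?h (l j) = (\<Sum>i<\<kappa>. minv T $$ (j, i) * ip f (er i))" if "j < \<kappa>" for j
      using arg_cong[OF mc, of "\<lambda>v. v $ j"] that T_inv(3)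
      by (simp add: c_def d_def scalar_prod_def lessThan_atLeast0)
    have "ip ?h g = ip (lsum (\<lambda>j. ip ?h (l j))) g" by (rule ip_cong[OF hs ae_eq_refl])
    also have "\<dots> = (\<Sum>j<\<kappa>. \<Sum>i<\<kappa>. minv T $$ (j, i) * ip f (er i) * ip (l j) g)"
      using g by (simp add: ip_lsum cj sum_distrib_right)
    also have "\<dots> = (\<Sum>i<\<kappa>. \<Sum>j<\<kappa>. minv T $$ (j, i) * ip f (er i) * ip (l j) g)"
      by (rule sum.swap)
    also have "\<dots> = ip f (rsum a)"
      using f by (simp add: ip_rsum_right a_def sum_distrib_right sum_distrib_left mult_ac)
    finally show ?thesis .
  qed
  then have "\<exists>k. k \<in> L2 q \<and> (\<forall>h\<in>L2 q. ip (\<Gamma> h) g = ip h k)"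
    by (intro exI[of _ "rsum a"]) auto
  from someI_ex[OF this] show "adjoint_op q \<Gamma> g \<in> L2 q"
    "f \<in> L2 q \<Longrightarrow> ip (\<Gamma> f) g = ip f (adjoint_op q \<Gamma> g)"
    unfolding adjoint_op_def by auto
qed

section \<open>The form of a shift pair\<close>

abbreviation "sh x \<equiv> (\<lambda>z. z \<cdot>\<^sub>v x z)"

text \<open>
  What is used of \<open>f = F u\<close>: the functions \<open>\<phi>, \<psi>\<close> are the components of \<open>\<Delta> f\<close>, stated through scalar products
  so that representatives do not matter, and they satisfy the two conditions that are imposed on \<open>F\<close>.
\<close>

definition "admissible f1 f2 \<phi> \<psi> \<longleftrightarrow>
  f1 \<in> L2 p \<and> f2 \<in> L2 q \<and> \<phi> \<in> L2 p \<and> \<psi> \<in> L2 q \<and>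
  (\<forall>x\<in>L2 p. ip \<phi> x = ip f1 x - ip f2 (S' x)) \<and>
  (\<forall>y\<in>L2 q. ip \<psi> y = ip f2 y - ip f1 (S y)) \<and>
  B \<phi> \<in> H2 p \<and> R' \<psi> \<in> H2perp q"

text \<open>
  This is \<open>\<langle>\<Delta> f, g\<rangle> + \<langle>\<Gamma> \<psi>, \<phi>'\<rangle> + \<langle>\<phi>, \<Gamma> \<psi>'\<rangle>\<close> when \<open>\<phi>, \<psi>\<close> are the components of \<open>\<Delta> f\<close> and \<open>\<phi>', \<psi>'\<close> those of
  \<open>\<Delta> g\<close>.
\<close>

definition "form g1 g2 \<phi> \<psi> \<phi>' \<psi>' =
  ip \<phi> g1 + ip \<psi> g2 + (ip (\<Gamma> \<psi>) \<phi>' + ip \<phi> (\<Gamma> \<psi>'))"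

definition "step c1 c2 g1 g2 f1 f2 \<longleftrightarrow>
  (\<forall>z. cmod z = 1 \<longrightarrow> f1 z = c1 + z \<cdot>\<^sub>v g1 z \<and> f2 z = c2 + z \<cdot>\<^sub>v g2 z)"

lemma admissibleD:
  assumes "admissible f1 f2 \<phi> \<psi>"
  shows "f1 \<in> L2 p" "f2 \<in> L2 q" "\<phi> \<in> L2 p" "\<psi> \<in> L2 q"
    "x \<in> L2 p \<Longrightarrow> ip \<phi> x = ip f1 x - ip f2 (S' x)"
    "y \<in> L2 q \<Longrightarrow> ip \<psi> y = ip f2 y - ip f1 (S y)"
    "B \<phi> \<in> H2 p" "R' \<psi> \<in> H2perp q"
  using assms unfolding admissible_def by auto

lemma \<Gamma>_Hstar:
  assumes "\<psi> \<in> L2 q"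
  shows "\<Gamma> \<psi> \<in> L2 p" "\<Gamma> \<psi> \<in> H2perp p" "B (\<Gamma> \<psi>) \<in> H2 p"
  using \<Gamma>_spec(1)[OF assms] by (auto simp: Hstar_iff)

text \<open>
  \<open>s\<^sup>* \<Gamma> \<psi> - \<psi>\<close> is orthogonal to \<open>H(b\<^sub>r)\<close> by the definition of \<open>\<Gamma>\<close> and to \<open>b\<^sub>r H\<^sub>2\<close> by the assumption on \<open>\<psi>\<close>.
\<close>

lemma \<Gamma>_residual:
  assumes \<psi>: "\<psi> \<in> L2 q" and R: "R' \<psi> \<in> H2perp q" and x: "x \<in> H2 q"
  shows "ip (S' (\<Gamma> \<psi>)) x = ip \<psi> x"
proof -
  note h = \<Gamma>_Hstar[OF \<psi>]
  have "(\<lambda>z. S' (\<Gamma> \<psi>) z - \<psi> z) \<in> H2perp q"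
  proof (rule H2perp_test)
    show w: "(\<lambda>z. S' (\<Gamma> \<psi>) z - \<psi> z) \<in> L2 q" using h \<psi> by simp
    show "R' (\<lambda>z. S' (\<Gamma> \<psi>) z - \<psi> z) \<in> H2perp q"
    proof (rule H2perp_I)
      show "R' (\<lambda>z. S' (\<Gamma> \<psi>) z - \<psi> z) \<in> L2 q" by (rule R'_L2[OF w])
      fix g assume g: "g \<in> H2 q"
      have "ip (R' (\<lambda>z. S' (\<Gamma> \<psi>) z - \<psi> z)) g = ip (S' (\<Gamma> \<psi>)) (R g) - ip \<psi> (R g)"
        using h \<psi> g by (simp add: ip_R' ip_minus_left[of _ q])
      also have "\<dots> = ip (R' (S' (\<Gamma> \<psi>))) g - ip (R' \<psi>) g" using h \<psi> g by (simp add: ip_R')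
      also have "\<dots> = 0" using H2perp_orth[OF R'_S'[OF h(2)] g] H2perp_orth[OF R g] by simp
      finally show "ip (R' (\<lambda>z. S' (\<Gamma> \<psi>) z - \<psi> z)) g = 0" .
    qed
    fix j assume "j < \<kappa>"
    then show "ip (\<lambda>z. S' (\<Gamma> \<psi>) z - \<psi> z) (er j) = 0"
      using h \<psi> \<Gamma>_spec(2)[OF \<psi>] by (simp add: ip_minus_left[of _ q])
  qed
  from H2perp_orth[OF this x] show ?thesis using h \<psi> x by (simp add: ip_minus_left[of _ q])
qed

lemma step_ip:
  assumes st: "step c1 c2 g1 g2 f1 f2" and c: "c1 \<in> carrier_vec p" "c2 \<in> carrier_vec q"
    and g: "g1 \<in> L2 p" "g2 \<in> L2 q"
  shows "x \<in> L2 p \<Longrightarrow> ip f1 x = ip (\<lambda>_. c1) x + ip (sh g1) x"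
    "y \<in> L2 q \<Longrightarrow> ip f2 y = ip (\<lambda>_. c2) y + ip (sh g2) y"
    "x \<in> L2 p \<Longrightarrow> ip x f1 = ip x (\<lambda>_. c1) + ip x (sh g1)"
    "y \<in> L2 q \<Longrightarrow> ip y f2 = ip y (\<lambda>_. c2) + ip y (sh g2)"
proof -
  have "ip f1 x = ip (\<lambda>z. c1 + z \<cdot>\<^sub>v g1 z) x" "ip x f1 = ip x (\<lambda>z. c1 + z \<cdot>\<^sub>v g1 z)" for x
    using st by (auto intro!: ip_cong_left ip_cong_right simp: step_def)
  then show "x \<in> L2 p \<Longrightarrow> ip f1 x = ip (\<lambda>_. c1) x + ip (sh g1) x"
    "x \<in> L2 p \<Longrightarrow> ip x f1 = ip x (\<lambda>_. c1) + ip x (sh g1)"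
    using c g by (simp_all add: ip_add_left[of _ p] ip_add_right[of _ p])
  have "ip f2 y = ip (\<lambda>z. c2 + z \<cdot>\<^sub>v g2 z) y" "ip y f2 = ip y (\<lambda>z. c2 + z \<cdot>\<^sub>v g2 z)" for y
    using st by (auto intro!: ip_cong_left ip_cong_right simp: step_def)
  then show "y \<in> L2 q \<Longrightarrow> ip f2 y = ip (\<lambda>_. c2) y + ip (sh g2) y"
    "y \<in> L2 q \<Longrightarrow> ip y f2 = ip y (\<lambda>_. c2) + ip y (sh g2)"
    using c g by (simp_all add: ip_add_left[of _ q] ip_add_right[of _ q])
qed

lemma S_sh: "y \<in> L2 q \<Longrightarrow> ip x (S (sh y)) = ip x (sh (S y))"
  by (intro ip_cong_right shift_mult_op[OF s])
lemma S'_sh: "y \<in> L2 p \<Longrightarrow> ip x (S' (sh y)) = ip x (sh (S' y))"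
  by (intro ip_cong_right shift_mult_op[OF Linf_adj[OF s]])
lemma B_sh: "y \<in> L2 p \<Longrightarrow> ip x (B (sh y)) = ip x (sh (B y))"
  by (intro ip_cong_right shift_mult_op[OF bl_Linf])
lemma SL_sh: "y \<in> L2 q \<Longrightarrow> ip x (SL (sh y)) = ip x (sh (SL y))"
  by (intro ip_cong_right shift_mult_op[OF sl_Linf])
lemma ip_B_S: "y \<in> L2 q \<Longrightarrow> ip x (B (S y)) = ip x (SL y)"
  by (rule ip_cong[OF ae_eq_refl B_S])

text \<open>
  The function \<open>k = c\<^sub>1 + \<Gamma> \<psi>\<^sub>f - z \<Gamma> \<psi>\<^sub>g\<close> measures how far \<open>\<Gamma>\<close> is from commuting with the shift.  It satisfies
  \<open>b\<^sub>l k \<in> H\<^sub>2\<close>, and the backward shift \<open>b'\<close> of \<open>b\<^sub>l k\<close> gives an element \<open>b\<^sub>l\<^sup>* b'\<close> of the kernel of \<open>Y\<close>: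
  its orthogonality to \<open>H\<^sub>2\<close>, and that of \<open>s\<^sup>* b\<^sub>l\<^sup>* b'\<close>, is checked by moving everything to the other side, where
  \<open>f = c + z g\<close> makes the contributions of \<open>\<psi>\<^sub>f\<close> and \<open>\<psi>\<^sub>g\<close> cancel.  Hence \<open>b\<^sub>l k\<close> is constant.
\<close>

lemma shift_defect:
  assumes f: "admissible f1 f2 \<phi>f \<psi>f" and g: "admissible g1 g2 \<phi>g \<psi>g"
    and st: "step c1 c2 g1 g2 f1 f2" and c: "c1 \<in> carrier_vec p" "c2 \<in> carrier_vec q"
    and x: "x \<in> L2 p" "B x \<in> H2 p"
  shows "ip (\<Gamma> \<psi>f) (sh x) = ip (\<Gamma> \<psi>g) x - ip (\<lambda>_. c1) (sh x)"
proof -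
  note F = admissibleD[OF f] and G = admissibleD[OF g]
  let ?hf = "\<Gamma> \<psi>f" and ?hg = "\<Gamma> \<psi>g"
  note hf = \<Gamma>_Hstar[OF F(4)] and hg = \<Gamma>_Hstar[OF G(4)]
  note stp = step_ip[OF st c G(1,2)]
  define k where "k z = (c1 + ?hf z) - z \<cdot>\<^sub>v ?hg z" for z
  have kL: "k \<in> L2 p" unfolding k_def using hf hg c by simp
  have ipk: "ip k w = ip (\<lambda>_. c1) w + ip ?hf w - ip (sh ?hg) w" if "w \<in> L2 p" for w
    unfolding k_def using hf hg c that by (simp add: ip_minus_left[of _ p] ip_add_left[of _ p])
  define b where "b = B k"
  have b: "b \<in> H2 p"
  proof (rule H2_I_orth)
    show "b \<in> L2 p" using kL by (simp add: b_def)
    fix w assume w: "w \<in> H2perp p"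
    have "ip (sh ?hg) (B' w) = ip ?hg (\<lambda>z. cnj z \<cdot>\<^sub>v B' w z)"
      using hg w by (intro ip_shift[of _ p]) auto
    also have "\<dots> = ip ?hg (B' (\<lambda>z. cnj z \<cdot>\<^sub>v w z))"
      using Linf_carrier[OF Linf_adj[OF bl_Linf]] L2_carrier[OF H2perp_L2[OF w]]
      by (intro ip_cong_right) (simp add: mult_op_def mult_mat_vec[of _ p p])
    also have "\<dots> = ip (B ?hg) (\<lambda>z. cnj z \<cdot>\<^sub>v w z)" using hg w by (simp add: ip_B)
    also have "\<dots> = 0" by (rule H2_orth[OF hg(3) H2perp_bshift[OF w]])
    finally have 1: "ip (sh ?hg) (B' w) = 0" .
    have "ip ?hf (B' w) = ip (B ?hf) w" using hf w by (simp add: ip_B)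
    also have "\<dots> = 0" by (rule H2_orth[OF hf(3) w])
    finally have 2: "ip ?hf (B' w) = 0" .
    have "ip (\<lambda>_. c1) (B' w) = 0"
      by (rule H2_orth[OF const_H2[OF c(1)] B'_H2perp[OF w]])
    then show "ip b w = 0" using 1 2 w kL by (simp add: b_def ip_B ipk)
  qed
  define b' where "b' z = cnj z \<cdot>\<^sub>v (b z - mean p b)" for z
  have b': "b' \<in> H2 p" unfolding b'_def by (rule H2_bshift[OF b])
  have ipb': "ip b' w = ip b (sh w)" if w: "w \<in> H2 p" for w
    unfolding b'_def using b w
    by (simp add: ip_bshift[of _ p] ip_minus_left[of _ p] ip_shift_const[of _ p])
  have ipb: "ip b (B w) = ip k w" if "w \<in> L2 p" for w
    unfolding b_def using kL that by (simp add: ip_inner[OF bl_inner])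
  have h': "B' b' \<in> H2perp p"
  proof (rule H2perp_I)
    show "B' b' \<in> L2 p" using b' by simp
    fix w assume w: "w \<in> H2 p"
    have "ip (B' b') w = ip b (sh (B w))" using b' w by (simp add: ip_B' ipb')
    also have "\<dots> = ip k (sh w)" using w by (simp add: ipb flip: B_sh)
    also have "\<dots> = ip (\<lambda>_. c1) (sh w) + ip ?hf (sh w) - ip ?hg w"
      using w hg by (simp add: ipk ip_shift_shift[of _ p])
    also have "\<dots> = 0"
      using w c H2perp_orth[OF hf(2) H2_shift[OF w]] H2perp_orth[OF hg(2) w] by (simp add: ip_shift_const[of _ p])
    finally show "ip (B' b') w = 0" .
  qed
  have "S' (B' b') \<in> H2perp q"
  proof (rule H2perp_I)
    show "S' (B' b') \<in> L2 q" using b' by simp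
    fix y assume y: "y \<in> H2 q"
    have "ip (S' (B' b')) y = ip b' (SL y)" using b' y by (simp add: ip_S' ip_B' ip_B_S)
    also have "\<dots> = ip b (sh (SL y))" using y by (simp add: ipb')
    also have "\<dots> = ip b (B (S (sh y)))" using y by (simp add: ip_B_S SL_sh)
    also have "\<dots> = ip k (S (sh y))" using y by (simp add: ipb)
    also have "\<dots> = ip (\<lambda>_. c1) (S (sh y)) + ip ?hf (S (sh y)) - ip ?hg (S y)"
      using y hg by (simp add: ipk S_sh[of y "sh ?hg"] ip_shift_shift[of _ p])
    also have "ip ?hf (S (sh y)) = ip (S' ?hf) (sh y)" using hf y by (simp add: ip_S')
    also have "\<dots> = ip \<psi>f (sh y)" by (rule \<Gamma>_residual[OF F(4,8) H2_shift[OF y]])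
    also have "\<dots> = ip g2 y - ip (\<lambda>_. c1) (S (sh y)) - ip g1 (S y)"
      using y c G(1,2) F(6)[of "sh y"] stp(1)[of "S (sh y)"] stp(2)[of "sh y"]
      by (simp add: S_sh[of y "sh g1"] ip_shift_shift[of _ p] ip_shift_shift[of _ q] ip_shift_const[of _ q])
    also have "ip ?hg (S y) = ip (S' ?hg) y" using hg y by (simp add: ip_S')
    also have "\<dots> = ip \<psi>g y" by (rule \<Gamma>_residual[OF G(4,8) y])
    also have "\<dots> = ip g2 y - ip g1 (S y)" using y by (intro G(6)) simp
    finally show "ip (S' (B' b')) y = 0" by simp
  qed
  moreover have "B (B' b') \<in> H2 p"
    by (rule H2_ae[OF b' ae_eq_sym[OF B_cancel(1)]]) (use b' in auto)
  ultimately have z: "ae_eq (B' b') (\<lambda>_. 0\<^sub>v p)" by (intro Y_injective[OF h'])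
  have "ip k (sh x) = ip b (sh (B x))" using x by (simp add: ipb flip: B_sh)
  also have "\<dots> = ip (B' b') x" using ipb'[OF x(2)] b' x by (simp add: ip_B')
  also have "\<dots> = 0" by (rule ip_zero_left[OF z x(1)])
  finally show ?thesis using x hg by (simp add: ipk ip_shift_shift[of _ p] algebra_simps)
qed

text \<open>
  Expand \<open>\<phi>\<close> for \<open>f'\<close> by \<open>f' = c' + z g'\<close>.  The constant \<open>c'\<^sub>1\<close> is orthogonal to \<open>\<Gamma> \<psi>\<^sub>f\<close>, the constant \<open>c'\<^sub>2\<close> sees
  \<open>s\<^sup>* \<Gamma> \<psi>\<^sub>f\<close> as \<open>\<psi>\<^sub>f\<close>, and the shifted part is the previous lemma.
\<close>

lemma cross_term:
  assumes f: "admissible f1 f2 \<phi>f \<psi>f" and g: "admissible g1 g2 \<phi>g \<psi>g"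
    and st: "step c1 c2 g1 g2 f1 f2" and c: "c1 \<in> carrier_vec p" "c2 \<in> carrier_vec q"
    and f': "admissible f1' f2' \<phi>f' \<psi>f'" and g': "admissible g1' g2' \<phi>g' \<psi>g'"
    and st': "step c1' c2' g1' g2' f1' f2'" and c': "c1' \<in> carrier_vec p" "c2' \<in> carrier_vec q"
  shows "ip (\<Gamma> \<psi>f) \<phi>f' = ip (\<Gamma> \<psi>g) \<phi>g' - ip \<psi>f (\<lambda>_. c2') - ip (\<lambda>_. c1) (sh \<phi>g')"
proof -
  note F = admissibleD[OF f] and G = admissibleD[OF g] and F' = admissibleD[OF f'] and G' = admissibleD[OF g']
  let ?h = "\<Gamma> \<psi>f"
  note h = \<Gamma>_Hstar[OF F(4)]
  note stp = step_ip[OF st' c' G'(1,2)]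
  have adj: "ip x \<phi>g' = ip x g1' - ip (S' x) g2'" if "x \<in> L2 p" for x
    using that G'(1-3) G'(5)[of x] S'_L2[OF that] by (simp add: ip_cnj[of x p] ip_cnj[of "S' x" q])
  have sh\<phi>: "ip x (sh \<phi>g') = ip x (sh g1') - ip (S' x) (sh g2')" if x: "x \<in> L2 p" for x
  proof -
    let ?y = "\<lambda>z. cnj z \<cdot>\<^sub>v x z"
    have y: "?y \<in> L2 p" using x by simp
    have "ip x (sh \<phi>g') = ip ?y \<phi>g'" using x G'(3) by (simp add: ip_bshift[of _ p])
    also have "\<dots> = ip ?y g1' - ip (S' ?y) g2'" by (rule adj[OF y])
    also have "ip ?y g1' = ip x (sh g1')" using x G'(1) by (simp add: ip_bshift[of _ p])
    also have "ip (S' ?y) g2' = ip (S' x) (sh g2')"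
      using x G'(2) by (simp add: ip_S' ip_bshift[of _ p] S_sh)
    finally show ?thesis .
  qed
  have "ip ?h \<phi>f' = ip ?h f1' - ip (S' ?h) f2'"
    using h F'(1-3) F'(5)[of ?h] by (simp add: ip_cnj[of ?h p] ip_cnj[of "S' ?h" q])
  also have "\<dots> = ip ?h (\<lambda>_. c1') - ip (S' ?h) (\<lambda>_. c2') + ip ?h (sh \<phi>g')"
    using h by (simp add: stp sh\<phi>)
  also have "ip ?h (\<lambda>_. c1') = 0" by (rule H2perp_orth[OF h(2) const_H2[OF c'(1)]])
  also have "ip (S' ?h) (\<lambda>_. c2') = ip \<psi>f (\<lambda>_. c2')"
    by (rule \<Gamma>_residual[OF F(4,8) const_H2[OF c'(2)]])
  also have "ip ?h (sh \<phi>g') = ip (\<Gamma> \<psi>g) \<phi>g' - ip (\<lambda>_. c1) (sh \<phi>g')"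
    by (rule shift_defect[OF f g st c G'(3,7)])
  finally show ?thesis by simp
qed

text \<open>
  All scalar products are expanded in terms of the constants and of \<open>g, g'\<close>.  The scalar products of \<open>g\<close> with \<open>g'\<close> cancel
  because the shift is isometric, the mixed ones cancel against the two cross terms, and the two products of constants
  survive.
\<close>

lemma form_difference:
  assumes f: "admissible f1 f2 \<phi>f \<psi>f" and g: "admissible g1 g2 \<phi>g \<psi>g"
    and st: "step c1 c2 g1 g2 f1 f2" and c: "c1 \<in> carrier_vec p" "c2 \<in> carrier_vec q"
    and f': "admissible f1' f2' \<phi>f' \<psi>f'" and g': "admissible g1' g2' \<phi>g' \<psi>g'"
    and st': "step c1' c2' g1' g2' f1' f2'" and c': "c1' \<in> carrier_vec p" "c2' \<in> carrier_vec q"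
  shows "form f1' f2' \<phi>f \<psi>f \<phi>f' \<psi>f' - form g1' g2' \<phi>g \<psi>g \<phi>g' \<psi>g' = c1 \<bullet>c c1' - c2 \<bullet>c c2'"
proof -
  note F = admissibleD[OF f] and G = admissibleD[OF g] and F' = admissibleD[OF f'] and G' = admissibleD[OF g']
  note h = \<Gamma>_Hstar[OF F(4)] \<Gamma>_Hstar[OF G(4)] \<Gamma>_Hstar[OF F'(4)] \<Gamma>_Hstar[OF G'(4)]
  note stp = step_ip[OF st c G(1,2)] and stp' = step_ip[OF st' c' G'(1,2)]
  note cL = L2_const[OF c(1)] L2_const[OF c(2)] L2_const[OF c'(1)] L2_const[OF c'(2)]
  let ?c1 = "\<lambda>_. c1" and ?c2 = "\<lambda>_. c2" and ?c1' = "\<lambda>_. c1'" and ?c2' = "\<lambda>_. c2'"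
  have cr: "ip (\<Gamma> \<psi>f) \<phi>f' = ip (\<Gamma> \<psi>g) \<phi>g' - ip \<psi>f ?c2' - ip ?c1 (sh \<phi>g')"
    by (rule cross_term[OF f g st c f' g' st' c'])
  have "ip (\<Gamma> \<psi>f') \<phi>f = ip (\<Gamma> \<psi>g') \<phi>g - ip \<psi>f' ?c2 - ip ?c1' (sh \<phi>g)"
    by (rule cross_term[OF f' g' st' c' f g st c])
  then have cr': "ip \<phi>f (\<Gamma> \<psi>f') = ip \<phi>g (\<Gamma> \<psi>g') - ip ?c2 \<psi>f' - ip (sh \<phi>g) ?c1'"
    using F(3) G(3) F'(4) G'(4) h cL
    by (simp add: ip_cnj[of \<phi>f p] ip_cnj[of \<phi>g p] ip_cnj[of ?c2 q] ip_cnj[of "sh \<phi>g" p])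
  have e1: "ip \<phi>f f1' = ip \<phi>f ?c1' + ip ?c1 (sh g1') - ip ?c2 (S' (sh g1')) + ip \<phi>g g1'"
    using G'(1) G(1,2) stp'(3)[OF F(3)] F(5)[of "sh g1'"] stp(1)[of "sh g1'"] stp(2)[of "S' (sh g1')"]
      G(5)[of g1']
    by (simp add: ip_shift_shift[of _ p] ip_shift_shift[of _ q] S'_sh[of _ "sh g2"])
  have e2: "ip \<psi>f f2' = ip \<psi>f ?c2' + ip ?c2 (sh g2') - ip ?c1 (S (sh g2')) + ip \<psi>g g2'"
    using G'(2) G(1,2) stp'(4)[OF F(4)] F(6)[of "sh g2'"] stp(2)[of "sh g2'"] stp(1)[of "S (sh g2')"]
      G(6)[of g2']
    by (simp add: ip_shift_shift[of _ p] ip_shift_shift[of _ q] S_sh[of _ "sh g1"])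
  have e3: "ip ?c1 (sh \<phi>g') = ip ?c1 (sh g1') - ip ?c1 (S (sh g2'))"
  proof -
    let ?y = "\<lambda>z. cnj z \<cdot>\<^sub>v c1"
    have y: "?y \<in> L2 p" using L2_bshift[OF cL(1)] .
    have "ip ?c1 (sh \<phi>g') = ip ?y \<phi>g'" using ip_bshift[OF cL(1) G'(3)] by simp
    also have "\<dots> = ip ?y g1' - ip (S' ?y) g2'"
      using y G'(1-3) G'(5)[of ?y] S'_L2[OF y] by (simp add: ip_cnj[of ?y p] ip_cnj[of "S' ?y" q])
    also have "ip ?y g1' = ip ?c1 (sh g1')" using ip_bshift[OF cL(1) G'(1)] .
    also have "ip (S' ?y) g2' = ip ?c1 (S (sh g2'))"
      using ip_bshift[OF cL(1) S_L2[OF G'(2)]] y G'(2) by (simp add: ip_S' S_sh)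
    finally show ?thesis .
  qed
  have e4: "ip ?c2 \<psi>f' = ip ?c2 ?c2' + ip ?c2 (sh g2') - ip (S ?c2) ?c1' - ip (S ?c2) (sh g1')"
  proof -
    have "ip ?c2 \<psi>f' = ip ?c2 f2' - ip (S ?c2) f1'"
      using cL(2) F'(1,2,4) F'(6)[of ?c2] by (simp add: ip_cnj[of ?c2 q] ip_cnj[of "S ?c2" p])
    then show ?thesis using stp'(3)[of "S ?c2"] stp'(4)[OF cL(2)] cL(2) by simp
  qed
  have e5: "ip \<phi>f ?c1' = ip ?c1 ?c1' - ip (S ?c2) ?c1' + ip (sh \<phi>g) ?c1'"
  proof -
    let ?y = "\<lambda>z. cnj z \<cdot>\<^sub>v c1'"
    have y: "?y \<in> L2 p" using L2_bshift[OF cL(3)] .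
    have "ip (sh \<phi>g) ?c1' = ip \<phi>g ?y" by (rule ip_shift[OF G(3) cL(3)])
    also have "\<dots> = ip g1 ?y - ip g2 (S' ?y)" by (rule G(5)[OF y])
    also have "ip g1 ?y = ip (sh g1) ?c1'" by (rule ip_shift[OF G(1) cL(3), symmetric])
    also have "ip g2 (S' ?y) = ip (S g2) ?y" using G(2) y by (simp add: ip_S)
    also have "\<dots> = ip (sh (S g2)) ?c1'" by (rule ip_shift[OF S_L2[OF G(2)] cL(3), symmetric])
    also have "\<dots> = ip (S (sh g2)) ?c1'"
      by (rule ip_cong_left[symmetric]) (rule shift_mult_op[OF s G(2)])
    also have "\<dots> = ip (sh g2) (S' ?c1')" using G(2) cL by (simp add: ip_S)
    finally have "ip (sh \<phi>g) ?c1' = ip (sh g1) ?c1' - ip (sh g2) (S' ?c1')" .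
    moreover have "ip (S ?c2) ?c1' = ip ?c2 (S' ?c1')" using cL by (simp add: ip_S)
    ultimately show ?thesis
      using F(5)[OF cL(3)] stp(1)[OF cL(3)] stp(2)[OF S'_L2[OF cL(3)]] by simp
  qed
  have e6: "ip ?c2 (S' (sh g1')) = ip (S ?c2) (sh g1')"
    using cL G'(1) by (simp add: ip_S)
  have "ip ?c1 ?c1' = c1 \<bullet>c c1'" "ip ?c2 ?c2' = c2 \<bullet>c c2'"
    by (rule ip_const[OF c(1) c'(1)], rule ip_const[OF c(2) c'(2)])
  then show ?thesis
    unfolding form_def cr cr' e1 e2 e3 e4 e5 e6 by (simp add: algebra_simps)
qed

end

section \<open>The matrix P and the Lyapunov--Stein equation\<close>

lemma sum_split: "(\<Sum>i<p + q. F i) = (\<Sum>i<p. F i) + (\<Sum>i<q. F (p + i :: nat) :: complex)"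
  by (induction q) (auto simp: add.assoc)

lemma vec_last_index:
  "v \<in> carrier_vec (p + q) \<Longrightarrow> i < q \<Longrightarrow> vec_last v q $ i = v $ (p + i)"
  "i < p \<Longrightarrow> vec_first v p $ i = v $ i"
  by (auto simp: vec_last_def vec_first_def)

lemma cscalar_prod_split:
  fixes v w :: "complex vec"
  assumes "v \<in> carrier_vec (p + q)" "w \<in> carrier_vec (p + q)"
  shows "v \<bullet>c w = vec_first v p \<bullet>c vec_first w p + vec_last v q \<bullet>c vec_last w q"
  using assms
  by (simp add: cscalar_prod_sum[of _ "p + q"] cscalar_prod_sum[of _ p] cscalar_prod_sum[of _ q]
      sum_split vec_last_index)

lemma L2_first: "f \<in> L2 (p + q) \<Longrightarrow> (\<lambda>z. vec_first (f z) p) \<in> L2 p"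
  by (rule L2_I) (auto simp: vec_last_index intro: L2_sq)

lemma L2_last: "f \<in> L2 (p + q) \<Longrightarrow> (\<lambda>z. vec_last (f z) q) \<in> L2 q"
  by (rule L2_I) (auto simp: vec_last_index(1)[OF L2_cis] intro: L2_sq)

lemma L2_append:
  assumes "f \<in> L2 p" "g \<in> L2 q"
  shows "(\<lambda>z. f z @\<^sub>v g z) \<in> L2 (p + q)"
proof (rule L2_I)
  fix i assume i: "i < p + q"
  show "sq_integrable (\<lambda>t. (f (cis t) @\<^sub>v g (cis t)) $ i)"
  proof (cases "i < p")
    case True
    then show ?thesis using assms i by (simp add: L2_sq)
  next
    case False
    then have "i - p < q" using i by simp
    then show ?thesis using False assms i by (simp add: L2_sq)
  qed
qed (use assms in \<open>auto dest: L2_carrier\<close>)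

lemma first_append: "v \<in> carrier_vec p \<Longrightarrow> vec_first (v @\<^sub>v w) p = v"
  and last_append: "v \<in> carrier_vec p \<Longrightarrow> w \<in> carrier_vec q \<Longrightarrow> vec_last (v @\<^sub>v w) q = w"
  by (auto simp: vec_first_def vec_last_def intro!: eq_vecI)

lemma ip_split:
  assumes f: "f \<in> L2 (p + q)" and g: "g \<in> L2 (p + q)"
  shows "ip f g = ip (\<lambda>z. vec_first (f z) p) (\<lambda>z. vec_first (g z) p)
    + ip (\<lambda>z. vec_last (f z) q) (\<lambda>z. vec_last (g z) q)"
proof -
  have "f (cis t) \<bullet>c g (cis t) = vec_first (f (cis t)) p \<bullet>c vec_first (g (cis t)) p
      + vec_last (f (cis t)) q \<bullet>c vec_last (g (cis t)) q" for t
    by (rule cscalar_prod_split) (use f g in auto)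
  then show ?thesis
    using ip_integrable[OF L2_first[OF f] L2_first[OF g]] ip_integrable[OF L2_last[OF f] L2_last[OF g]]
    by (simp add: ip_def algebra_simps)
qed

lemma hcat_mult_vec:
  assumes A: "A \<in> carrier_mat k a" and B: "B \<in> carrier_mat k b" and v: "v \<in> carrier_vec (a + b)"
  shows "hcat A B *\<^sub>v v = A *\<^sub>v vec_first v a + B *\<^sub>v vec_last v b"
proof -
  have "hcat A B *\<^sub>v (vec_first v a @\<^sub>v vec_last v b)
    = (A *\<^sub>v vec_first v a + B *\<^sub>v vec_last v b)
       @\<^sub>v (0\<^sub>m 0 a *\<^sub>v vec_first v a + 0\<^sub>m 0 b *\<^sub>v vec_last v b)"
    unfolding hcat_def using four_block_mat_mult_vec[OF A B, of "0\<^sub>m 0 a" 0 "0\<^sub>m 0 b" "vec_first v a" "vec_last v b"] A B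
    by simp
  also have "\<dots> = A *\<^sub>v vec_first v a + B *\<^sub>v vec_last v b"
    using A B by (intro eq_vecI) auto
  finally show ?thesis using v by simp
qed

lemma Delta_mult_vec:
  assumes s: "s z \<in> carrier_mat p q" and v: "v \<in> carrier_vec (p + q)"
  shows "Delta p q s z *\<^sub>v v = (vec_first v p - s z *\<^sub>v vec_last v q)
    @\<^sub>v (vec_last v q - mat_adjoint (s z) *\<^sub>v vec_first v p)"
proof -
  have "Delta p q s z *\<^sub>v (vec_first v p @\<^sub>v vec_last v q)
    = (1\<^sub>m p *\<^sub>v vec_first v p + - s z *\<^sub>v vec_last v q)
      @\<^sub>v (- mat_adjoint (s z) *\<^sub>v vec_first v p + 1\<^sub>m q *\<^sub>v vec_last v q)"
    unfolding Delta_def by (rule four_block_mat_mult_vec) (use s in auto)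
  also have "1\<^sub>m p *\<^sub>v vec_first v p + - s z *\<^sub>v vec_last v q = vec_first v p - s z *\<^sub>v vec_last v q"
    using s by (intro eq_vecI) (auto simp: uminus_mult_mat_vec)
  also have "- mat_adjoint (s z) *\<^sub>v vec_first v p + 1\<^sub>m q *\<^sub>v vec_last v q
      = vec_last v q - mat_adjoint (s z) *\<^sub>v vec_first v p"
    using s by (intro eq_vecI) (auto simp: uminus_mult_mat_vec)
  finally show ?thesis using v by simp
qed

text \<open>
  A form that is a scalar product with a fixed vector in each argument separately is sesquilinear, hence given by
  its Gram matrix at the unit vectors.  Representability is easier to obtain than linearity for an operator
  that is defined by choices of representatives.
\<close>

lemma sesquilinear_matrix:
  fixes \<Phi> :: "complex vec \<Rightarrow> complex vec \<Rightarrow> complex"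
  assumes l: "\<And>v. v \<in> carrier_vec n \<Longrightarrow> \<exists>w\<in>carrier_vec n. \<forall>u\<in>carrier_vec n. \<Phi> u v = u \<bullet>c w"
    and r: "\<And>u. u \<in> carrier_vec n \<Longrightarrow> \<exists>w\<in>carrier_vec n. \<forall>v\<in>carrier_vec n. \<Phi> u v = w \<bullet>c v"
  shows "\<exists>!P. P \<in> carrier_mat n n \<and>
    (\<forall>u\<in>carrier_vec n. \<forall>v\<in>carrier_vec n. (P *\<^sub>v u) \<bullet>c v = \<Phi> u v)"
proof (rule ex1I)
  define P where "P = Matrix.mat n n (\<lambda>(i, j). \<Phi> (unit_vec n j) (unit_vec n i))"
  have Pc: "P \<in> carrier_mat n n" by (simp add: P_def)
  have "(P *\<^sub>v u) \<bullet>c v = \<Phi> u v" if u: "u \<in> carrier_vec n" and v: "v \<in> carrier_vec n" for u v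
  proof -
    have col: "\<Phi> (unit_vec n j) v = (\<Sum>i<n. P $$ (i, j) * cnj (v $ i))" if j: "j < n" for j
    proof -
      obtain w where w: "w \<in> carrier_vec n" "\<And>v. v \<in> carrier_vec n \<Longrightarrow> \<Phi> (unit_vec n j) v = w \<bullet>c v"
        using r[of "unit_vec n j"] by auto
      have "w $ i = P $$ (i, j)" if "i < n" for i
        using w(2)[of "unit_vec n i"] w(1) that j by (simp add: P_def)
      then show ?thesis unfolding w(2)[OF v] using w(1) v by (simp add: cscalar_prod_sum[of _ n])
    qed
    obtain w where w: "w \<in> carrier_vec n" "\<And>u. u \<in> carrier_vec n \<Longrightarrow> \<Phi> u v = u \<bullet>c w"
      using l[OF v] by auto
    have wj: "cnj (w $ j) = \<Phi> (unit_vec n j) v" if "j < n" for j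
    proof -
      have "w \<bullet>c unit_vec n j = cnj (unit_vec n j \<bullet>c w)"
        using w(1) by (simp only: cscalar_prod_sum[of _ n] unit_vec_carrier cnj_sum complex_cnj_mult
            complex_cnj_cnj mult.commute)
      then show ?thesis using w(1) w(2)[OF unit_vec_carrier] that by simp
    qed
    have "\<Phi> u v = (\<Sum>j<n. u $ j * \<Phi> (unit_vec n j) v)"
      unfolding w(2)[OF u] using w(1) u by (simp add: cscalar_prod_sum[of _ n] wj)
    also have "\<dots> = (\<Sum>j<n. \<Sum>i<n. P $$ (i, j) * u $ j * cnj (v $ i))"
      by (simp add: col sum_distrib_left mult_ac)
    also have "\<dots> = (\<Sum>i<n. \<Sum>j<n. P $$ (i, j) * u $ j * cnj (v $ i))" by (rule sum.swap)
    also have "\<dots> = (\<Sum>i<n. (P *\<^sub>v u) $ i * cnj (v $ i))"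
    proof (rule sum.cong[OF refl])
      fix i assume "i \<in> {..<n}"
      then have "(P *\<^sub>v u) $ i = (\<Sum>j<n. P $$ (i, j) * u $ j)"
        using Pc u by (simp add: scalar_prod_def atLeast0LessThan)
      then show "(\<Sum>j<n. P $$ (i, j) * u $ j * cnj (v $ i)) = (P *\<^sub>v u) $ i * cnj (v $ i)"
        by (simp only: sum_distrib_right)
    qed
    also have "\<dots> = (P *\<^sub>v u) \<bullet>c v"
      using Pc u v by (simp only: cscalar_prod_sum[of _ n] mult_mat_vec_carrier)
    finally show ?thesis ..
  qed
  then show "P \<in> carrier_mat n n \<and> (\<forall>u\<in>carrier_vec n. \<forall>v\<in>carrier_vec n. (P *\<^sub>v u) \<bullet>c v = \<Phi> u v)"
    using Pc by blast
  fix Q assume Q: "Q \<in> carrier_mat n n \<and> (\<forall>u\<in>carrier_vec n. \<forall>v\<in>carrier_vec n. (Q *\<^sub>v u) \<bullet>c v = \<Phi> u v)"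
  show "Q = P"
  proof (rule eq_matI)
    fix i j assume "i < dim_row P" "j < dim_col P"
    then have ij: "i < n" "j < n" by (auto simp: P_def)
    have "(Q *\<^sub>v unit_vec n j) \<bullet>c unit_vec n i = \<Phi> (unit_vec n j) (unit_vec n i)" using Q by simp
    moreover have "Q *\<^sub>v unit_vec n j \<in> carrier_vec n" "dim_row Q = n" "dim_col Q = n" using Q by auto
    ultimately show "Q $$ (i, j) = P $$ (i, j)" using ij by (simp add: P_def)
  qed (use Q in \<open>auto simp: P_def\<close>)
qed

context krein_langer
begin

abbreviation (input) "\<phi>_of f \<equiv> (\<lambda>w. vec_first (mult_op (Delta p q s) f w) p)"
abbreviation (input) "\<psi>_of f \<equiv> (\<lambda>w. vec_last (mult_op (Delta p q s) f w) q)"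
abbreviation (input) "fst_part f \<equiv> (\<lambda>z. vec_first (f z) p)"
abbreviation (input) "snd_part f \<equiv> (\<lambda>z. vec_last (f z) q)"

lemma Delta_apply:
  assumes f: "f \<in> L2 (p + q)" and z: "cmod z = 1"
  shows "mult_op (Delta p q s) f z = (fst_part f z - S (snd_part f) z) @\<^sub>v (snd_part f z - S' (fst_part f) z)"
  unfolding mult_op_def by (rule Delta_mult_vec[of s z p q "f z", OF Linf_carrier[OF s z] L2_carrier[OF f z]])

lemma \<phi>_apply:
  assumes f: "f \<in> L2 (p + q)" and z: "cmod z = 1"
  shows "\<phi>_of f z = fst_part f z - S (snd_part f) z" "\<psi>_of f z = snd_part f z - S' (fst_part f) z"
proof -
  have c: "S (snd_part f) z \<in> carrier_vec p" "S' (fst_part f) z \<in> carrier_vec q"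
    using L2_carrier[OF S_L2[OF L2_last[OF f]] z] L2_carrier[OF S'_L2[OF L2_first[OF f]] z] by auto
  show "\<phi>_of f z = fst_part f z - S (snd_part f) z" "\<psi>_of f z = snd_part f z - S' (fst_part f) z"
    unfolding Delta_apply[OF f z] using c minus_carrier_vec[of "vec_first (f z) p" p] minus_carrier_vec[of "vec_last (f z) q" q]
    by (simp_all add: first_append last_append[of _ p])
qed

lemma Delta_L2:
  assumes f: "f \<in> L2 (p + q)"
  shows "mult_op (Delta p q s) f \<in> L2 (p + q)"
proof (rule L2_ae)
  show "(\<lambda>z. (fst_part f z - S (snd_part f) z) @\<^sub>v (snd_part f z - S' (fst_part f) z)) \<in> L2 (p + q)"
    using L2_first[OF f] L2_last[OF f] by (intro L2_append L2_minus S_L2 S'_L2)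
  then show "mult_op (Delta p q s) f z \<in> carrier_vec (p + q)" if "cmod z = 1" for z
    unfolding Delta_apply[OF f that] by (rule L2_carrier[OF _ that])
  show "ae_eq (\<lambda>z. (fst_part f z - S (snd_part f) z) @\<^sub>v (snd_part f z - S' (fst_part f) z)) (mult_op (Delta p q s) f)"
    by (rule ae_eqI) (rule Delta_apply[OF f, symmetric])
qed

lemma \<phi>_\<psi>_L2:
  assumes f: "f \<in> L2 (p + q)" shows "\<phi>_of f \<in> L2 p" "\<psi>_of f \<in> L2 q"
  by (rule L2_first[OF Delta_L2[OF f]], rule L2_last[OF Delta_L2[OF f]])

lemma ip_\<phi>_\<psi>:
  assumes f: "f \<in> L2 (p + q)"
  shows "x \<in> L2 p \<Longrightarrow> ip (\<phi>_of f) x = ip (fst_part f) x - ip (snd_part f) (S' x)"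
    "y \<in> L2 q \<Longrightarrow> ip (\<psi>_of f) y = ip (snd_part f) y - ip (fst_part f) (S y)"
    "x \<in> L2 p \<Longrightarrow> ip x (\<phi>_of f) = ip x (fst_part f) - ip x (S (snd_part f))"
    "y \<in> L2 q \<Longrightarrow> ip y (\<psi>_of f) = ip y (snd_part f) - ip y (S' (fst_part f))"
proof -
  note l = L2_first[OF f] L2_last[OF f]
  have 1: "ip (\<phi>_of f) x = ip (\<lambda>z. fst_part f z - S (snd_part f) z) x"
    "ip x (\<phi>_of f) = ip x (\<lambda>z. fst_part f z - S (snd_part f) z)" for x
    by (auto intro!: ip_cong_left ip_cong_right \<phi>_apply[OF f])
  have 2: "ip (\<psi>_of f) x = ip (\<lambda>z. snd_part f z - S' (fst_part f) z) x"
    "ip x (\<psi>_of f) = ip x (\<lambda>z. snd_part f z - S' (fst_part f) z)" for x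
    by (auto intro!: ip_cong_left ip_cong_right \<phi>_apply[OF f])
  show "x \<in> L2 p \<Longrightarrow> ip (\<phi>_of f) x = ip (fst_part f) x - ip (snd_part f) (S' x)"
    "x \<in> L2 p \<Longrightarrow> ip x (\<phi>_of f) = ip x (fst_part f) - ip x (S (snd_part f))"
    unfolding 1 using l by (simp_all add: ip_minus_left[of _ p] ip_minus_right[of _ p] ip_S)
  show "y \<in> L2 q \<Longrightarrow> ip (\<psi>_of f) y = ip (snd_part f) y - ip (fst_part f) (S y)"
    "y \<in> L2 q \<Longrightarrow> ip y (\<psi>_of f) = ip y (snd_part f) - ip y (S' (fst_part f))"
    unfolding 2 using l by (simp_all add: ip_minus_left[of _ q] ip_minus_right[of _ q] ip_S')
qed

abbreviation (input) "\<Gamma>' \<equiv> adjoint_op q \<Gamma>"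

lemma ip_P_operator:
  assumes f: "f \<in> L2 (p + q)" and g: "g \<in> L2 (p + q)"
  shows "P_operator p q s bl br f \<in> L2 (p + q)"
    and "ip (P_operator p q s bl br f) g
      = form (fst_part g) (snd_part g) (\<phi>_of f) (\<psi>_of f) (\<phi>_of g) (\<psi>_of g)"
proof -
  define W where "W z = \<Gamma> (\<psi>_of f) z @\<^sub>v \<Gamma>' (\<phi>_of f) z" for z
  note fl = \<phi>_\<psi>_L2[OF f] and gl = \<phi>_\<psi>_L2[OF g]
  note g12 = L2_first[OF g] L2_last[OF g]
  have W1: "\<Gamma> (\<psi>_of f) \<in> L2 p" by (rule \<Gamma>_Hstar(1)[OF fl(2)])
  have W2: "\<Gamma>' (\<phi>_of f) \<in> L2 q" by (rule adjoint_\<Gamma>(1)[OF fl(1)])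
  have W: "W \<in> L2 (p + q)" unfolding W_def by (rule L2_append[OF W1 W2])
  have P: "P_operator p q s bl br f = (\<lambda>z. mult_op (Delta p q s) f z + mult_op (Delta p q s) W z)"
    unfolding P_operator_def Let_def offdiag_op_def W_def ..
  show "P_operator p q s bl br f \<in> L2 (p + q)"
    unfolding P by (intro L2_add Delta_L2 f W)
  have tW: "ip (fst_part W) x = ip (\<Gamma> (\<psi>_of f)) x" for x
    by (rule ip_cong_left) (auto simp: W_def first_append dest: L2_carrier[OF W1])
  have bW: "ip (snd_part W) x = ip (\<Gamma>' (\<phi>_of f)) x" for x
    by (rule ip_cong_left) (auto simp: W_def intro!: last_append dest: L2_carrier[OF W1] L2_carrier[OF W2])
  have "ip (P_operator p q s bl br f) g = ip (mult_op (Delta p q s) f) g + ip (mult_op (Delta p q s) W) g"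
    unfolding P by (intro ip_add_left[of _ "p + q"] Delta_L2 f W g)
  also have "ip (mult_op (Delta p q s) f) g = ip (\<phi>_of f) (fst_part g) + ip (\<psi>_of f) (snd_part g)"
    by (rule ip_split[OF Delta_L2[OF f] g])
  also have "ip (mult_op (Delta p q s) W) g = ip (\<phi>_of W) (fst_part g) + ip (\<psi>_of W) (snd_part g)"
    by (rule ip_split[OF Delta_L2[OF W] g])
  also have "\<dots> = ip (\<Gamma> (\<psi>_of f)) (\<phi>_of g) + ip (\<Gamma>' (\<phi>_of f)) (\<psi>_of g)"
    using g12 W1 W2 by (simp add: ip_\<phi>_\<psi>(1,2)[OF W] ip_\<phi>_\<psi>(3,4)[OF g] tW bW)
  also have "ip (\<Gamma>' (\<phi>_of f)) (\<psi>_of g) = cnj (ip (\<psi>_of g) (\<Gamma>' (\<phi>_of f)))"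
    by (rule ip_cnj[OF W2 gl(2)])
  also have "\<dots> = cnj (ip (\<Gamma> (\<psi>_of g)) (\<phi>_of f))"
    by (simp only: adjoint_\<Gamma>(2)[OF fl(1) gl(2)])
  also have "\<dots> = ip (\<phi>_of f) (\<Gamma> (\<psi>_of g))"
    by (rule ip_cnj[OF fl(1) \<Gamma>_Hstar(1)[OF gl(2)], symmetric])
  finally show "ip (P_operator p q s bl br f) g
      = form (fst_part g) (snd_part g) (\<phi>_of f) (\<psi>_of f) (\<phi>_of g) (\<psi>_of g)"
    by (simp add: form_def)
qed

text \<open>
  Move \<open>\<Delta>\<close>, \<open>\<Gamma>\<close> and \<open>\<Gamma>\<^sup>*\<close> one after the other to the second argument.
\<close>

lemma P_operator_adjoint:
  assumes g: "g \<in> L2 (p + q)"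
  shows "\<exists>X\<in>L2 (p + q). \<forall>f\<in>L2 (p + q). ip (P_operator p q s bl br f) g = ip f X"
proof -
  note gl = \<phi>_\<psi>_L2[OF g] and g12 = L2_first[OF g] L2_last[OF g]
  define x where "x z = fst_part g z + \<Gamma> (\<psi>_of g) z" for z
  define y where "y z = snd_part g z + \<Gamma>' (\<phi>_of g) z" for z
  have G: "\<Gamma> (\<psi>_of g) \<in> L2 p" "\<Gamma>' (\<phi>_of g) \<in> L2 q"
    by (rule \<Gamma>_Hstar(1)[OF gl(2)], rule adjoint_\<Gamma>(1)[OF gl(1)])
  have xy: "x \<in> L2 p" "y \<in> L2 q" unfolding x_def y_def using g12 G by simp_all
  define X1 where "X1 z = x z - S y z" for z
  define X2 where "X2 z = y z - S' x z" for z
  have X12: "X1 \<in> L2 p" "X2 \<in> L2 q" unfolding X1_def X2_def using xy by simp_all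
  define X where "X z = X1 z @\<^sub>v X2 z" for z
  have X: "X \<in> L2 (p + q)" unfolding X_def by (rule L2_append[OF X12])
  have "ip (P_operator p q s bl br f) g = ip f X" if f: "f \<in> L2 (p + q)" for f
  proof -
    note fl = \<phi>_\<psi>_L2[OF f] and f12 = L2_first[OF f] L2_last[OF f]
    have "ip f X = ip (fst_part f) X1 + ip (snd_part f) X2"
    proof -
      have "ip (fst_part f) (fst_part X) = ip (fst_part f) X1"
        by (rule ip_cong_right) (auto simp: X_def first_append dest: L2_carrier[OF X12(1)])
      moreover have "ip (snd_part f) (snd_part X) = ip (snd_part f) X2"
        by (rule ip_cong_right) (auto simp: X_def intro!: last_append dest: L2_carrier[OF X12(1)] L2_carrier[OF X12(2)])
      ultimately show ?thesis using ip_split[OF f X] by simp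
    qed
    also have "\<dots> = ip (\<phi>_of f) x + ip (\<psi>_of f) y"
      unfolding X1_def X2_def using f12 xy
      by (simp add: ip_minus_right[of _ p] ip_minus_right[of _ q] ip_\<phi>_\<psi>(1,2)[OF f])
    also have "ip (\<phi>_of f) x = ip (\<phi>_of f) (fst_part g) + ip (\<phi>_of f) (\<Gamma> (\<psi>_of g))"
      unfolding x_def by (rule ip_add_right[OF g12(1) G(1) fl(1)])
    also have "ip (\<psi>_of f) y = ip (\<psi>_of f) (snd_part g) + ip (\<psi>_of f) (\<Gamma>' (\<phi>_of g))"
      unfolding y_def by (rule ip_add_right[OF g12(2) G(2) fl(2)])
    also have "ip (\<psi>_of f) (\<Gamma>' (\<phi>_of g)) = ip (\<Gamma> (\<psi>_of f)) (\<phi>_of g)"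
      by (rule adjoint_\<Gamma>(2)[OF gl(1) fl(2), symmetric])
    finally show ?thesis by (simp add: ip_P_operator(2)[OF f g] form_def)
  qed
  then show ?thesis using X by blast
qed

text \<open>
  The scalar product of \<open>F v\<close> with a function \<open>Y\<close> is that of \<open>v\<close> with the mean of \<open>F\<^sup>* Y\<close>.  Hence the form is
  represented by vectors in both arguments.
\<close>

lemma Pmat_form:
  assumes F: "F \<in> Linf (p + q) n"
  shows "Pmat p q n s bl br F \<in> carrier_mat n n"
    and "u \<in> carrier_vec n \<Longrightarrow> v \<in> carrier_vec n \<Longrightarrow>
      (Pmat p q n s bl br F *\<^sub>v u) \<bullet>c v
      = ip (P_operator p q s bl br (\<lambda>z. F z *\<^sub>v u)) (\<lambda>z. F z *\<^sub>v v)"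
proof -
  have FL: "(\<lambda>z. F z *\<^sub>v u) \<in> L2 (p + q)" if "u \<in> carrier_vec n" for u
    using L2_mult_op[OF F L2_const[OF that]] by (simp add: mult_op_def)
  have right: "ip Y (\<lambda>z. F z *\<^sub>v v) = mean n (mult_op (adj F) Y) \<bullet>c v"
    if "v \<in> carrier_vec n" "Y \<in> L2 (p + q)" for v Y
  proof -
    have "ip Y (\<lambda>z. F z *\<^sub>v v) = ip Y (mult_op F (\<lambda>_. v))" by (simp add: mult_op_def)
    also have "\<dots> = ip (mult_op (adj F) Y) (\<lambda>_. v)"
      by (rule ip_mult_op'[OF F that(2) L2_const[OF that(1)], symmetric])
    also have "\<dots> = mean n (mult_op (adj F) Y) \<bullet>c v"
      by (rule ip_const_right[OF L2_mult_op[OF Linf_adj[OF F] that(2)] that(1)])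
    finally show ?thesis .
  qed
  have left: "ip (\<lambda>z. F z *\<^sub>v u) Y = u \<bullet>c mean n (mult_op (adj F) Y)"
    if "u \<in> carrier_vec n" "Y \<in> L2 (p + q)" for u Y
    using right[OF that] ip_cnj[OF FL[OF that(1)] that(2)] that(1)
    by (simp add: cscalar_prod_sum[of _ n] mult.commute)
  have ex: "\<exists>!P. P \<in> carrier_mat n n \<and> (\<forall>u\<in>carrier_vec n. \<forall>v\<in>carrier_vec n. (P *\<^sub>v u) \<bullet>c v
      = ip (P_operator p q s bl br (\<lambda>z. F z *\<^sub>v u)) (\<lambda>z. F z *\<^sub>v v))"
  proof (rule sesquilinear_matrix)
    fix v :: "complex vec" assume v: "v \<in> carrier_vec n"
    obtain X where X: "X \<in> L2 (p + q)"
      "\<And>f. f \<in> L2 (p + q) \<Longrightarrow> ip (P_operator p q s bl br f) (\<lambda>z. F z *\<^sub>v v) = ip f X"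
      using P_operator_adjoint[OF FL[OF v]] by blast
    show "\<exists>w\<in>carrier_vec n. \<forall>u\<in>carrier_vec n.
        ip (P_operator p q s bl br (\<lambda>z. F z *\<^sub>v u)) (\<lambda>z. F z *\<^sub>v v) = u \<bullet>c w"
    proof (intro bexI ballI)
      fix u :: "complex vec" assume u: "u \<in> carrier_vec n"
      show "ip (P_operator p q s bl br (\<lambda>z. F z *\<^sub>v u)) (\<lambda>z. F z *\<^sub>v v)
          = u \<bullet>c mean n (mult_op (adj F) X)"
        by (rule trans[OF X(2)[OF FL[OF u]] left[OF u X(1)]])
    qed simp
  next
    fix u :: "complex vec" assume u: "u \<in> carrier_vec n"
    show "\<exists>w\<in>carrier_vec n. \<forall>v\<in>carrier_vec n.
        ip (P_operator p q s bl br (\<lambda>z. F z *\<^sub>v u)) (\<lambda>z. F z *\<^sub>v v) = w \<bullet>c v"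
    proof (intro bexI ballI)
      fix v :: "complex vec" assume v: "v \<in> carrier_vec n"
      show "ip (P_operator p q s bl br (\<lambda>z. F z *\<^sub>v u)) (\<lambda>z. F z *\<^sub>v v)
          = mean n (mult_op (adj F) (P_operator p q s bl br (\<lambda>z. F z *\<^sub>v u))) \<bullet>c v"
        by (rule right[OF v ip_P_operator(1)[OF FL[OF u] FL[OF u]]])
    qed simp
  qed
  note PF = theI'[OF ex, folded Pmat_def]
  show "Pmat p q n s bl br F \<in> carrier_mat n n" by (rule PF[THEN conjunct1])
  show "(Pmat p q n s bl br F *\<^sub>v u) \<bullet>c v
      = ip (P_operator p q s bl br (\<lambda>z. F z *\<^sub>v u)) (\<lambda>z. F z *\<^sub>v v)"
    if "u \<in> carrier_vec n" "v \<in> carrier_vec n"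
    by (rule PF[THEN conjunct2, THEN bspec, OF that(1), THEN bspec, OF that(2)])
qed

text \<open>
  Because of \<open>b\<^sub>l s = s\<^sub>l\<close> and \<open>s b\<^sub>r = s\<^sub>r\<close> on the circle, \<open>[b\<^sub>l, -s\<^sub>l] f = b\<^sub>l \<phi>\<close> and
  \<open>[-s\<^sub>r\<^sup>*, b\<^sub>r\<^sup>*] f = b\<^sub>r\<^sup>* \<psi>\<close>.
\<close>

lemma admissible_of:
  assumes f: "f \<in> L2 (p + q)"
    and l: "(\<lambda>z. hcat (bl z) (- sl z) *\<^sub>v f z) \<in> H2 p"
    and r: "(\<lambda>z. hcat (- mat_adjoint (sr z)) (mat_adjoint (br z)) *\<^sub>v f z) \<in> H2perp q"
  shows "admissible (fst_part f) (snd_part f) (\<phi>_of f) (\<psi>_of f)"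
  unfolding admissible_def
proof (intro conjI ballI)
  note f12 = L2_first[OF f] L2_last[OF f] and fl = \<phi>_\<psi>_L2[OF f]
  show "fst_part f \<in> L2 p" "snd_part f \<in> L2 q" "\<phi>_of f \<in> L2 p" "\<psi>_of f \<in> L2 q" by (fact f12 fl)+
  show "x \<in> L2 p \<Longrightarrow> ip (\<phi>_of f) x = ip (fst_part f) x - ip (snd_part f) (S' x)" for x
    by (rule ip_\<phi>_\<psi>(1)[OF f])
  show "y \<in> L2 q \<Longrightarrow> ip (\<psi>_of f) y = ip (snd_part f) y - ip (fst_part f) (S y)" for y
    by (rule ip_\<phi>_\<psi>(2)[OF f])
  show "B (\<phi>_of f) \<in> H2 p"
  proof (rule H2_ae[OF l _ B_L2[OF fl(1)]])
    show "ae_eq (\<lambda>z. hcat (bl z) (- sl z) *\<^sub>v f z) (B (\<phi>_of f))"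
      unfolding ae_eq_def using bl_s
    proof eventually_elim
      case (elim t)
      let ?z = "cis t"
      have c: "bl ?z \<in> carrier_mat p p" "sl ?z \<in> carrier_mat p q" "s ?z \<in> carrier_mat p q"
        "f ?z \<in> carrier_vec (p + q)"
        using bl_Linf sl_Linf s f by auto
      have c': "vec_first (f ?z) p \<in> carrier_vec p" "vec_last (f ?z) q \<in> carrier_vec q"
        "s ?z *\<^sub>v vec_last (f ?z) q \<in> carrier_vec p" using c(3) by auto
      have "B (\<phi>_of f) ?z = bl ?z *\<^sub>v (vec_first (f ?z) p - s ?z *\<^sub>v vec_last (f ?z) q)"
        using \<phi>_apply(1)[OF f, of ?z] by (simp add: mult_op_def)
      also have "\<dots> = bl ?z *\<^sub>v vec_first (f ?z) p - bl ?z *\<^sub>v (s ?z *\<^sub>v vec_last (f ?z) q)"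
        by (rule mult_minus_distrib_mat_vec[OF c(1) c'(1,3)])
      also have "bl ?z *\<^sub>v (s ?z *\<^sub>v vec_last (f ?z) q) = sl ?z *\<^sub>v vec_last (f ?z) q"
        using assoc_mult_mat_vec[OF c(1,3) c'(2)] elim by simp
      also have "bl ?z *\<^sub>v vec_first (f ?z) p - sl ?z *\<^sub>v vec_last (f ?z) q
          = hcat (bl ?z) (- sl ?z) *\<^sub>v f ?z"
        using hcat_mult_vec[OF c(1) uminus_carrier_mat[OF c(2)] c(4)] c
        by (intro eq_vecI) (auto simp: uminus_mult_mat_vec)
      finally show ?case ..
    qed
  qed
  show "R' (\<psi>_of f) \<in> H2perp q"
  proof (rule H2perp_ae[OF r _ R'_L2[OF fl(2)]])
    show "ae_eq (\<lambda>z. hcat (- mat_adjoint (sr z)) (mat_adjoint (br z)) *\<^sub>v f z) (R' (\<psi>_of f))"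
      unfolding ae_eq_def using s_br
    proof eventually_elim
      case (elim t)
      let ?z = "cis t"
      have c: "br ?z \<in> carrier_mat q q" "sr ?z \<in> carrier_mat p q" "s ?z \<in> carrier_mat p q"
        "f ?z \<in> carrier_vec (p + q)"
        using br_Linf sr_Linf s f by auto
      note ca = mat_adjoint_carrier[OF c(1)] mat_adjoint_carrier[OF c(2)] mat_adjoint_carrier[OF c(3)]
      have c': "vec_first (f ?z) p \<in> carrier_vec p" "vec_last (f ?z) q \<in> carrier_vec q"
        "mat_adjoint (s ?z) *\<^sub>v vec_first (f ?z) p \<in> carrier_vec q" using ca(3) by auto
      have adj: "mat_adjoint (br ?z) * mat_adjoint (s ?z) = mat_adjoint (sr ?z)"
        using mat_adjoint_mult[OF c(3,1)] elim by simp
      have "R' (\<psi>_of f) ?z = mat_adjoint (br ?z) *\<^sub>v (vec_last (f ?z) q - mat_adjoint (s ?z) *\<^sub>v vec_first (f ?z) p)"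
        using \<phi>_apply(2)[OF f, of ?z] by (simp add: mult_op_def)
      also have "\<dots> = mat_adjoint (br ?z) *\<^sub>v vec_last (f ?z) q
          - mat_adjoint (br ?z) *\<^sub>v (mat_adjoint (s ?z) *\<^sub>v vec_first (f ?z) p)"
        by (rule mult_minus_distrib_mat_vec[OF ca(1) c'(2,3)])
      also have "mat_adjoint (br ?z) *\<^sub>v (mat_adjoint (s ?z) *\<^sub>v vec_first (f ?z) p)
          = mat_adjoint (sr ?z) *\<^sub>v vec_first (f ?z) p"
        using assoc_mult_mat_vec[OF ca(1,3) c'(1)] adj by simp
      also have "mat_adjoint (br ?z) *\<^sub>v vec_last (f ?z) q - mat_adjoint (sr ?z) *\<^sub>v vec_first (f ?z) p
          = hcat (- mat_adjoint (sr ?z)) (mat_adjoint (br ?z)) *\<^sub>v f ?z"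
        using hcat_mult_vec[OF uminus_carrier_mat[OF ca(2)] ca(1) c(4)] c
        by (intro eq_vecI) (auto simp: uminus_mult_mat_vec)
      finally show ?case ..
    qed
  qed
qed

text \<open>
  Both sides are compared as sesquilinear forms: for vectors \<open>u, v\<close> the functions \<open>F M u, F N u\<close> and \<open>F M v, F N v\<close>
  are related by the constants \<open>C u\<close> and \<open>C v\<close>.
\<close>

lemma lyapunov_stein:
  assumes F: "F \<in> Linf (p + q) n" and M: "M \<in> carrier_mat n n" and N: "N \<in> carrier_mat n n"
    and C: "C \<in> carrier_mat (p + q) n"
    and FMN: "\<And>z. cmod z = 1 \<Longrightarrow> F z * (M - z \<cdot>\<^sub>m N) = C"
    and l: "\<And>u. u \<in> carrier_vec n \<Longrightarrow> (\<lambda>z. hcat (bl z) (- sl z) *\<^sub>v (F z *\<^sub>v u)) \<in> H2 p"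
    and r: "\<And>u. u \<in> carrier_vec n \<Longrightarrow>
      (\<lambda>z. hcat (- mat_adjoint (sr z)) (mat_adjoint (br z)) *\<^sub>v (F z *\<^sub>v u)) \<in> H2perp q"
  shows "mat_adjoint M * Pmat p q n s bl br F * M - mat_adjoint N * Pmat p q n s bl br F * N
     = mat_adjoint C * jmat p q * C"
proof -
  define P where "P = Pmat p q n s bl br F"
  note Pc = Pmat_form(1)[OF F, folded P_def] and Pf = Pmat_form(2)[OF F, folded P_def]
  have FL: "(\<lambda>z. F z *\<^sub>v u) \<in> L2 (p + q)" if "u \<in> carrier_vec n" for u
    using L2_mult_op[OF F L2_const[OF that]] by (simp add: mult_op_def)
  have st: "step (vec_first (C *\<^sub>v u) p) (vec_last (C *\<^sub>v u) q)
      (fst_part (\<lambda>z. F z *\<^sub>v (N *\<^sub>v u))) (snd_part (\<lambda>z. F z *\<^sub>v (N *\<^sub>v u)))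
      (fst_part (\<lambda>z. F z *\<^sub>v (M *\<^sub>v u))) (snd_part (\<lambda>z. F z *\<^sub>v (M *\<^sub>v u)))"
    if u: "u \<in> carrier_vec n" for u
    unfolding step_def
  proof (intro allI impI)
    fix z :: complex assume z: "cmod z = 1"
    have Fc: "F z \<in> carrier_mat (p + q) n" by (rule Linf_carrier[OF F z])
    have v: "M *\<^sub>v u \<in> carrier_vec n" "N *\<^sub>v u \<in> carrier_vec n" using M N u by auto
    have w: "F z *\<^sub>v (M *\<^sub>v u) \<in> carrier_vec (p + q)" "F z *\<^sub>v (N *\<^sub>v u) \<in> carrier_vec (p + q)"
      using Fc v by auto
    have "C *\<^sub>v u = (F z * (M - z \<cdot>\<^sub>m N)) *\<^sub>v u" by (simp add: FMN[OF z])
    also have "\<dots> = F z *\<^sub>v ((M - z \<cdot>\<^sub>m N) *\<^sub>v u)"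
      by (rule assoc_mult_mat_vec[OF Fc minus_carrier_mat[OF smult_carrier_mat[OF N]] u])
    also have "(M - z \<cdot>\<^sub>m N) *\<^sub>v u = M *\<^sub>v u - z \<cdot>\<^sub>v (N *\<^sub>v u)"
      using minus_mult_distrib_mat_vec[OF M smult_carrier_mat[OF N] u] smult_mat_vec[OF N u] by simp
    also have "F z *\<^sub>v \<dots> = F z *\<^sub>v (M *\<^sub>v u) - z \<cdot>\<^sub>v (F z *\<^sub>v (N *\<^sub>v u))"
      using mult_minus_distrib_mat_vec[OF Fc v(1) smult_carrier_vec[THEN iffD2, OF v(2)], of z]
        mult_mat_vec[OF Fc v(2)] by simp
    finally have Cu: "C *\<^sub>v u = F z *\<^sub>v (M *\<^sub>v u) - z \<cdot>\<^sub>v (F z *\<^sub>v (N *\<^sub>v u))" .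
    have i: "(F z *\<^sub>v (M *\<^sub>v u)) $ i = (C *\<^sub>v u) $ i + z * (F z *\<^sub>v (N *\<^sub>v u)) $ i" if "i < p + q" for i
      proof -
      have "dim_vec (F z *\<^sub>v (M *\<^sub>v u)) = p + q" "dim_vec (F z *\<^sub>v (N *\<^sub>v u)) = p + q" using w by (auto simp only: carrier_vec_def mem_Collect_eq)
      then show ?thesis unfolding Cu using that by (simp del: index_mult_mat_vec dim_mult_mat_vec)
    qed
    have Cc: "C *\<^sub>v u \<in> carrier_vec (p + q)" using C u by simp
    show "vec_first (F z *\<^sub>v (M *\<^sub>v u)) p = vec_first (C *\<^sub>v u) p + z \<cdot>\<^sub>v vec_first (F z *\<^sub>v (N *\<^sub>v u)) p \<and>
      vec_last (F z *\<^sub>v (M *\<^sub>v u)) q = vec_last (C *\<^sub>v u) q + z \<cdot>\<^sub>v vec_last (F z *\<^sub>v (N *\<^sub>v u)) q"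
      using i Cc w
      by (intro conjI eq_vecI)
        (simp_all add: vec_last_index(2) vec_last_index(1)[of _ p q] del: index_mult_mat_vec)
  qed
  have adm: "admissible (fst_part (\<lambda>z. F z *\<^sub>v u)) (snd_part (\<lambda>z. F z *\<^sub>v u)) (\<phi>_of (\<lambda>z. F z *\<^sub>v u)) (\<psi>_of (\<lambda>z. F z *\<^sub>v u))"
    if "u \<in> carrier_vec n" for u
    by (rule admissible_of[OF FL[OF that] l[OF that] r[OF that]])
  have key: "(P *\<^sub>v (M *\<^sub>v u)) \<bullet>c (M *\<^sub>v v) - (P *\<^sub>v (N *\<^sub>v u)) \<bullet>c (N *\<^sub>v v)
      = vec_first (C *\<^sub>v u) p \<bullet>c vec_first (C *\<^sub>v v) p - vec_last (C *\<^sub>v u) q \<bullet>c vec_last (C *\<^sub>v v) q"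
    if u: "u \<in> carrier_vec n" and v: "v \<in> carrier_vec n" for u v
  proof -
    have c: "M *\<^sub>v u \<in> carrier_vec n" "N *\<^sub>v u \<in> carrier_vec n" "M *\<^sub>v v \<in> carrier_vec n" "N *\<^sub>v v \<in> carrier_vec n"
      using M N u v by auto
    show ?thesis
      unfolding Pf[OF c(1,3)] Pf[OF c(2,4)] ip_P_operator(2)[OF FL[OF c(1)] FL[OF c(3)]]
        ip_P_operator(2)[OF FL[OF c(2)] FL[OF c(4)]]
      by (rule form_difference[OF adm[OF c(1)] adm[OF c(2)] st[OF u] vec_first_carrier vec_last_carrier
          adm[OF c(3)] adm[OF c(4)] st[OF v] vec_first_carrier vec_last_carrier])
  qed
  have J: "(jmat p q *\<^sub>v a) \<bullet>c b = vec_first a p \<bullet>c vec_first b p - vec_last a q \<bullet>c vec_last b q"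
    if a: "a \<in> carrier_vec (p + q)" and b: "b \<in> carrier_vec (p + q)" for a b
  proof -
    have "jmat p q *\<^sub>v (vec_first a p @\<^sub>v vec_last a q)
      = (1\<^sub>m p *\<^sub>v vec_first a p + 0\<^sub>m p q *\<^sub>v vec_last a q)
        @\<^sub>v (0\<^sub>m q p *\<^sub>v vec_first a p + - 1\<^sub>m q *\<^sub>v vec_last a q)"
      unfolding jmat_def by (rule four_block_mat_mult_vec) auto
    also have "1\<^sub>m p *\<^sub>v vec_first a p + 0\<^sub>m p q *\<^sub>v vec_last a q = vec_first a p"
      by (intro eq_vecI) auto
    also have "0\<^sub>m q p *\<^sub>v vec_first a p + - 1\<^sub>m q *\<^sub>v vec_last a q = - vec_last a q"
      by (intro eq_vecI) (auto simp: uminus_mult_mat_vec)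
    finally have eq: "jmat p q *\<^sub>v a = vec_first a p @\<^sub>v - vec_last a q" using a by simp
    have "vec_first a p @\<^sub>v - vec_last a q \<in> carrier_vec (p + q)" by simp
    from cscalar_prod_split[OF this b] show ?thesis
      unfolding eq by (simp add: first_append last_append[of _ p] cscalar_prod_sum[of _ q] sum_negf)
  qed
  have jc: "jmat p q \<in> carrier_mat (p + q) (p + q)" by (simp add: jmat_def)
  have adj: "((mat_adjoint X * Q * X) *\<^sub>v u) \<bullet>c v = (Q *\<^sub>v (X *\<^sub>v u)) \<bullet>c (X *\<^sub>v v)"
    if X: "X \<in> carrier_mat m n" and Q: "Q \<in> carrier_mat m m"
      and u: "u \<in> carrier_vec n" and v: "v \<in> carrier_vec n" for X Q :: "complex mat" and u v m
  proof -
    have Xu: "X *\<^sub>v u \<in> carrier_vec m" using X u by simp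
    have QXu: "Q *\<^sub>v (X *\<^sub>v u) \<in> carrier_vec m" using Q Xu by simp
    have "(mat_adjoint X * Q * X) *\<^sub>v u = mat_adjoint X *\<^sub>v (Q *\<^sub>v (X *\<^sub>v u))"
      using assoc_mult_mat_vec[OF mult_carrier_mat[OF mat_adjoint_carrier[OF X] Q] X u]
        assoc_mult_mat_vec[OF mat_adjoint_carrier[OF X] Q Xu] by simp
    then show ?thesis
      using cscalar_prod_mat_left[OF mat_adjoint_carrier[OF X] QXu v] by simp
  qed
  have MP: "mat_adjoint M * P * M \<in> carrier_mat n n" and NP: "mat_adjoint N * P * N \<in> carrier_mat n n"
    and CJ: "mat_adjoint C * jmat p q * C \<in> carrier_mat n n"
    using M N C Pc jc by auto
  have "mat_adjoint M * P * M - mat_adjoint N * P * N = mat_adjoint C * jmat p q * C"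
  proof (rule eq_matI)
    fix i j assume "i < dim_row (mat_adjoint C * jmat p q * C)" "j < dim_col (mat_adjoint C * jmat p q * C)"
    then have ij: "i < n" "j < n" using CJ by auto
    have entry: "X $$ (i, j) = (X *\<^sub>v unit_vec n j) \<bullet>c unit_vec n i" if X: "X \<in> carrier_mat n n" for X :: "complex mat"
    proof -
      have "X *\<^sub>v unit_vec n j \<in> carrier_vec n" using X by simp
      then show ?thesis using X ij by simp
    qed
    have uc: "unit_vec n j \<in> carrier_vec n" "unit_vec n i \<in> carrier_vec n" by auto
    have Cu: "C *\<^sub>v unit_vec n j \<in> carrier_vec (p + q)" "C *\<^sub>v unit_vec n i \<in> carrier_vec (p + q)"
      using C by auto
    have "(mat_adjoint M * P * M - mat_adjoint N * P * N) $$ (i, j)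
       = (mat_adjoint M * P * M) $$ (i, j) - (mat_adjoint N * P * N) $$ (i, j)"
      by (rule index_minus_mat(1)) (simp_all only: carrier_matD[OF NP] ij)
    also have "\<dots> = (mat_adjoint C * jmat p q * C) $$ (i, j)"
      unfolding entry[OF MP] entry[OF NP] entry[OF CJ] adj[OF M Pc uc] adj[OF N Pc uc] adj[OF C jc uc]
        J[OF Cu] by (rule key[OF uc])
    finally show "(mat_adjoint M * P * M - mat_adjoint N * P * N) $$ (i, j)
      = (mat_adjoint C * jmat p q * C) $$ (i, j)" .
  qed (simp_all only: carrier_matD[OF CJ] carrier_matD[OF minus_carrier_mat[OF NP]])
  then show ?thesis by (simp add: P_def)
qed

end

theorem theorem3p3:
  fixes p q n1 n2 n \<kappa> :: nat
    and A1 A2 C M N :: "complex mat"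
    and F s sl sr bl br :: "complex \<Rightarrow> complex mat"
  assumes "p \<ge> 1" "q \<ge> 1" "n = n1 + n2" "n \<ge> 1"
    and "A1 \<in> carrier_mat n1 n1" "A2 \<in> carrier_mat n2 n2" "C \<in> carrier_mat (p + q) n"
    and "spectrum A1 \<union> spectrum A2 \<subseteq> ball 0 1"
    and "M = Mmat n1 n2 A1" "N = Nmat n1 n2 A2" "F = Fmat C M N"
    and "s \<in> gen_schur \<kappa> p q"
    and "left_KL \<kappa> p q s bl sl" "right_KL \<kappa> p q s br sr"
    and "bdry_values p q s" "bdry_values p q sl" "bdry_values p q sr"
    and "\<And>u. u \<in> carrier_vec n \<Longrightarrow> (\<lambda>z. hcat (bl z) (- sl z) *\<^sub>v (F z *\<^sub>v u)) \<in> H2 p"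
    and "\<And>u. u \<in> carrier_vec n \<Longrightarrow>
           (\<lambda>z. hcat (- mat_adjoint (sr z)) (mat_adjoint (br z)) *\<^sub>v (F z *\<^sub>v u)) \<in> H2perp q"
  shows "mat_adjoint M * Pmat p q n s bl br F * M - mat_adjoint N * Pmat p q n s bl br F * N
           = mat_adjoint C * jmat p q * C"
proof -
  have s: "meromorphic_mvf p q s" using assms(12) by (simp add: gen_schur_def)
  have bl: "bp_product \<kappa> p bl" and sl_schur: "sl \<in> schur_class p q"
    and kl_l: "\<And>z. z \<in> hol_domain p q s \<Longrightarrow> invertible_mat (bl z) \<Longrightarrow> s z = minv (bl z) * sl z"
    and cop: "\<And>z. z \<in> ball 0 1 \<Longrightarrow> vec_space.rank p (hcat (bl z) (sl z)) = p"
    using assms(13) unfolding left_KL_def by blast+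
  have br: "bp_product \<kappa> q br" and sr_schur: "sr \<in> schur_class p q"
    and kl_r: "\<And>z. z \<in> hol_domain p q s \<Longrightarrow> invertible_mat (br z) \<Longrightarrow> s z = sr z * minv (br z)"
    using assms(14) unfolding right_KL_def by blast+
  note bl_inner = bp_product_structure(1)[OF bl] and br_inner = bp_product_structure(1)[OF br]
  note sl = schur_Hinf[OF sl_schur assms(16)] and sr = schur_Hinf[OF sr_schur assms(17)]
  have bl_s: "AE t in circ. bl (cis t) * s (cis t) = sl (cis t)"
    by (rule left_KL_boundary[OF s assms(15) bl_inner sl kl_l])
  have s_br: "AE t in circ. s (cis t) * br (cis t) = sr (cis t)"
    by (rule right_KL_boundary[OF s assms(15) br_inner sr kl_r])
  have sc: "s z \<in> carrier_mat p q" if "cmod z = 1" for z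
    using assms(15) that by (simp add: bdry_values_def)
  \<comment> \<open>\<open>s = b\<^sub>l\<^sup>* s\<^sub>l\<close> almost everywhere on the circle\<close>
  have sb: "s \<in> Linf p q"
  proof (rule Linf_AE[OF Linf_mult[OF Linf_adj[OF inner_Linf[OF bl_inner]] Hinf_Linf[OF sl]] _ sc])
    show "AE t in circ. mat_adjoint (bl (cis t)) * sl (cis t) = s (cis t)"
      using bl_s
    proof eventually_elim
      case (elim t)
      have c: "bl (cis t) \<in> carrier_mat p p" by (rule inner_carrier[OF bl_inner]) simp
      have "mat_adjoint (bl (cis t)) * sl (cis t) = (mat_adjoint (bl (cis t)) * bl (cis t)) * s (cis t)"
        using assoc_mult_mat[OF mat_adjoint_carrier[OF c] c sc[of "cis t"]] elim by simp
      then show ?case using inner_unitary(1)[OF bl_inner, of "cis t"] sc[of "cis t"] by simp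
    qed
  qed
  interpret krein_langer p q \<kappa> s bl br sl sr
    by (rule krein_langer.intro[OF bl br sl sr sb bl_s s_br cop])
  have M: "M \<in> carrier_mat n n" and N: "N \<in> carrier_mat n n"
    using assms(3,5,6,9,10) by (auto simp: Mmat_def Nmat_def)
  have d: "Determinant.det (M - z \<cdot>\<^sub>m N) \<noteq> 0" if "cmod z = 1" for z
    using pencil_det_nonzero[OF assms(5,6,8) that] assms(9,10) by simp
  show ?thesis
    by (rule lyapunov_stein[OF Fmat_Linf(1)[OF M N assms(7) d, folded assms(11)] M N assms(7)
          Fmat_Linf(2)[OF M N assms(7) d, folded assms(11)] assms(18,19)])
qed

end
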